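(* Let $M\in\mathfrak{M}$, $A\in\mathbb{P}$ and $f(X)=M(A,X)$ for $X\in\mathbb{P}$. (a) If $M$ is not the right trivial mean (the mean with $M(C,B)=B$ for all $B,C\in\mathbb{P}$), then $f$ is a strict contraction on $\overline{B}_A(r)$ for all $0<r<\infty$, i.e. there exists $0<\rho_r<1$ such that $$d_\infty(f(X),f(Y))\le\rho_r\, d_\infty(X,Y)$$ for all $X,Y\in\overline{B}_A(r)$. (b) If $M$ is the right trivial mean, then $f$ is nonexpansive on $\mathbb{P}$, that is, $d_\infty(f(X),f(Y))\le d_\infty(X,Y)$ for all $A,X,Y\in\mathbb{P}$.
   Context: $E$ is a (possibly infinite-dimensional) complex Hilbert space, $S(E)$ the Banach space of bounded self-adjoint operators, and $\mathbb{P}\subseteq S(E)$ the cone of positive definite operators, $\mathbb{P}=\bigcup_{k\ge1}\{X\in S(E):\frac1kI\le X\le kI\}$, where $A\le B$ means $B-A$ is positive semidefinite. A function $f:(0,\infty)\to\mathbb{R}$ is operator monotone if $A\le B$ implies $f(A)\le f(B)$ for all positive definite operators (on any Hilbert space; equivalently, for positive definite matrices of all sizes). $\mathfrak{M}$ is the set of operator means: maps $M:\mathbb{P}\times\mathbb{P}\to\mathbb{P}$ of the form $M(A,B)=A^{1/2}g(A^{-1/2}BA^{-1/2})A^{1/2}$ with $g:(0,\infty)\to(0,\infty)$ operator monotone and $g(1)=1$. The Thompson metric on $\mathbb{P}$ is $d_\infty(A,B)=\max\{\log M(A/B),\log M(B/A)\}$ with $M(A/B)=\inf\{\alpha>0:A\le\alpha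 B\}$, and $\overline{B}_A(r)=\{X\in\mathbb{P}:d_\infty(A,X)\le r\}$. *)

theory Defs
  imports
    "HOL-Analysis.Bounded_Linear_Function"
    "HOL-Computational_Algebra.Polynomial"
    "HOL-Library.Complex_Order"
    "Jordan_Normal_Form.Schur_Decomposition"
begin

section \<open>Complex Hilbert spaces and bounded operators\<close>

text \<open>The inner product is linear in its first argument.  The last axiom says that the norm is
  the one induced by the inner product, and contains positive definiteness.\<close>

class chilbert_space = banach +
  fixes scaleC :: "complex \<Rightarrow> 'a \<Rightarrow> 'a"  (infixr "*\<^sub>C" 75)
    and cinner :: "'a \<Rightarrow> 'a \<Rightarrow> complex"
  assumes scaleC_add_right: "a *\<^sub>C (x + y) = a *\<^sub>C x + a *\<^sub>C y"
    and scaleC_add_left: "(a + b) *\<^sub>C x = a *\<^sub>C x + b *\<^sub>C x"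
    and scaleC_scaleC: "a *\<^sub>C b *\<^sub>C x = (a * b) *\<^sub>C x"
    and scaleC_of_real: "complex_of_real r *\<^sub>C x = r *\<^sub>R x"
    and cinner_commute: "cinner x y = cnj (cinner y x)"
    and cinner_add_left: "cinner (x + y) z = cinner x z + cinner y z"
    and cinner_scaleC_left: "cinner (a *\<^sub>C x) y = a * cinner x y"
    and cinner_norm: "cinner x x = complex_of_real ((norm x)\<^sup>2)"

text \<open>The type of \<open>blinfun\<close> contains all real-linear bounded maps, so complex linearity is
  part of the definition of \<open>S(E)\<close>.\<close>

definition selfadj :: "('a::chilbert_space \<Rightarrow>\<^sub>L 'a) set" where
  "selfadj = {T :: 'a \<Rightarrow>\<^sub>L 'a. (\<forall>a x. T (a *\<^sub>C x) = a *\<^sub>C T x) \<and> (\<forall>x y. cinner (T x) y = cinner x (T y))}"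

definition psd_op :: "('a::chilbert_space \<Rightarrow>\<^sub>L 'a) \<Rightarrow> bool" where
  "psd_op T \<longleftrightarrow> T \<in> selfadj \<and> (\<forall>x. 0 \<le> cinner (T x) x)"

definition op_le :: "('a::chilbert_space \<Rightarrow>\<^sub>L 'a) \<Rightarrow> ('a \<Rightarrow>\<^sub>L 'a) \<Rightarrow> bool" where
  "op_le A B \<longleftrightarrow> psd_op (B - A)"

definition posdef_ops :: "('a::chilbert_space \<Rightarrow>\<^sub>L 'a) set" where
  "posdef_ops = (\<Union>k\<in>{1::nat..}. {X \<in> selfadj.
     op_le ((1 / real k) *\<^sub>R id_blinfun) X \<and> op_le X (real k *\<^sub>R id_blinfun)})"


section \<open>Continuous functional calculus on \<open>S(E)\<close>\<close>

text \<open>A bounded inverse \<open>R\<close> of the complex-linear map \<open>T - z\<close> is automatically complex linear.\<close>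

definition op_spectrum :: "('a::chilbert_space \<Rightarrow>\<^sub>L 'a) \<Rightarrow> complex set" where
  "op_spectrum T = {z. \<not> (\<exists>R :: 'a \<Rightarrow>\<^sub>L 'a.
     (\<forall>x. R (T x - z *\<^sub>C x) = x) \<and> (\<forall>x. T (R x) - z *\<^sub>C R x = x))}"

definition poly_op :: "real poly \<Rightarrow> ('a::chilbert_space \<Rightarrow>\<^sub>L 'a) \<Rightarrow> ('a \<Rightarrow>\<^sub>L 'a)" where
  "poly_op p T = (\<Sum>i\<le>degree p. coeff p i *\<^sub>R (((o\<^sub>L) T) ^^ i) id_blinfun)"

text \<open>For self-adjoint \<open>T\<close> and \<open>f\<close> continuous on the spectrum (which is then real), \<open>f(T)\<close> is
  the norm limit of \<open>p\<^sub>n(T)\<close> for any real polynomials \<open>p\<^sub>n\<close> converging to \<open>f\<close> uniformly on the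
  spectrum.  Outside this situation the value is meaningless.\<close>

definition op_fun :: "(real \<Rightarrow> real) \<Rightarrow> ('a::chilbert_space \<Rightarrow>\<^sub>L 'a) \<Rightarrow> ('a \<Rightarrow>\<^sub>L 'a)" where
  "op_fun f T = (THE S. \<exists>p :: nat \<Rightarrow> real poly.
     uniform_limit {t. complex_of_real t \<in> op_spectrum T} (\<lambda>n. poly (p n)) f sequentially \<and>
     (\<lambda>n. poly_op (p n) T) \<longlonglongrightarrow> S)"

definition op_powr :: "('a::chilbert_space \<Rightarrow>\<^sub>L 'a) \<Rightarrow> real \<Rightarrow> ('a \<Rightarrow>\<^sub>L 'a)" where
  "op_powr T s = op_fun (\<lambda>t. t powr s) T"


section \<open>Operator monotone functions\<close>

definition psd_mat :: "nat \<Rightarrow> complex mat \<Rightarrow> bool" where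
  "psd_mat n A \<longleftrightarrow> A \<in> carrier_mat n n \<and> mat_adjoint A = A \<and>
     (\<forall>v \<in> carrier_vec n. 0 \<le> (A *\<^sub>v v) \<bullet>c v)"

definition posdef_mat :: "nat \<Rightarrow> complex mat \<Rightarrow> bool" where
  "posdef_mat n A \<longleftrightarrow> A \<in> carrier_mat n n \<and> mat_adjoint A = A \<and>
     (\<forall>v \<in> carrier_vec n. v \<noteq> 0\<^sub>v n \<longrightarrow> 0 < (A *\<^sub>v v) \<bullet>c v)"

text \<open>\<open>f(A) = U diag(f(d\<^sub>1), \<dots>, f(d\<^sub>n)) U\<^sup>*\<close> for any unitary diagonalization
  \<open>A = U diag(d\<^sub>1, \<dots>, d\<^sub>n) U\<^sup>*\<close> of the Hermitian matrix \<open>A\<close>; no continuity of \<open>f\<close> is needed.\<close>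

definition mat_fun :: "nat \<Rightarrow> (real \<Rightarrow> real) \<Rightarrow> complex mat \<Rightarrow> complex mat" where
  "mat_fun n f A = (THE B. \<exists>U (d :: nat \<Rightarrow> real).
     U \<in> carrier_mat n n \<and> U * mat_adjoint U = 1\<^sub>m n \<and> mat_adjoint U * U = 1\<^sub>m n \<and>
     A = U * mat_diag n (\<lambda>i. complex_of_real (d i)) * mat_adjoint U \<and>
     B = U * mat_diag n (\<lambda>i. complex_of_real (f (d i))) * mat_adjoint U)"

text \<open>HOL cannot quantify over all Hilbert spaces (types) inside a definition, so operator
  monotonicity is stated in its form for positive definite matrices of all sizes.  Only the values
  of \<open>f\<close> on \<open>(0,\<infinity>)\<close> matter.\<close>

definition operator_monotone :: "(real \<Rightarrow> real) \<Rightarrow> bool" where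
  "operator_monotone f \<longleftrightarrow> (\<forall>n A B. posdef_mat n A \<and> posdef_mat n B \<and> psd_mat n (B - A) \<longrightarrow>
     psd_mat n (mat_fun n f B - mat_fun n f A))"


section \<open>Operator means and the Thompson metric\<close>

text \<open>Only the restriction of \<open>M\<close> to pairs of positive definite operators is relevant.\<close>

definition operator_means ::
    "(('a::chilbert_space \<Rightarrow>\<^sub>L 'a) \<Rightarrow> ('a \<Rightarrow>\<^sub>L 'a) \<Rightarrow> ('a \<Rightarrow>\<^sub>L 'a)) set" where
  "operator_means = {M. \<exists>g :: real \<Rightarrow> real.
     (\<forall>t>0. g t > 0) \<and> operator_monotone g \<and> g 1 = 1 \<and>
     (\<forall>A\<in>posdef_ops. \<forall>B\<in>posdef_ops. M A B =
        op_powr A (1/2) o\<^sub>L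
        op_fun g (op_powr A (-1/2) o\<^sub>L B o\<^sub>L op_powr A (-1/2)) o\<^sub>L
        op_powr A (1/2))}"

definition right_trivial ::
    "(('a::chilbert_space \<Rightarrow>\<^sub>L 'a) \<Rightarrow> ('a \<Rightarrow>\<^sub>L 'a) \<Rightarrow> ('a \<Rightarrow>\<^sub>L 'a)) \<Rightarrow> bool" where
  "right_trivial M \<longleftrightarrow> (\<forall>B\<in>posdef_ops. \<forall>C\<in>posdef_ops. M C B = B)"

definition thompson_ratio :: "('a::chilbert_space \<Rightarrow>\<^sub>L 'a) \<Rightarrow> ('a \<Rightarrow>\<^sub>L 'a) \<Rightarrow> real" where
  "thompson_ratio A B = Inf {\<alpha>. \<alpha> > 0 \<and> op_le A (\<alpha> *\<^sub>R B)}"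

definition thompson_dist :: "('a::chilbert_space \<Rightarrow>\<^sub>L 'a) \<Rightarrow> ('a \<Rightarrow>\<^sub>L 'a) \<Rightarrow> real" where
  "thompson_dist A B = max (ln (thompson_ratio A B)) (ln (thompson_ratio B A))"

definition thompson_cball :: "('a::chilbert_space \<Rightarrow>\<^sub>L 'a) \<Rightarrow> real \<Rightarrow> ('a \<Rightarrow>\<^sub>L 'a) set" where
  "thompson_cball A r = {X \<in> posdef_ops. thompson_dist A X \<le> r}"

end

theory Submission
  imports Defs "HOL-Analysis.Weierstrass_Theorems"
begin

text \<open>The congruence by \<open>A\<^sup>-\<^sup>1\<^sup>/\<^sup>2\<close> turns the Thompson ball around \<open>A\<close> into the order interval
  \<open>[e\<^sup>-\<^sup>r, e\<^sup>r]\<close> and the map \<open>X \<mapsto> M(A, X)\<close> into \<open>C \<mapsto> g(C)\<close>.  If \<open>C \<le> \<alpha>D\<close> and \<open>D \<le> \<alpha>C\<close> in that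
  interval, operator monotonicity gives \<open>g(C) \<le> g(\<alpha>D)\<close>, so everything reduces to a scalar estimate
  \<open>g(\<alpha>t) \<le> \<alpha>\<^sup>\<rho> g(t)\<close> on the interval, with one \<open>\<rho> < 1\<close> for all relevant \<open>\<alpha>\<close>
  (\<open>operator_monotone_contraction\<close>).  Two points carry the proof.

  Scalar part.  Comparing \<open>2 \<times> 2\<close> matrices with diagonal ones shows that \<open>g\<close> is concave
  (\<open>operator_monotone_concave\<close>), and that \<open>g(t)/t\<close> can take one value twice only if \<open>g\<close> is linear on
  the whole half-line (\<open>operator_monotone_linear\<close>).  Unless \<open>g\<close> is the identity, which is the right
  trivial case, \<open>g(t)/t\<close> is therefore strictly decreasing; a chord of the concave function \<open>g\<close> then
  bounds its logarithmic growth below that of \<open>t\<close>, uniformly on compact intervals.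

  Passage from matrices to operators.  Operator monotonicity is given for matrices, while \<open>E\<close> may have
  infinite dimension.  For a vector \<open>x\<close> and a polynomial \<open>p\<close> of degree \<open>N\<close> that is close to \<open>g\<close>, the
  number \<open>\<langle>p(C)x, x\<rangle>\<close> does not change when \<open>C\<close> is compressed to a finite-dimensional space that
  contains \<open>x, Cx, \<dots>, C\<^sup>Nx\<close>.  On a space that contains these vectors for both \<open>C\<close> and \<open>D\<close>, the
  matrix inequality applies (\<open>operator_monotone_Hilbert\<close>).

  The functional calculus rests on one estimate, \<open>\<parallel>p(T)\<parallel> \<le> sup |p|\<close> over the approximate eigenvalues of
  the self-adjoint operator \<open>T\<close> (\<open>norm_poly_op_le\<close>).\<close>

section \<open>Complex Hilbert spaces\<close>

lemma scaleC_one [simp]: "(1::complex) *\<^sub>C x = (x::'a::chilbert_space)"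
  using scaleC_of_real[of 1 x] by simp

lemma cinner_scaleR_left: "cinner (r *\<^sub>R x) y = of_real r * cinner (x::'a::chilbert_space) y"
  by (metis cinner_scaleC_left scaleC_of_real)

lemma cinner_add_right: "cinner z (x + y) = cinner z x + cinner (z::'a::chilbert_space) y"
  by (metis cinner_add_left cinner_commute complex_cnj_add)

lemma cinner_scaleC_right: "cinner x (a *\<^sub>C y) = cnj a * cinner (x::'a::chilbert_space) y"
  by (metis cinner_commute cinner_scaleC_left complex_cnj_mult)

lemma cinner_scaleR_right: "cinner x (r *\<^sub>R y) = of_real r * cinner (x::'a::chilbert_space) y"
  by (metis cinner_scaleC_right complex_cnj_complex_of_real scaleC_of_real)

lemma Re_cinner_self: "Re (cinner x x) = (norm (x::'a::chilbert_space))\<^sup>2"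
  by (simp add: cinner_norm)

lemma norm_scaleC: "norm (a *\<^sub>C x) = cmod a * norm (x::'a::chilbert_space)"
proof -
  have "complex_of_real ((norm (a *\<^sub>C x))\<^sup>2) = cinner (a *\<^sub>C x) (a *\<^sub>C x)"
    by (simp add: cinner_norm)
  also have "\<dots> = a * cnj a * cinner x x"
    by (simp add: cinner_scaleC_left cinner_scaleC_right)
  also have "\<dots> = complex_of_real ((cmod a * norm x)\<^sup>2)"
    by (simp add: cinner_norm complex_norm_square[symmetric] power_mult_distrib)
  finally have "(norm (a *\<^sub>C x))\<^sup>2 = (cmod a * norm x)\<^sup>2"
    using of_real_eq_iff by blast
  then show ?thesis by (simp add: power2_eq_iff_nonneg)
qed

lemma norm_add_sq: "(norm (x + y))\<^sup>2 = (norm x)\<^sup>2 + 2 * Re (cinner x y) + (norm (y::'a::chilbert_space))\<^sup>2"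
proof -
  have "Re (cinner y x) = Re (cinner x y)"
    using cinner_commute[of x y] by simp
  then show ?thesis
    by (simp add: Re_cinner_self[symmetric] cinner_add_left cinner_add_right)
qed

lemma Cauchy_Schwarz_Re: "\<bar>Re (cinner x y)\<bar> \<le> norm x * norm (y::'a::chilbert_space)"
proof (cases "y = 0")
  case True
  then have "cinner x y = 0" using cinner_scaleR_right[of x 0 y] by simp
  then show ?thesis by simp
next
  case False
  define t where "t = Re (cinner x y) / (norm y)\<^sup>2"
  have ny: "(norm y)\<^sup>2 > 0" using False by simp
  have "0 \<le> (norm (x + (-t) *\<^sub>R y))\<^sup>2" by simp
  also have "\<dots> = (norm x)\<^sup>2 - 2 * t * Re (cinner x y) + t\<^sup>2 * (norm y)\<^sup>2"
    unfolding norm_add_sq by (simp add: cinner_scaleR_right power_mult_distrib del: scaleR_minus_left)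
  also have "\<dots> = (norm x)\<^sup>2 - (Re (cinner x y))\<^sup>2 / (norm y)\<^sup>2"
    using ny by (simp add: t_def field_simps power2_eq_square)
  finally have "(Re (cinner x y))\<^sup>2 \<le> (norm x * norm y)\<^sup>2"
    using ny by (simp add: field_simps power_mult_distrib)
  then show ?thesis using abs_le_square_iff[of "Re (cinner x y)" "norm x * norm y"] by (simp add: abs_mult)
qed

lemma Cauchy_Schwarz: "cmod (cinner x y) \<le> norm x * norm (y::'a::chilbert_space)"
proof (cases "cinner x y = 0")
  case False
  \<comment> \<open>A phase factor makes the inner product real.\<close>
  define a where "a = cnj (sgn (cinner x y))"
  have "cinner (a *\<^sub>C x) y = of_real (cmod (cinner x y))"
  proof -
    have "a * cinner x y = of_real ((cmod (cinner x y))\<^sup>2) / of_real (cmod (cinner x y))"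
      by (simp only: a_def sgn_eq complex_norm_square) (simp add: mult.commute)
    then show ?thesis using False by (simp add: cinner_scaleC_left power2_eq_square)
  qed
  moreover have "cmod a = 1" using False by (simp add: a_def norm_sgn)
  ultimately show ?thesis
    using Cauchy_Schwarz_Re[of "a *\<^sub>C x" y] by (simp add: norm_scaleC)
qed auto

lemma bounded_bilinear_cinner: "bounded_bilinear (cinner :: 'a::chilbert_space \<Rightarrow> 'a \<Rightarrow> complex)"
proof
  show "\<exists>K. \<forall>a b. norm (cinner (a::'a) b) \<le> norm a * norm b * K"
    by (rule exI[of _ 1]) (simp add: Cauchy_Schwarz)
qed (auto simp: cinner_add_left cinner_add_right cinner_scaleR_left cinner_scaleR_right scaleR_conv_of_real)

interpretation cinner: bounded_bilinear "cinner :: 'a::chilbert_space \<Rightarrow> 'a \<Rightarrow> complex"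
  by (rule bounded_bilinear_cinner)

lemma scaleC_zero_right [simp]: "a *\<^sub>C (0::'a::chilbert_space) = 0"
  using norm_scaleC[of a 0] by simp

lemma scaleC_zero_left [simp]: "(0::complex) *\<^sub>C (x::'a::chilbert_space) = 0"
  using norm_scaleC[of 0 x] by simp

lemma scaleC_minus_right: "a *\<^sub>C (- x) = - (a *\<^sub>C (x::'a::chilbert_space))"
  using scaleC_add_right[of a x "-x"] by (simp add: eq_neg_iff_add_eq_0 add.commute)

lemma scaleC_diff_right: "a *\<^sub>C (x - y) = a *\<^sub>C x - a *\<^sub>C (y::'a::chilbert_space)"
  using scaleC_add_right[of a x "-y"] by (simp add: scaleC_minus_right)

lemma scaleC_scaleR: "a *\<^sub>C (r *\<^sub>R x) = r *\<^sub>R (a *\<^sub>C (x::'a::chilbert_space))"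
  by (simp add: scaleC_of_real[symmetric] scaleC_scaleC mult.commute)

lemma bounded_linear_scaleC: "bounded_linear (\<lambda>x::'a::chilbert_space. a *\<^sub>C x)"
  by (rule bounded_linear_intro[of _ "cmod a"])
    (auto simp: scaleC_add_right scaleC_scaleR norm_scaleC)

lemma scaleC_sum_right: "a *\<^sub>C (\<Sum>i\<in>I. f i) = (\<Sum>i\<in>I. a *\<^sub>C (f i :: 'a::chilbert_space))"
  by (rule Real_Vector_Spaces.bounded_linear.linear[THEN linear_sum, OF bounded_linear_scaleC])


section \<open>Self-adjoint operators\<close>

lemma selfadj_scaleC: "T \<in> selfadj \<Longrightarrow> T (a *\<^sub>C x) = a *\<^sub>C T x"
  by (simp add: selfadj_def)

lemma selfadj_cinner: "T \<in> selfadj \<Longrightarrow> cinner (T x) y = cinner x (T y)"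
  by (simp add: selfadj_def)

lemma selfadj_id: "id_blinfun \<in> selfadj"
  by (simp add: selfadj_def)

lemma selfadj_zero: "0 \<in> selfadj"
  by (simp add: selfadj_def cinner.zero_left cinner.zero_right)

lemma selfadj_add: "S \<in> selfadj \<Longrightarrow> T \<in> selfadj \<Longrightarrow> S + T \<in> selfadj"
  by (simp add: selfadj_def blinfun.add_left scaleC_add_right cinner.add_left cinner.add_right)

lemma selfadj_diff: "S \<in> selfadj \<Longrightarrow> T \<in> selfadj \<Longrightarrow> S - T \<in> selfadj"
  by (simp add: selfadj_def blinfun.diff_left scaleC_diff_right cinner.diff_left cinner.diff_right)

lemma selfadj_scaleR: "T \<in> selfadj \<Longrightarrow> r *\<^sub>R T \<in> selfadj"
  by (simp add: selfadj_def blinfun.scaleR_left scaleC_scaleR cinner.scaleR_left cinner.scaleR_right)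

lemma selfadj_compose:
  "S \<in> selfadj \<Longrightarrow> T \<in> selfadj \<Longrightarrow> S o\<^sub>L T = T o\<^sub>L S \<Longrightarrow> S o\<^sub>L T \<in> selfadj"
  unfolding selfadj_def by simp (metis blinfun_apply_blinfun_compose)

lemma selfadj_congruence: "S \<in> selfadj \<Longrightarrow> T \<in> selfadj \<Longrightarrow> S o\<^sub>L T o\<^sub>L S \<in> selfadj"
  by (simp add: selfadj_def)

lemma selfadj_limit:
  assumes "\<And>n. S n \<in> selfadj" "S \<longlonglongrightarrow> T"
  shows "T \<in> selfadj"
proof -
  have lim: "(\<lambda>n. S n x) \<longlonglongrightarrow> T x" for x
    by (rule blinfun.tendsto[OF assms(2) tendsto_const])
  have "T (a *\<^sub>C x) = a *\<^sub>C T x" for a x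
  proof (rule LIMSEQ_unique[OF lim])
    show "(\<lambda>n. S n (a *\<^sub>C x)) \<longlonglongrightarrow> a *\<^sub>C T x"
      using bounded_linear.tendsto[OF bounded_linear_scaleC lim]
      by (simp add: selfadj_scaleC[OF assms(1)])
  qed
  moreover have "cinner (T x) y = cinner x (T y)" for x y
  proof (rule LIMSEQ_unique)
    show "(\<lambda>n. cinner (S n x) y) \<longlonglongrightarrow> cinner (T x) y"
      by (intro cinner.tendsto lim tendsto_const)
    show "(\<lambda>n. cinner (S n x) y) \<longlonglongrightarrow> cinner x (T y)"
      unfolding selfadj_cinner[OF assms(1)] by (intro cinner.tendsto lim tendsto_const)
  qed
  ultimately show ?thesis by (simp add: selfadj_def)
qed

abbreviation qform :: "('a::chilbert_space \<Rightarrow>\<^sub>L 'a) \<Rightarrow> 'a \<Rightarrow> real" where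
  "qform T x \<equiv> Re (cinner (T x) x)"

lemma Im_qform: "T \<in> selfadj \<Longrightarrow> Im (cinner (T x) x) = 0"
  using cinner_commute[of "T x" x] selfadj_cinner[of T x x]
  by (metis complex_cnj_cancel_iff complex_cnj_cnj cnj.simps(2) neg_equal_zero)

lemma op_le_iff:
  assumes "A \<in> selfadj" "B \<in> selfadj"
  shows "op_le A B \<longleftrightarrow> (\<forall>x. qform A x \<le> qform B x)"
  using assms selfadj_diff[OF assms(2,1)]
  by (simp add: op_le_def psd_op_def less_eq_complex_def blinfun.diff_left cinner.diff_left Im_qform)

text \<open>Spectral bounds are expressed by quadratic forms, since in this shape they restrict to
  subspaces and pass through congruences without further argument.\<close>

definition between :: "real \<Rightarrow> real \<Rightarrow> ('a::chilbert_space \<Rightarrow>\<^sub>L 'a) \<Rightarrow> bool" where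
  "between a b T \<longleftrightarrow> T \<in> selfadj \<and> (\<forall>x. a * (norm x)\<^sup>2 \<le> qform T x \<and> qform T x \<le> b * (norm x)\<^sup>2)"

lemma op_le_scaled_id:
  assumes "T \<in> selfadj"
  shows "op_le (c *\<^sub>R id_blinfun) T \<longleftrightarrow> (\<forall>x. c * (norm x)\<^sup>2 \<le> qform T x)"
    and "op_le T (c *\<^sub>R id_blinfun) \<longleftrightarrow> (\<forall>x. qform T x \<le> c * (norm x)\<^sup>2)"
  using assms
  by (simp_all add: op_le_iff selfadj_scaleR selfadj_id blinfun.scaleR_left cinner_scaleR_left Re_cinner_self)

lemma posdef_ops_iff: "T \<in> posdef_ops \<longleftrightarrow> (\<exists>k\<ge>1. between (1 / real k) (real k) T)"
  unfolding posdef_ops_def between_def by (auto simp: op_le_scaled_id Bex_def)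

lemma posdef_ops_between:
  assumes "T \<in> posdef_ops"
  obtains a b where "0 < a" "a \<le> b" "between a b T"
proof -
  obtain k where k: "k \<ge> 1" "between (1 / real k) (real k) T"
    using assms posdef_ops_iff by blast
  have "1 / real k \<le> 1" "1 \<le> real k" using k(1) by auto
  then have "1 / real k \<le> real k" by linarith
  then show ?thesis using that[OF _ _ k(2)] k(1) by simp
qed

lemma between_posdef_ops:
  assumes "0 < a" "between a b T"
  shows "T \<in> posdef_ops"
proof -
  obtain k :: nat where k: "max 1 (max (1 / a) b) \<le> real k" using real_arch_simple by blast
  then have k1: "k \<ge> 1" "1 / a \<le> real k" "b \<le> real k" by auto
  then have ka: "1 / real k \<le> a" using assms(1) by (simp add: field_simps)
  have "between (1 / real k) (real k) T"
    unfolding between_def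
  proof (intro conjI allI)
    show "T \<in> selfadj" using assms(2) between_def by blast
    fix x :: 'a
    have "1 / real k * (norm x)\<^sup>2 \<le> a * (norm x)\<^sup>2" "b * (norm x)\<^sup>2 \<le> real k * (norm x)\<^sup>2"
      using ka k1 by (intro mult_right_mono; simp)+
    then show "1 / real k * (norm x)\<^sup>2 \<le> qform T x" "qform T x \<le> real k * (norm x)\<^sup>2"
      using assms(2) unfolding between_def by (meson order_trans)+
  qed
  then show ?thesis using k1 posdef_ops_iff by blast
qed

lemma posdef_ops_selfadj: "T \<in> posdef_ops \<Longrightarrow> T \<in> selfadj"
  using posdef_ops_iff between_def by blast


section \<open>Polynomials of an operator\<close>

lemma poly_op_altdef:
  assumes "degree p \<le> n"
  shows "poly_op p T = (\<Sum>i\<le>n. coeff p i *\<^sub>R (((o\<^sub>L) T) ^^ i) id_blinfun)"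
  unfolding poly_op_def
  by (rule sum.mono_neutral_left) (use assms in \<open>auto simp: coeff_eq_0\<close>)

lemma poly_op_0 [simp]: "poly_op 0 T = 0"
  by (simp add: poly_op_def)

lemma poly_op_pCons: "poly_op (pCons a p) T = a *\<^sub>R id_blinfun + (T o\<^sub>L poly_op p T)"
proof -
  have "degree (pCons a p) \<le> Suc (degree p)" by (rule degree_pCons_le)
  then have "poly_op (pCons a p) T =
      a *\<^sub>R id_blinfun + (\<Sum>i\<le>degree p. coeff p i *\<^sub>R (T o\<^sub>L (((o\<^sub>L) T) ^^ i) id_blinfun))"
    by (simp add: poly_op_altdef sum.atMost_Suc_shift del: sum.atMost_Suc)
  also have "(\<Sum>i\<le>degree p. coeff p i *\<^sub>R (T o\<^sub>L (((o\<^sub>L) T) ^^ i) id_blinfun)) = T o\<^sub>L poly_op p T"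
    by (intro blinfun_eqI) (simp add: poly_op_def blinfun.sum_left blinfun.sum_right blinfun.scaleR_left blinfun.scaleR_right)
  finally show ?thesis .
qed

lemma poly_op_add: "poly_op (p + q) T = poly_op p T + poly_op q T"
proof -
  have d: "degree (p + q) \<le> max (degree p) (degree q)" by (rule degree_add_le_max)
  show ?thesis
    by (simp add: poly_op_altdef[OF d] poly_op_altdef[of p "max (degree p) (degree q)"]
        poly_op_altdef[of q "max (degree p) (degree q)"] scaleR_add_left sum.distrib)
qed

lemma poly_op_smult: "poly_op (smult c p) T = c *\<^sub>R poly_op p T"
  by (simp add: poly_op_altdef[OF degree_smult_le] poly_op_def scaleR_sum_right)

lemma poly_op_minus: "poly_op (- p) T = - poly_op p T"
  using poly_op_smult[of "-1" p T] by simp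

lemma poly_op_diff: "poly_op (p - q) T = poly_op p T - poly_op q T"
  using poly_op_add[of p "-q" T] by (simp add: poly_op_minus)

lemma poly_op_const: "poly_op [:c:] T = c *\<^sub>R id_blinfun"
  by (simp add: poly_op_pCons blinfun_eqI)

lemma poly_op_linear: "poly_op [:c, 1:] T = T + c *\<^sub>R id_blinfun"
  by (rule blinfun_eqI) (simp add: poly_op_pCons blinfun.add_left blinfun.scaleR_left blinfun.zero_left)

lemma poly_op_mult: "poly_op (p * q) T = poly_op p T o\<^sub>L poly_op q T"
proof (induction p)
  case (pCons a p)
  show ?case
    by (rule blinfun_eqI) (simp add: poly_op_add poly_op_smult poly_op_pCons pCons blinfun.add_left blinfun.scaleR_left)
qed (simp add: blinfun_eqI blinfun.zero_left)

lemma poly_op_commute: "poly_op p T o\<^sub>L poly_op q T = poly_op q T o\<^sub>L poly_op p T"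
  by (metis mult.commute poly_op_mult)

lemma selfadj_poly_op:
  assumes "T \<in> selfadj"
  shows "poly_op p T \<in> selfadj"
proof (induction p)
  case (pCons a p)
  have "T o\<^sub>L poly_op p T = poly_op p T o\<^sub>L T"
    using poly_op_commute[of "[:0, 1:]" T p] by (simp add: poly_op_linear)
  then show ?case unfolding poly_op_pCons
    by (intro selfadj_add selfadj_scaleR selfadj_id selfadj_compose assms pCons)
qed (simp add: selfadj_zero)


section \<open>The norm of a polynomial of a self-adjoint operator\<close>

text \<open>Failure of this property for \<open>T - t\<close> says that \<open>t\<close> is an approximate eigenvalue of \<open>T\<close>;
  self-adjoint operators have enough of those to control the norm of every polynomial.\<close>

definition bounded_below :: "('a::real_normed_vector \<Rightarrow>\<^sub>L 'a) \<Rightarrow> bool" where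
  "bounded_below T \<longleftrightarrow> (\<exists>c>0. \<forall>x. c * norm x \<le> norm (T x))"

lemma bounded_below_compose:
  assumes "bounded_below S" "bounded_below T"
  shows "bounded_below (S o\<^sub>L T)"
proof -
  obtain c d where cd: "c > 0" "\<And>x. c * norm x \<le> norm (S x)" "d > 0" "\<And>x. d * norm x \<le> norm (T x)"
    using assms unfolding bounded_below_def by blast
  have "c * d * norm x \<le> norm (S (T x))" for x
    using order_trans[OF mult_left_mono[OF cd(4), of c x] cd(2)] cd(1) by (simp add: mult.assoc)
  then show ?thesis unfolding bounded_below_def using cd by (intro exI[of _ "c * d"]) simp
qed

lemma bounded_below_scaleR_id: "c \<noteq> 0 \<Longrightarrow> bounded_below (c *\<^sub>R id_blinfun)"
  unfolding bounded_below_def by (intro exI[of _ "\<bar>c\<bar>"]) (simp add: blinfun.scaleR_left)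

lemma bounded_below_qform:
  assumes "c > 0" "\<And>x. c * (norm x)\<^sup>2 \<le> \<bar>qform T x\<bar>"
  shows "bounded_below T"
proof -
  have "c * norm x \<le> norm (T x)" for x
  proof (cases "x = 0")
    case False
    have "c * norm x * norm x \<le> norm (T x) * norm x"
      using order_trans[OF assms(2) Cauchy_Schwarz_Re, of x] by (simp add: power2_eq_square mult.assoc)
    then show ?thesis using False by simp
  qed simp
  then show ?thesis using assms(1) bounded_below_def by blast
qed

text \<open>A nonreal pair of roots \<open>a \<plusminus> ib\<close> contributes the factor \<open>(T - a)\<^sup>2 + b\<^sup>2 \<ge> b\<^sup>2\<close>.\<close>

lemma bounded_below_quadratic:
  assumes "T \<in> selfadj" "b \<noteq> 0"
  shows "bounded_below (poly_op [:a\<^sup>2 + b\<^sup>2, -2 * a, 1:] T)"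
proof (rule bounded_below_qform[of "b\<^sup>2"])
  fix x
  let ?S = "poly_op [:-a, 1:] T"
  have S: "?S \<in> selfadj" by (rule selfadj_poly_op[OF assms(1)])
  have "[:a\<^sup>2 + b\<^sup>2, -2 * a, 1:] = [:-a, 1:] * [:-a, 1:] + [:b\<^sup>2:]"
    by (simp add: power2_eq_square)
  then have "poly_op [:a\<^sup>2 + b\<^sup>2, -2 * a, 1:] T = (?S o\<^sub>L ?S) + b\<^sup>2 *\<^sub>R id_blinfun"
    by (simp only: poly_op_add poly_op_mult poly_op_const)
  moreover have "cinner (?S (?S x)) x = cinner (?S x) (?S x)" by (rule selfadj_cinner[OF S])
  ultimately have "qform (poly_op [:a\<^sup>2 + b\<^sup>2, -2 * a, 1:] T) x = (norm (?S x))\<^sup>2 + b\<^sup>2 * (norm x)\<^sup>2"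
    by (simp add: blinfun.add_left blinfun.scaleR_left cinner.add_left cinner_scaleR_left Re_cinner_self)
  then show "b\<^sup>2 * (norm x)\<^sup>2 \<le> \<bar>qform (poly_op [:a\<^sup>2 + b\<^sup>2, -2 * a, 1:] T) x\<bar>" by simp
qed (use assms in simp)

lemma poly_of_real_pCons:
  "poly (map_poly complex_of_real (pCons a p)) z = of_real a + z * poly (map_poly complex_of_real p) z"
  by (cases "a = 0 \<and> p = 0") (auto simp: map_poly_pCons)

lemma poly_of_real_add:
  "poly (map_poly complex_of_real (p + q)) z =
   poly (map_poly complex_of_real p) z + poly (map_poly complex_of_real q) z"
proof (induction p arbitrary: q)
  case (pCons a p)
  obtain b q' where "q = pCons b q'" by (cases q)
  then show ?case by (simp add: poly_of_real_pCons pCons.IH algebra_simps)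
qed simp

lemma poly_of_real_mult:
  "poly (map_poly complex_of_real (p * q)) z =
   poly (map_poly complex_of_real p) z * poly (map_poly complex_of_real q) z"
proof -
  have smult: "poly (map_poly complex_of_real (smult a q)) z =
    of_real a * poly (map_poly complex_of_real q) z" for a q
    by (induction q) (simp_all add: poly_of_real_pCons algebra_simps)
  show ?thesis
    by (induction p) (simp_all add: poly_of_real_pCons poly_of_real_add smult algebra_simps)
qed

text \<open>For a nonreal root \<open>z = a + ib\<close>, the remainder of \<open>p\<close> modulo the quadratic polynomial with roots
  \<open>z\<close> and its conjugate is linear, real and vanishes at \<open>z\<close>, hence is zero.\<close>

lemma real_poly_factor:
  fixes p :: "real poly"
  assumes "degree p > 0"
  obtains t where "[:-t, 1:] dvd p" | a b where "b \<noteq> 0" "[:a\<^sup>2 + b\<^sup>2, -2 * a, 1:] dvd p"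
proof -
  let ?ev = "\<lambda>p. poly (map_poly complex_of_real p)"
  have "degree (map_poly complex_of_real p) > 0"
    using assms by (simp add: degree_map_poly)
  then obtain z where z: "?ev p z = 0"
    using fundamental_theorem_of_algebra[of "map_poly complex_of_real p"] constant_degree by (metis less_irrefl)
  show ?thesis
  proof (cases "Im z = 0")
    case True
    then have "z = of_real (Re z)" by (simp add: complex_eq_iff)
    moreover have "?ev p (of_real t) = of_real (poly p t)" for t
      by (induction p) (simp_all add: map_poly_pCons)
    ultimately have "poly p (Re z) = 0" using z by (metis of_real_eq_0_iff)
    then show ?thesis using that(1) poly_eq_0_iff_dvd by blast
  next
    case False
    define m where "m = [:(Re z)\<^sup>2 + (Im z)\<^sup>2, -2 * Re z, 1:]"
    have m: "?ev m z = 0"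
      by (simp add: m_def map_poly_pCons complex_eq_iff power2_eq_square algebra_simps)
    define r where "r = p mod m"
    have "?ev p z = ?ev (p div m) z * ?ev m z + ?ev r z"
      unfolding r_def by (metis div_mult_mod_eq poly_of_real_add poly_of_real_mult)
    then have rz: "?ev r z = 0" using z m by simp
    have "degree m = 2" "m \<noteq> 0" by (simp_all add: m_def)
    then have "r = 0 \<or> degree r < 2" unfolding r_def by (metis degree_mod_less)
    then have dr: "degree r \<le> 1" by auto
    then have r: "r = [:coeff r 0, coeff r 1:]"
      by (intro poly_eqI) (auto simp: coeff_pCons coeff_eq_0 split: nat.split)
    have "?ev r z = of_real (coeff r 0) + z * of_real (coeff r 1)"
      by (subst r) (simp add: poly_of_real_pCons)
    with rz have "Im z * coeff r 1 = 0" "coeff r 0 + Re z * coeff r 1 = 0"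
      by (simp_all add: complex_eq_iff)
    then have "coeff r 1 = 0" "coeff r 0 = 0" using False by auto
    with r have "r = 0" by simp
    then have "m dvd p" unfolding r_def by (simp add: mod_eq_0_iff_dvd)
    then show ?thesis using that(2) False unfolding m_def by blast
  qed
qed

text \<open>Spectral mapping for approximate eigenvalues, in contrapositive form: linear factors of \<open>p\<close> are
  covered by the hypothesis, quadratic ones are bounded below in any case.\<close>

lemma bounded_below_poly_op:
  assumes "T \<in> selfadj" "p \<noteq> 0"
    and "\<And>t. poly p t = 0 \<Longrightarrow> bounded_below (T - t *\<^sub>R id_blinfun)"
  shows "bounded_below (poly_op p T)"
  using assms(2,3)
proof (induction "degree p" arbitrary: p rule: less_induct)
  case less
  have step: "bounded_below (poly_op p T)"
    if m: "m dvd p" "degree m > 0" "bounded_below (poly_op m T)" for m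
  proof -
    obtain q where q: "p = m * q" using m(1) by auto
    then have "m \<noteq> 0" "q \<noteq> 0" using less.prems(1) by auto
    then have "degree q < degree p" using m(2) by (simp add: q degree_mult_eq)
    then have "bounded_below (poly_op q T)"
      using less.hyps \<open>q \<noteq> 0\<close> less.prems(2) by (simp add: q)
    then show ?thesis using m(3) by (simp add: q poly_op_mult bounded_below_compose)
  qed
  show ?case
  proof (cases "degree p = 0")
    case True
    then obtain c where "p = [:c:]" by (rule degree_eq_zeroE)
    then show ?thesis using less.prems(1) bounded_below_scaleR_id by (simp add: poly_op_const)
  next
    case False
    then have "degree p > 0" by simp
    then show ?thesis
    proof (cases rule: real_poly_factor)
      case (1 t)
      then have "bounded_below (T - t *\<^sub>R id_blinfun)"
        using less.prems(2) poly_eq_0_iff_dvd by blast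
      then show ?thesis using step[OF 1] by (simp add: poly_op_linear)
    next
      case (2 a b)
      then show ?thesis using step[OF 2(2)] bounded_below_quadratic[OF assms(1) 2(1)] by simp
    qed
  qed
qed

text \<open>Either \<open>\<parallel>S\<parallel>\<close> or \<open>-\<parallel>S\<parallel>\<close> is an approximate eigenvalue: on unit vectors
  \<open>\<parallel>S\<^sup>2x - \<parallel>S\<parallel>\<^sup>2x\<parallel>\<^sup>2 \<le> \<parallel>S\<parallel>\<^sup>2(\<parallel>S\<parallel>\<^sup>2 - \<parallel>Sx\<parallel>\<^sup>2)\<close>, and \<open>\<parallel>Sx\<parallel>\<close> comes as close to \<open>\<parallel>S\<parallel>\<close> as desired.\<close>

lemma not_bounded_below_norm_sq:
  assumes S: "S \<in> selfadj" and "norm S > 0"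
  shows "\<not> bounded_below ((S o\<^sub>L S) - (norm S)\<^sup>2 *\<^sub>R id_blinfun)"
proof
  let ?s = "norm S"
  assume "bounded_below ((S o\<^sub>L S) - ?s\<^sup>2 *\<^sub>R id_blinfun)"
  then obtain c where c: "c > 0"
    "\<And>x. c * norm x \<le> norm (((S o\<^sub>L S) - ?s\<^sup>2 *\<^sub>R id_blinfun) x)"
    unfolding bounded_below_def by blast
  define k where "k = ?s\<^sup>2 - c\<^sup>2 / ?s\<^sup>2"
  have bound: "(norm (S x))\<^sup>2 \<le> k * (norm x)\<^sup>2" for x
  proof -
    have "(c * norm x)\<^sup>2 \<le> (norm (((S o\<^sub>L S) - ?s\<^sup>2 *\<^sub>R id_blinfun) x))\<^sup>2"
      using c(1) by (intro power_mono c(2)) simp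
    also have "\<dots> = (norm (S (S x) + (- ?s\<^sup>2) *\<^sub>R x))\<^sup>2"
      by (simp add: blinfun.diff_left blinfun.scaleR_left)
    also have "\<dots> = (norm (S (S x)))\<^sup>2 - 2 * ?s\<^sup>2 * (norm (S x))\<^sup>2 + (?s\<^sup>2)\<^sup>2 * (norm x)\<^sup>2"
      unfolding norm_add_sq
      by (simp add: cinner_scaleR_right selfadj_cinner[OF S, of "S x"] Re_cinner_self power_mult_distrib del: scaleR_minus_left)
    also have "(norm (S (S x)))\<^sup>2 \<le> (?s * norm (S x))\<^sup>2"
      by (intro power_mono norm_blinfun norm_ge_zero)
    also have "\<dots> = ?s\<^sup>2 * (norm (S x))\<^sup>2" by (simp add: power_mult_distrib)
    finally have "(c * norm x)\<^sup>2 \<le> (?s\<^sup>2)\<^sup>2 * (norm x)\<^sup>2 - ?s\<^sup>2 * (norm (S x))\<^sup>2" by simp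
    then have *: "?s\<^sup>2 * (norm (S x))\<^sup>2 \<le> ((?s\<^sup>2)\<^sup>2 - c\<^sup>2) * (norm x)\<^sup>2"
      by (simp add: power_mult_distrib algebra_simps)
    have "(norm (S x))\<^sup>2 \<le> ((?s\<^sup>2)\<^sup>2 - c\<^sup>2) / ?s\<^sup>2 * (norm x)\<^sup>2"
      using * assms(2) by (simp add: field_simps)
    also have "\<dots> \<le> k * (norm x)\<^sup>2"
    proof (rule mult_right_mono)
      show "((?s\<^sup>2)\<^sup>2 - c\<^sup>2) / ?s\<^sup>2 \<le> k"
        using assms(2) by (simp add: k_def diff_divide_distrib power2_eq_square)
    qed simp
    finally show ?thesis .
  qed
  have "?s \<le> sqrt (max 0 k)"
  proof (rule norm_blinfun_bound)
    fix x
    have "(norm (S x))\<^sup>2 \<le> max 0 k * (norm x)\<^sup>2"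
      using bound[of x] by (meson max.cobounded2 mult_right_mono order_trans zero_le_power2)
    then show "norm (S x) \<le> sqrt (max 0 k) * norm x"
      using real_le_rsqrt by (fastforce simp: real_sqrt_mult)
  qed simp
  then have "?s\<^sup>2 \<le> max 0 k"
    using assms(2) by (metis max.cobounded1 norm_ge_zero power_mono real_sqrt_pow2)
  moreover have "k < ?s\<^sup>2" using c(1) assms(2) by (simp add: k_def)
  ultimately show False using assms(2) by (auto simp: max_def split: if_splits)
qed

text \<open>The polynomial \<open>p\<^sup>2 - \<parallel>p(T)\<parallel>\<^sup>2\<close> of \<open>T\<close> is not bounded below, so it vanishes at an approximate
  eigenvalue.  Positive degree of \<open>p\<close> keeps that polynomial from being zero.\<close>

lemma norm_poly_op_attained:
  assumes T: "T \<in> selfadj" and "norm (poly_op p T) > 0" "degree p > 0"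
  obtains t where "\<not> bounded_below (T - t *\<^sub>R id_blinfun)" "\<bar>poly p t\<bar> = norm (poly_op p T)"
proof -
  let ?s = "norm (poly_op p T)"
  define q where "q = p * p - [:?s\<^sup>2:]"
  have qT: "poly_op q T = (poly_op p T o\<^sub>L poly_op p T) - ?s\<^sup>2 *\<^sub>R id_blinfun"
    by (simp only: q_def poly_op_diff poly_op_mult poly_op_const)
  have "p \<noteq> 0" using assms(3) by auto
  then have "degree (p * p) > 0" using assms(3) by (simp add: degree_mult_eq)
  then have "q \<noteq> 0" unfolding q_def by (metis degree_pCons_0 eq_iff_diff_eq_0 less_irrefl)
  have "\<not> bounded_below (poly_op q T)"
    unfolding qT by (rule not_bounded_below_norm_sq[OF selfadj_poly_op[OF T] assms(2)])
  then obtain t where t: "poly q t = 0" "\<not> bounded_below (T - t *\<^sub>R id_blinfun)"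
    using bounded_below_poly_op[OF T \<open>q \<noteq> 0\<close>] by blast
  then have "\<bar>poly p t\<bar>\<^sup>2 = ?s\<^sup>2" by (simp add: q_def power2_eq_square)
  then have "\<bar>poly p t\<bar> = ?s" using power2_eq_iff_nonneg abs_ge_zero norm_ge_zero by blast
  then show ?thesis using that t by blast
qed

lemma norm_poly_op_le:
  assumes T: "T \<in> selfadj" and e: "e \<ge> 0"
    and p: "\<And>t. \<not> bounded_below (T - t *\<^sub>R id_blinfun) \<Longrightarrow> \<bar>poly p t\<bar> \<le> e"
  shows "norm (poly_op p T) \<le> e"
proof (cases "degree p = 0")
  case False
  show ?thesis
  proof (cases "norm (poly_op p T) > 0")
    case True
    then obtain t where "\<not> bounded_below (T - t *\<^sub>R id_blinfun)" "\<bar>poly p t\<bar> = norm (poly_op p T)"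
      using False norm_poly_op_attained[OF T] by blast
    then show ?thesis using p by metis
  qed (use e in simp)
next
  case True
  then obtain c where c: "p = [:c:]" by (rule degree_eq_zeroE)
  show ?thesis
  proof (cases "\<exists>t. \<not> bounded_below (T - t *\<^sub>R id_blinfun)")
    case True
    then have "\<bar>c\<bar> \<le> e" using p c by auto
    moreover have "norm (c *\<^sub>R (id_blinfun :: 'a \<Rightarrow>\<^sub>L 'a)) \<le> \<bar>c\<bar>"
      by (rule norm_blinfun_bound) (simp_all add: blinfun.scaleR_left)
    ultimately show ?thesis by (simp add: c poly_op_const)
  next
    case False
    \<comment> \<open>Without approximate eigenvalues every \<open>T + a\<close> vanishes, so the space is trivial.\<close>
    have zero: "poly_op [:a, 1:] T = 0" for a
      using norm_poly_op_attained[OF T, of "[:a, 1:]"] False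
      by (metis degree_pCons_eq_if norm_le_zero_iff not_le one_neq_zero pCons_eq_0_iff zero_less_Suc)
    have "poly_op [:c:] T = poly_op [:c, 1:] T - poly_op [:0, 1:] T"
      by (simp flip: poly_op_diff)
    then show ?thesis using zero e by (simp add: c)
  qed
qed


section \<open>Functional calculus on an interval\<close>

lemma approx_eigenvalue_between:
  assumes T: "between a b T" and "\<not> bounded_below (T - t *\<^sub>R id_blinfun)"
  shows "t \<in> {a..b}"
proof (rule ccontr)
  assume "t \<notin> {a..b}"
  define c where "c = (if t < a then a - t else t - b)"
  have c: "c > 0" using \<open>t \<notin> {a..b}\<close> by (auto simp: c_def)
  have q: "qform (T - t *\<^sub>R id_blinfun) x = qform T x - t * (norm x)\<^sup>2" for x
    by (simp add: blinfun.diff_left blinfun.scaleR_left cinner.diff_left cinner_scaleR_left Re_cinner_self)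
  have "c * (norm x)\<^sup>2 \<le> \<bar>qform (T - t *\<^sub>R id_blinfun) x\<bar>" for x
  proof -
    have ab: "a * (norm x)\<^sup>2 \<le> qform T x" "qform T x \<le> b * (norm x)\<^sup>2"
      using T unfolding between_def by auto
    show ?thesis
    proof (cases "t < a")
      case True
      then show ?thesis using ab(1) unfolding q by (simp add: c_def left_diff_distrib)
    next
      case False
      then show ?thesis using ab(2) unfolding q by (simp add: c_def left_diff_distrib)
    qed
  qed
  with c have "bounded_below (T - t *\<^sub>R id_blinfun)" by (rule bounded_below_qform)
  with assms(2) show False by simp
qed

lemma norm_poly_op_le_between:
  assumes "between a b T" "e \<ge> 0" "\<And>t. t \<in> {a..b} \<Longrightarrow> \<bar>poly p t\<bar> \<le> e"
  shows "norm (poly_op p T) \<le> e"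
  using assms approx_eigenvalue_between[OF assms(1)]
  by (intro norm_poly_op_le) (auto simp: between_def)

lemma polynomial_approx:
  fixes f :: "real \<Rightarrow> real"
  assumes "continuous_on {a..b} f" "e > 0"
  obtains p where "\<And>t. t \<in> {a..b} \<Longrightarrow> \<bar>poly p t - f t\<bar> < e"
proof -
  obtain g where g: "real_polynomial_function g" "\<And>t. t \<in> {a..b} \<Longrightarrow> \<bar>f t - g t\<bar> < e"
    by (rule Stone_Weierstrass_real_polynomial_function[OF compact_Icc assms]) blast
  then obtain c n where "g = (\<lambda>x. \<Sum>i\<le>n. c i * x ^ i)"
    using real_polynomial_function_iff_sum by blast
  then have "g = poly (\<Sum>i\<le>n. monom (c i) i)" by (auto simp: poly_sum poly_monom)
  then show ?thesis using that g(2) by (metis abs_minus_commute)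
qed

lemma polynomial_approx_sequence:
  fixes f :: "real \<Rightarrow> real"
  assumes "continuous_on {a..b} f"
  obtains p where "uniform_limit {a..b} (\<lambda>n. poly (p n)) f sequentially"
proof -
  have "\<exists>p. \<forall>t\<in>{a..b}. \<bar>poly p t - f t\<bar> < 1 / real (Suc n)" for n
    using polynomial_approx[OF assms, of "1 / real (Suc n)"] by (metis of_nat_0_less_iff zero_less_Suc zero_less_divide_1_iff)
  then obtain p where p: "\<And>n t. t \<in> {a..b} \<Longrightarrow> \<bar>poly (p n) t - f t\<bar> < 1 / real (Suc n)"
    by metis
  have "uniform_limit {a..b} (\<lambda>n. poly (p n)) f sequentially"
  proof (rule uniform_limitI)
    fix e :: real assume "e > 0"
    then obtain N where "1 / real (Suc N) < e" using nat_approx_posE by blast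
    moreover have "1 / real (Suc n) \<le> 1 / real (Suc N)" if "n \<ge> N" for n
      using that by (simp add: frac_le)
    ultimately have "\<forall>t\<in>{a..b}. dist (poly (p n) t) (f t) < e" if "n \<ge> N" for n
      using p that by (metis dist_real_def order_less_le_trans order_less_trans)
    then show "\<forall>\<^sub>F n in sequentially. \<forall>t\<in>{a..b}. dist (poly (p n) t) (f t) < e"
      using eventually_sequentially by blast
  qed
  then show ?thesis using that by blast
qed

lemma poly_fun_simps:
  fixes p q :: "real poly" and c :: real
  shows "poly [:c:] = (\<lambda>t. c)" "poly [:0, 1:] = (\<lambda>t::real. t)" "poly (p * q) = (\<lambda>t. poly p t * poly q t)"
    "poly (p + q) = (\<lambda>t. poly p t + poly q t)" "poly (smult c p) = (\<lambda>t. c * poly p t)"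
  by (rule ext, simp)+

text \<open>One estimate serves twice: with \<open>p = q\<close> it gives the Cauchy property of \<open>p\<^sub>n(T)\<close>, with different
  sequences it shows that the limit depends on \<open>f\<close> alone.\<close>

lemma poly_op_close:
  assumes T: "T \<in> selfadj" and sub: "\<And>t. \<not> bounded_below (T - t *\<^sub>R id_blinfun) \<Longrightarrow> t \<in> K"
    and "uniform_limit K (\<lambda>n. poly (p n)) f sequentially" "uniform_limit K (\<lambda>n. poly (q n)) f sequentially"
    and "e > 0"
  shows "\<exists>N. \<forall>m\<ge>N. \<forall>n\<ge>N. norm (poly_op (p m) T - poly_op (q n) T) < e"
proof -
  have "\<forall>\<^sub>F n in sequentially. \<forall>t\<in>K. dist (poly (p n) t) (f t) < e / 4"
       "\<forall>\<^sub>F n in sequentially. \<forall>t\<in>K. dist (poly (q n) t) (f t) < e / 4"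
    using \<open>e > 0\<close> by (intro uniform_limitD[OF assms(3)] uniform_limitD[OF assms(4)]; simp)+
  then have "\<forall>\<^sub>F n in sequentially. \<forall>t\<in>K. dist (poly (p n) t) (f t) < e / 4 \<and> dist (poly (q n) t) (f t) < e / 4"
    by eventually_elim auto
  then obtain N where N: "\<And>n t. n \<ge> N \<Longrightarrow> t \<in> K \<Longrightarrow> \<bar>poly (p n) t - f t\<bar> < e / 4 \<and> \<bar>poly (q n) t - f t\<bar> < e / 4"
    unfolding eventually_sequentially dist_real_def by blast
  have "norm (poly_op (p m) T - poly_op (q n) T) < e" if "m \<ge> N" "n \<ge> N" for m n
  proof -
    have "norm (poly_op (p m - q n) T) \<le> e / 2"
    proof (rule norm_poly_op_le[OF T])
      fix t assume "\<not> bounded_below (T - t *\<^sub>R id_blinfun)"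
      then have "\<bar>poly (p m) t - f t\<bar> < e / 4" "\<bar>poly (q n) t - f t\<bar> < e / 4"
        using sub N that by blast+
      then show "\<bar>poly (p m - q n) t\<bar> \<le> e / 2" unfolding poly_diff by linarith
    qed (use \<open>e > 0\<close> in simp)
    then show ?thesis using \<open>e > 0\<close> by (simp add: poly_op_diff)
  qed
  then show ?thesis by blast
qed

lemma poly_op_convergent:
  assumes T: "between a b T" and "uniform_limit {a..b} (\<lambda>n. poly (p n)) f sequentially"
  shows "convergent (\<lambda>n. poly_op (p n) T)"
proof -
  have "T \<in> selfadj" using T between_def by blast
  then have "Cauchy (\<lambda>n. poly_op (p n) T)"
    using poly_op_close[OF _ approx_eigenvalue_between[OF T] assms(2) assms(2)]
    unfolding Cauchy_def dist_norm by blast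
  then show ?thesis by (simp add: Cauchy_convergent_iff)
qed

lemma approx_eigenvalue_in_spectrum:
  assumes "\<not> bounded_below (T - t *\<^sub>R id_blinfun)"
  shows "complex_of_real t \<in> op_spectrum T"
proof (rule ccontr)
  assume "complex_of_real t \<notin> op_spectrum T"
  then obtain R :: "'a \<Rightarrow>\<^sub>L 'a" where R: "\<And>x. R (T x - complex_of_real t *\<^sub>C x) = x"
    unfolding op_spectrum_def by blast
  have le: "norm x \<le> (norm R + 1) * norm ((T - t *\<^sub>R id_blinfun) x)" for x
  proof -
    have "x = R ((T - t *\<^sub>R id_blinfun) x)"
      using R[of x] by (simp add: blinfun.diff_left blinfun.scaleR_left scaleC_of_real)
    then have "norm x \<le> norm R * norm ((T - t *\<^sub>R id_blinfun) x)"
      by (metis norm_blinfun)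
    also have "\<dots> \<le> (norm R + 1) * norm ((T - t *\<^sub>R id_blinfun) x)"
      by (rule mult_right_mono) auto
    finally show ?thesis .
  qed
  have "1 / (norm R + 1) * norm x \<le> norm ((T - t *\<^sub>R id_blinfun) x)" for x
    using le[of x] by (simp add: divide_le_eq mult.commute add_nonneg_pos)
  then have "bounded_below (T - t *\<^sub>R id_blinfun)"
    unfolding bounded_below_def by (intro exI[of _ "1 / (norm R + 1)"]) (auto simp: add_nonneg_pos)
  with assms show False by simp
qed

text \<open>Outside \<open>[a,b]\<close> an inverse of \<open>T - t\<close> is obtained as the limit of \<open>p\<^sub>n(T)\<close>, where \<open>p\<^sub>n\<close>
  approximates \<open>s \<mapsto> 1/(s - t)\<close> on \<open>[a,b]\<close>.\<close>

lemma real_spectrum_between: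
  assumes T: "between a b T" and "complex_of_real t \<in> op_spectrum T"
  shows "t \<in> {a..b}"
proof (rule ccontr)
  assume t: "t \<notin> {a..b}"
  define h where "h = (\<lambda>s. 1 / (s - t))"
  have contl: "continuous_on {a..b} (\<lambda>s. s - t)" and cont: "continuous_on {a..b} h"
    unfolding h_def using t by (auto intro!: continuous_intros)
  obtain p where p: "uniform_limit {a..b} (\<lambda>n. poly (p n)) h sequentially"
    using polynomial_approx_sequence[OF cont] by blast
  obtain R where R: "(\<lambda>n. poly_op (p n) T) \<longlonglongrightarrow> R"
    using poly_op_convergent[OF T p] convergent_def by blast
  let ?l = "[:-t, 1:]"
  have l: "poly_op ?l T x = T x - t *\<^sub>R x" for x
    by (simp add: poly_op_linear blinfun.diff_left blinfun.scaleR_left)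
  have "uniform_limit {a..b} (\<lambda>n s. (s - t) * poly (p n) s) (\<lambda>s. (s - t) * h s) sequentially"
    by (intro uniform_lim_mult uniform_limit_const p compact_imp_bounded
        compact_continuous_image contl cont compact_Icc)
  then have "uniform_limit {a..b} (\<lambda>n. poly (?l * p n)) (\<lambda>s. 1) sequentially"
    by (rule uniform_limit_cong'[THEN iffD1, rotated -1]) (use t in \<open>auto simp: algebra_simps h_def field_simps\<close>)
  moreover have "uniform_limit {a..b} (\<lambda>n. poly [:1:]) (\<lambda>s. 1) (sequentially :: nat filter)"
    unfolding poly_fun_simps by (rule uniform_limit_const)
  moreover have sa: "T \<in> selfadj" using T between_def by blast
  ultimately have close: "\<exists>N. \<forall>m\<ge>N. \<forall>n\<ge>N. norm (poly_op (?l * p m) T - poly_op [:1:] T) < e" if "e > 0" for e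
    using that by (intro poly_op_close[OF sa approx_eigenvalue_between[OF T]])
  have "(\<lambda>n. poly_op (?l * p n) T) \<longlonglongrightarrow> poly_op [:1:] T"
    unfolding LIMSEQ_iff using close by blast
  then have lim: "(\<lambda>n. poly_op (?l * p n) T x) \<longlonglongrightarrow> x" for x
    using blinfun.tendsto[OF _ tendsto_const, of _ _ _ x] by (force simp: poly_op_const)
  have "T (R x) - t *\<^sub>R R x = x" for x
  proof (rule LIMSEQ_unique[OF _ lim])
    have "(\<lambda>n. poly_op ?l T (poly_op (p n) T x)) \<longlonglongrightarrow> poly_op ?l T (R x)"
      by (intro blinfun.tendsto tendsto_const R)
    then show "(\<lambda>n. poly_op (?l * p n) T x) \<longlonglongrightarrow> T (R x) - t *\<^sub>R R x"
      by (simp only: l poly_op_mult blinfun_apply_blinfun_compose)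
  qed
  moreover have "R (T x - t *\<^sub>R x) = x" for x
  proof (rule LIMSEQ_unique[OF _ lim])
    have "(\<lambda>n. poly_op (p n) T (poly_op ?l T x)) \<longlonglongrightarrow> R (poly_op ?l T x)"
      by (intro blinfun.tendsto tendsto_const R)
    then show "(\<lambda>n. poly_op (?l * p n) T x) \<longlonglongrightarrow> R (T x - t *\<^sub>R x)"
      by (simp only: l poly_op_mult mult.commute[of ?l] blinfun_apply_blinfun_compose)
  qed
  ultimately have "complex_of_real t \<notin> op_spectrum T"
    unfolding op_spectrum_def by (auto simp: scaleC_of_real)
  with assms(2) show False by simp
qed

text \<open>The definition of \<open>f(T)\<close> admits all polynomial sequences that converge on the real spectrum.  That
  set lies between the approximate eigenvalues, which determine the limit, and \<open>[a,b]\<close>, where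
  approximating polynomials are available.\<close>

lemma op_fun_tendsto:
  assumes T: "between a b T" and p: "uniform_limit {a..b} (\<lambda>n. poly (p n)) f sequentially"
  shows "(\<lambda>n. poly_op (p n) T) \<longlonglongrightarrow> op_fun f T"
proof -
  let ?K = "{t. complex_of_real t \<in> op_spectrum T}"
  have sa: "T \<in> selfadj" using T between_def by blast
  have sub: "?K \<subseteq> {a..b}" using real_spectrum_between[OF T] by blast
  have pK: "uniform_limit ?K (\<lambda>n. poly (p n)) f sequentially"
    using p sub by (rule uniform_limit_on_subset)
  obtain S where S: "(\<lambda>n. poly_op (p n) T) \<longlonglongrightarrow> S"
    using poly_op_convergent[OF T p] convergent_def by blast
  have "op_fun f T = S"
    unfolding op_fun_def
  proof (rule the_equality)
    show "\<exists>p. uniform_limit ?K (\<lambda>n. poly (p n)) f sequentially \<and> (\<lambda>n. poly_op (p n) T) \<longlonglongrightarrow> S"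
      using pK S by blast
    fix S' assume "\<exists>p. uniform_limit ?K (\<lambda>n. poly (p n)) f sequentially \<and> (\<lambda>n. poly_op (p n) T) \<longlonglongrightarrow> S'"
    then obtain q where q: "uniform_limit ?K (\<lambda>n. poly (q n)) f sequentially" "(\<lambda>n. poly_op (q n) T) \<longlonglongrightarrow> S'"
      by blast
    have "\<exists>N. \<forall>m\<ge>N. \<forall>n\<ge>N. norm (poly_op (q m) T - poly_op (p n) T) < e" if "e > 0" for e
      by (rule poly_op_close[OF sa _ q(1) pK that]) (auto simp: approx_eigenvalue_in_spectrum)
    then have "(\<lambda>n. poly_op (q n) T - poly_op (p n) T) \<longlonglongrightarrow> 0"
      unfolding LIMSEQ_iff by fastforce
    moreover have "(\<lambda>n. poly_op (q n) T - poly_op (p n) T) \<longlonglongrightarrow> S' - S"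
      by (intro tendsto_diff q S)
    ultimately have "S' - S = 0" using LIMSEQ_unique by blast
    then show "S' = S" by simp
  qed
  then show ?thesis using S by simp
qed

lemma op_fun_poly:
  assumes "between a b T"
  shows "op_fun (poly p) T = poly_op p T"
  using op_fun_tendsto[OF assms, of "\<lambda>_. p" "poly p"] LIMSEQ_unique[OF tendsto_const]
  by (metis uniform_limit_const)

lemma op_fun_cong:
  assumes T: "between a b T" and f: "continuous_on {a..b} f" and eq: "\<And>t. t \<in> {a..b} \<Longrightarrow> f t = g t"
  shows "op_fun f T = op_fun g T"
proof -
  obtain p where p: "uniform_limit {a..b} (\<lambda>n. poly (p n)) f sequentially"
    using polynomial_approx_sequence[OF f] by blast
  then have "uniform_limit {a..b} (\<lambda>n. poly (p n)) g sequentially"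
    by (rule uniform_limit_cong'[THEN iffD1, rotated -1]) (auto simp: eq)
  then show ?thesis using op_fun_tendsto[OF T] p LIMSEQ_unique by blast
qed

lemma op_fun_ident:
  assumes "between a b T"
  shows "op_fun (\<lambda>t. t) T = T"
  using op_fun_poly[OF assms, of "[:0, 1:]"] by (simp add: poly_op_linear poly_fun_simps)

lemma op_fun_one:
  assumes "between a b T"
  shows "op_fun (\<lambda>t. 1) T = id_blinfun"
  using op_fun_poly[OF assms, of "[:1:]"] by (simp add: poly_op_const poly_fun_simps)

lemma selfadj_op_fun:
  assumes T: "between a b T" and f: "continuous_on {a..b} f"
  shows "op_fun f T \<in> selfadj"
proof -
  obtain p where p: "uniform_limit {a..b} (\<lambda>n. poly (p n)) f sequentially"
    using polynomial_approx_sequence[OF f] by blast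
  then show ?thesis
    using selfadj_limit[OF _ op_fun_tendsto[OF T p]] selfadj_poly_op T between_def by blast
qed

lemma op_fun_mult:
  assumes T: "between a b T" and f: "continuous_on {a..b} f" and g: "continuous_on {a..b} g"
  shows "op_fun (\<lambda>t. f t * g t) T = op_fun f T o\<^sub>L op_fun g T"
proof -
  obtain p q where p: "uniform_limit {a..b} (\<lambda>n. poly (p n)) f sequentially"
    and q: "uniform_limit {a..b} (\<lambda>n. poly (q n)) g sequentially"
    using polynomial_approx_sequence[OF f] polynomial_approx_sequence[OF g] by metis
  have "uniform_limit {a..b} (\<lambda>n t. poly (p n) t * poly (q n) t) (\<lambda>t. f t * g t) sequentially"
    by (intro uniform_lim_mult p q compact_imp_bounded compact_continuous_image f g compact_Icc)
  then have "(\<lambda>n. poly_op (p n * q n) T) \<longlonglongrightarrow> op_fun (\<lambda>t. f t * g t) T"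
    by (intro op_fun_tendsto[OF T]) (simp add: poly_fun_simps)
  moreover have "(\<lambda>n. poly_op (p n * q n) T) \<longlonglongrightarrow> (op_fun f T o\<^sub>L op_fun g T)"
    unfolding poly_op_mult
    by (intro bounded_bilinear.tendsto[OF bounded_bilinear_blinfun_compose] op_fun_tendsto[OF T] p q)
  ultimately show ?thesis by (rule LIMSEQ_unique)
qed

text \<open>A polynomial with values in \<open>[0,2c]\<close> is within \<open>c\<close> of the constant \<open>c\<close>, hence so is the
  operator, and therefore it is nonnegative.\<close>

lemma qform_poly_op_nonneg:
  assumes T: "between a b T" and p: "\<And>t. t \<in> {a..b} \<Longrightarrow> 0 \<le> poly p t"
  shows "0 \<le> qform (poly_op p T) x"
proof -
  have "compact (poly p ` {a..b})"
    by (intro compact_continuous_image continuous_intros compact_Icc)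
  then obtain c where c: "\<And>t. t \<in> {a..b} \<Longrightarrow> \<bar>poly p t\<bar> \<le> c" "c > 0"
    using bounded_pos[of "poly p ` {a..b}"] compact_imp_bounded by (metis imageI real_norm_def)
  have "norm (poly_op (p - [:c:]) T) \<le> c"
  proof (rule norm_poly_op_le_between[OF T])
    fix t assume "t \<in> {a..b}"
    then show "\<bar>poly (p - [:c:]) t\<bar> \<le> c" using c(1)[of t] p[of t] by simp
  qed (use c in simp)
  moreover have "\<bar>qform (poly_op (p - [:c:]) T) x\<bar> \<le> norm (poly_op (p - [:c:]) T) * norm x * norm x"
    by (rule order_trans[OF Cauchy_Schwarz_Re]) (intro mult_right_mono norm_blinfun norm_ge_zero)
  ultimately have "\<bar>qform (poly_op (p - [:c:]) T) x\<bar> \<le> c * norm x * norm x"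
    by (smt (verit, best) mult_right_mono norm_ge_zero)
  moreover have "qform (poly_op (p - [:c:]) T) x = qform (poly_op p T) x - c * (norm x)\<^sup>2"
    by (simp add: poly_op_diff poly_op_const blinfun.diff_left blinfun.scaleR_left cinner.diff_left
        cinner_scaleR_left Re_cinner_self)
  ultimately show ?thesis by (simp add: power2_eq_square abs_le_iff mult.assoc)
qed

lemma qform_op_fun_nonneg:
  assumes T: "between a b T" and f: "continuous_on {a..b} f" and nn: "\<And>t. t \<in> {a..b} \<Longrightarrow> 0 \<le> f t"
  shows "0 \<le> qform (op_fun f T) x"
proof -
  obtain p where p: "uniform_limit {a..b} (\<lambda>n. poly (p n)) f sequentially"
    using polynomial_approx_sequence[OF f] by blast
  have lim: "(\<lambda>n. qform (poly_op (p n) T) x) \<longlonglongrightarrow> qform (op_fun f T) x"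
    by (intro tendsto_Re cinner.tendsto blinfun.tendsto tendsto_const op_fun_tendsto[OF T p])
  have "- e \<le> qform (op_fun f T) x" if "e > 0" for e
  proof -
    define d where "d = e / ((norm x)\<^sup>2 + 1)"
    have "(norm x)\<^sup>2 + 1 > 0" by (intro add_nonneg_pos) auto
    then have d: "d > 0" "d * (norm x)\<^sup>2 \<le> e" using that by (auto simp: d_def field_simps)
    have "\<forall>\<^sub>F n in sequentially. \<forall>t\<in>{a..b}. dist (poly (p n) t) (f t) < d"
      using p d(1) by (rule uniform_limitD)
    then have "\<forall>\<^sub>F n in sequentially. - e \<le> qform (poly_op (p n) T) x"
    proof eventually_elim
      case (elim n)
      have "0 \<le> qform (poly_op (p n + [:d:]) T) x"
      proof (rule qform_poly_op_nonneg[OF T])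
        fix t assume "t \<in> {a..b}"
        then have "\<bar>poly (p n) t - f t\<bar> < d" "0 \<le> f t" using elim nn by (auto simp: dist_real_def)
        then show "0 \<le> poly (p n + [:d:]) t" by simp
      qed
      also have "\<dots> = qform (poly_op (p n) T) x + d * (norm x)\<^sup>2"
        by (simp add: poly_op_add poly_op_const blinfun.add_left blinfun.scaleR_left cinner.add_left
            cinner_scaleR_left Re_cinner_self)
      finally show ?case using d(2) by simp
    qed
    then show ?thesis using lim by (rule tendsto_lowerbound[OF _ _ trivial_limit_sequentially, rotated])
  qed
  then show ?thesis using field_le_epsilon[of 0 "qform (op_fun f T) x"] by (smt (verit))
qed

lemma op_fun_linear:
  assumes T: "between a b T" and f: "continuous_on {a..b} f" and g: "continuous_on {a..b} g"
  shows "op_fun (\<lambda>t. c * f t + d * g t) T = c *\<^sub>R op_fun f T + d *\<^sub>R op_fun g T"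
proof -
  obtain p q where p: "uniform_limit {a..b} (\<lambda>n. poly (p n)) f sequentially"
    and q: "uniform_limit {a..b} (\<lambda>n. poly (q n)) g sequentially"
    using polynomial_approx_sequence[OF f] polynomial_approx_sequence[OF g] by metis
  have "uniform_limit {a..b} (\<lambda>n t. c *\<^sub>R poly (p n) t + d *\<^sub>R poly (q n) t) (\<lambda>t. c *\<^sub>R f t + d *\<^sub>R g t) sequentially"
    by (intro uniform_limit_intros p q)
  then have "(\<lambda>n. poly_op (smult c (p n) + smult d (q n)) T) \<longlonglongrightarrow> op_fun (\<lambda>t. c * f t + d * g t) T"
    by (intro op_fun_tendsto[OF T]) (simp add: poly_fun_simps)
  moreover have "(\<lambda>n. poly_op (smult c (p n) + smult d (q n)) T) \<longlonglongrightarrow> c *\<^sub>R op_fun f T + d *\<^sub>R op_fun g T"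
    unfolding poly_op_add poly_op_smult by (intro tendsto_intros op_fun_tendsto[OF T] p q)
  ultimately show ?thesis by (rule LIMSEQ_unique)
qed

lemma qform_op_fun_mono:
  assumes T: "between a b T" and f: "continuous_on {a..b} f" and g: "continuous_on {a..b} g"
    and le: "\<And>t. t \<in> {a..b} \<Longrightarrow> f t \<le> g t"
  shows "qform (op_fun f T) x \<le> qform (op_fun g T) x"
proof -
  have "0 \<le> qform (op_fun (\<lambda>t. 1 * g t + (-1) * f t) T) x"
    by (rule qform_op_fun_nonneg[OF T]) (use le in \<open>auto intro!: continuous_intros f g\<close>)
  then show ?thesis
    unfolding op_fun_linear[OF T g f] by (simp add: blinfun.diff_left cinner.diff_left)
qed

lemma between_op_fun:
  assumes T: "between a b T" and f: "continuous_on {a..b} f"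
    and le: "\<And>t. t \<in> {a..b} \<Longrightarrow> c \<le> f t \<and> f t \<le> d"
  shows "between c d (op_fun f T)"
proof -
  have const: "op_fun (\<lambda>t. c) T = c *\<^sub>R id_blinfun" for c
    using op_fun_poly[OF T, of "[:c:]"] by (simp add: poly_op_const poly_fun_simps)
  have "c * (norm x)\<^sup>2 \<le> qform (op_fun f T) x \<and> qform (op_fun f T) x \<le> d * (norm x)\<^sup>2" for x
    using qform_op_fun_mono[OF T continuous_on_const f, of c x] le
      qform_op_fun_mono[OF T f continuous_on_const, of d x]
    by (simp add: const blinfun.scaleR_left cinner_scaleR_left Re_cinner_self)
  then show ?thesis using selfadj_op_fun[OF T f] unfolding between_def by blast
qed

lemma qform_op_fun_approx:
  assumes T: "between a b T" and f: "continuous_on {a..b} f"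
    and p: "\<And>t. t \<in> {a..b} \<Longrightarrow> \<bar>poly p t - f t\<bar> < e"
  shows "\<bar>qform (poly_op p T) x - qform (op_fun f T) x\<bar> \<le> e * (norm x)\<^sup>2"
proof -
  have s: "qform (poly_op (p + [:c:]) T) x = qform (poly_op p T) x + c * (norm x)\<^sup>2" for c
    by (simp add: poly_op_add poly_op_const blinfun.add_left blinfun.scaleR_left cinner.add_left
        cinner_scaleR_left Re_cinner_self)
  have "qform (op_fun f T) x \<le> qform (op_fun (poly (p + [:e:])) T) x"
    by (rule qform_op_fun_mono[OF T f]) (use p in \<open>force intro!: continuous_intros\<close>)+
  moreover have "qform (op_fun (poly (p + [:-e:])) T) x \<le> qform (op_fun f T) x"
    by (rule qform_op_fun_mono[OF T _ f]) (use p in \<open>force intro!: continuous_intros\<close>)+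
  ultimately show ?thesis unfolding op_fun_poly[OF T] s by simp
qed


section \<open>Square roots of positive definite operators\<close>

lemma op_powr_half:
  assumes "A \<in> posdef_ops"
  shows "op_powr A (1/2) \<in> selfadj" "op_powr A (-1/2) \<in> selfadj"
    and "op_powr A (1/2) o\<^sub>L op_powr A (-1/2) = id_blinfun"
    and "op_powr A (-1/2) o\<^sub>L op_powr A (1/2) = id_blinfun"
    and "op_powr A (1/2) o\<^sub>L op_powr A (1/2) = A"
proof -
  obtain a b where ab: "0 < a" and A: "between a b A"
    using posdef_ops_between[OF assms] by metis
  have c: "continuous_on {a..b} (\<lambda>t. t powr s)" for s
    using ab by (intro continuous_intros) auto
  show "op_powr A (1/2) \<in> selfadj" "op_powr A (-1/2) \<in> selfadj"
    unfolding op_powr_def by (intro selfadj_op_fun[OF A] c)+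
  have prod: "op_powr A s o\<^sub>L op_powr A r = op_fun (\<lambda>t. t powr (s + r)) A" for s r
    unfolding op_powr_def powr_add by (rule op_fun_mult[OF A c c, symmetric])
  have "op_fun (\<lambda>t. t powr 0) A = op_fun (\<lambda>t. 1) A" "op_fun (\<lambda>t. t powr 1) A = op_fun (\<lambda>t. t) A"
    by (rule op_fun_cong[OF A c]; use ab in simp)+
  then show "op_powr A (1/2) o\<^sub>L op_powr A (-1/2) = id_blinfun"
    "op_powr A (-1/2) o\<^sub>L op_powr A (1/2) = id_blinfun"
    "op_powr A (1/2) o\<^sub>L op_powr A (1/2) = A"
    by (simp_all add: prod op_fun_one[OF A] op_fun_ident[OF A])
qed


section \<open>Operator monotonicity in terms of quadratic forms\<close>

definition unitary_entries :: "nat \<Rightarrow> (nat \<Rightarrow> nat \<Rightarrow> complex) \<Rightarrow> bool" where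
  "unitary_entries n w \<longleftrightarrow> (\<forall>j<n. \<forall>k<n. (\<Sum>i<n. cnj (w i j) * w i k) = (if j = k then 1 else 0))"

text \<open>The quadratic form of the Hermitian matrix with eigenvalues \<open>c\<^sub>k\<close> and eigenvectors the columns
  of \<open>w\<close>.  Entries are given by functions, so that the results can be combined with finite sums in \<open>E\<close>.\<close>

definition unitary_form :: "nat \<Rightarrow> (nat \<Rightarrow> nat \<Rightarrow> complex) \<Rightarrow> (nat \<Rightarrow> real) \<Rightarrow> (nat \<Rightarrow> complex) \<Rightarrow> real" where
  "unitary_form n w c v = (\<Sum>k<n. c k * (cmod (\<Sum>i<n. cnj (w i k) * v i))\<^sup>2)"

definition entries_mat :: "nat \<Rightarrow> (nat \<Rightarrow> nat \<Rightarrow> complex) \<Rightarrow> complex mat" where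
  "entries_mat n w = Matrix.mat n n (\<lambda>(i, j). w i j)"

definition conj_diag :: "nat \<Rightarrow> (nat \<Rightarrow> nat \<Rightarrow> complex) \<Rightarrow> (nat \<Rightarrow> real) \<Rightarrow> complex mat" where
  "conj_diag n w c = entries_mat n w * mat_diag n (\<lambda>i. complex_of_real (c i)) * mat_adjoint (entries_mat n w)"

lemma mat_adjoint_carrier [simp]: "A \<in> carrier_mat n m \<Longrightarrow> mat_adjoint A \<in> carrier_mat m n"
  by (auto simp: mat_adjoint_def)

lemma mat_adjoint_index:
  "i < dim_col A \<Longrightarrow> j < dim_row A \<Longrightarrow> mat_adjoint A $$ (i, j) = cnj (A $$ (j, i))"
  for A :: "complex mat"
  by (simp add: mat_adjoint_def mat_of_rows_index)

lemma entries_mat_carrier [simp]: "entries_mat n w \<in> carrier_mat n n"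
  by (simp add: entries_mat_def)

lemma unitary_entries_mat:
  assumes "unitary_entries n w"
  shows "mat_adjoint (entries_mat n w) * entries_mat n w = 1\<^sub>m n"
    and "entries_mat n w * mat_adjoint (entries_mat n w) = 1\<^sub>m n"
proof -
  let ?W = "entries_mat n w"
  show 1: "mat_adjoint ?W * ?W = 1\<^sub>m n"
  proof (rule eq_matI)
    fix i j assume "i < dim_row (1\<^sub>m n :: complex mat)" "j < dim_col (1\<^sub>m n :: complex mat)"
    then have ij: "i < n" "j < n" by auto
    have "(mat_adjoint ?W * ?W) $$ (i, j) = (\<Sum>k<n. cnj (w k i) * w k j)"
      using ij by (simp add: scalar_prod_def mat_adjoint_def entries_mat_def mat_of_rows_index lessThan_atLeast0)
    then show "(mat_adjoint ?W * ?W) $$ (i, j) = (1\<^sub>m n :: complex mat) $$ (i, j)"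
      using assms ij by (simp add: unitary_entries_def)
  qed (auto simp: entries_mat_def mat_adjoint_def)
  show "?W * mat_adjoint ?W = 1\<^sub>m n"
    by (rule mat_mult_left_right_inverse[OF _ _ 1]) auto
qed

lemma conj_diag_carrier [simp]: "conj_diag n w c \<in> carrier_mat n n"
  unfolding conj_diag_def by (intro mult_carrier_mat[of _ n n]) auto

lemma conj_diag_index:
  assumes "i < n" "j < n"
  shows "conj_diag n w c $$ (i, j) = (\<Sum>k<n. w i k * of_real (c k) * cnj (w j k))"
  using assms
  by (simp add: conj_diag_def mat_diag_mult_right[of _ n n] scalar_prod_def lessThan_atLeast0)
    (simp add: entries_mat_def mat_adjoint_def mat_of_rows_index scalar_prod_def lessThan_atLeast0)

lemma adjoint_conj_diag: "mat_adjoint (conj_diag n w c) = conj_diag n w c"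
proof (rule eq_matI)
  fix i j assume "i < dim_row (conj_diag n w c)" "j < dim_col (conj_diag n w c)"
  moreover have d: "dim_row (conj_diag n w c) = n" "dim_col (conj_diag n w c) = n"
    using conj_diag_carrier[of n w c] by (auto simp del: conj_diag_carrier)
  ultimately show "mat_adjoint (conj_diag n w c) $$ (i, j) = conj_diag n w c $$ (i, j)"
    by (simp add: mat_adjoint_index conj_diag_index mult_ac)
qed (use conj_diag_carrier[of n w c] in \<open>auto simp: mat_adjoint_def simp del: conj_diag_carrier\<close>)

lemma cscalar_conj_diag:
  assumes v: "v \<in> carrier_vec n"
  shows "(conj_diag n w c *\<^sub>v v) \<bullet>c v = of_real (unitary_form n w c (vec_index v))"
proof -
  let ?y = "\<lambda>k. \<Sum>i<n. cnj (w i k) * vec_index v i"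
  have d: "dim_row (conj_diag n w c) = n" "dim_col (conj_diag n w c) = n"
    using conj_diag_carrier[of n w c] by (auto simp del: conj_diag_carrier)
  have "(conj_diag n w c *\<^sub>v v) \<bullet>c v =
     (\<Sum>i<n. (\<Sum>j<n. (\<Sum>k<n. w i k * of_real (c k) * cnj (w j k)) * vec_index v j) * cnj (vec_index v i))"
    using v d by (simp add: scalar_prod_def lessThan_atLeast0 conj_diag_index)
  also have "\<dots> = (\<Sum>i<n. \<Sum>k<n. \<Sum>j<n. w i k * of_real (c k) * cnj (w j k) * vec_index v j * cnj (vec_index v i))"
    by (simp add: sum_distrib_right) (intro sum.cong refl sum.swap)
  also have "\<dots> = (\<Sum>k<n. \<Sum>i<n. \<Sum>j<n. w i k * of_real (c k) * cnj (w j k) * vec_index v j * cnj (vec_index v i))"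
    by (rule sum.swap)
  also have "\<dots> = (\<Sum>k<n. of_real (c k) * (?y k * cnj (?y k)))"
  proof (intro sum.cong refl)
    fix k
    have "cnj (?y k) * ?y k = (\<Sum>i<n. \<Sum>j<n. (w i k * cnj (vec_index v i)) * (cnj (w j k) * vec_index v j))"
      by (simp add: sum_product)
    then show "(\<Sum>i<n. \<Sum>j<n. w i k * of_real (c k) * cnj (w j k) * vec_index v j * cnj (vec_index v i)) =
        of_real (c k) * (?y k * cnj (?y k))"
      by (simp add: mult.commute[of "?y k"] sum_distrib_left) (simp add: mult_ac)
  qed
  also have "\<dots> = of_real (unitary_form n w c (vec_index v))"
    by (simp only: unitary_form_def of_real_sum of_real_mult complex_norm_square)
  finally show ?thesis .
qed

text \<open>Two diagonalisations of one matrix give the same \<open>f(A)\<close>: a nonzero entry \<open>Z\<^sub>i\<^sub>j\<close> of the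
  change of basis between them forces \<open>d\<^sub>j = d'\<^sub>i\<close>, hence \<open>f(d\<^sub>j) = f(d'\<^sub>i)\<close>.\<close>

lemma diagonalisation_fun_unique:
  assumes U: "U \<in> carrier_mat n n" "U * mat_adjoint U = 1\<^sub>m n" "mat_adjoint U * U = 1\<^sub>m n"
    and V: "V \<in> carrier_mat n n" "V * mat_adjoint V = 1\<^sub>m n" "mat_adjoint V * V = 1\<^sub>m n"
    and eq: "U * mat_diag n (\<lambda>i. complex_of_real (d i)) * mat_adjoint U =
             V * mat_diag n (\<lambda>i. complex_of_real (d' i)) * mat_adjoint V"
  shows "U * mat_diag n (\<lambda>i. complex_of_real (f (d i))) * mat_adjoint U =
         V * mat_diag n (\<lambda>i. complex_of_real (f (d' i))) * mat_adjoint V"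
proof -
  let ?D = "\<lambda>d. mat_diag n (\<lambda>i. complex_of_real (d i))"
  have U': "mat_adjoint U \<in> carrier_mat n n" and V': "mat_adjoint V \<in> carrier_mat n n"
    using U(1) V(1) by auto
  have D: "?D d \<in> carrier_mat n n" for d by simp
  define Z where "Z = mat_adjoint V * U"
  have Z: "Z \<in> carrier_mat n n" unfolding Z_def using U V' by auto
  have mult: "X * Y \<in> carrier_mat n n"
    if "X \<in> carrier_mat n n" "Y \<in> carrier_mat n n" for X Y :: "complex mat"
    using that by simp
  have assoc: "X * Y * W = X * (Y * W)"
    if "X \<in> carrier_mat n n" "Y \<in> carrier_mat n n" "W \<in> carrier_mat n n" for X Y W :: "complex mat"
    using that by (auto simp: assoc_mult_mat[of _ n n _ n _ n])
  note carriers = U(1) V(1) U' V' D Z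
  note [simp del] = mat_adjoint_carrier
  have VZ: "V * Z = U"
    unfolding Z_def using carriers V(2) U(1) by (simp add: mult flip: assoc)
  have ZU: "Z * mat_adjoint U = mat_adjoint V"
    unfolding Z_def using carriers U(2) by (simp add: assoc mult right_mult_one_mat[OF V'])
  have ZD: "Z * ?D d = ?D d' * Z"
  proof -
    have "Z * ?D d = mat_adjoint V * (U * ?D d * mat_adjoint U) * U"
      unfolding Z_def using carriers U(3) by (simp add: assoc mult right_mult_one_mat[OF D])
    also have "\<dots> = (mat_adjoint V * V) * ?D d' * (mat_adjoint V * U)"
      unfolding eq using carriers by (simp add: assoc mult)
    also have "\<dots> = ?D d' * Z" unfolding V(3) Z_def by (simp add: left_mult_one_mat[OF D])
    finally show ?thesis .
  qed
  have ZfD: "Z * ?D (\<lambda>i. f (d i)) = ?D (\<lambda>i. f (d' i)) * Z"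
  proof (rule eq_matI)
    fix i j assume "i < dim_row (?D (\<lambda>i. f (d' i)) * Z)" "j < dim_col (?D (\<lambda>i. f (d' i)) * Z)"
    then have ij: "i < n" "j < n" using Z by (auto simp: mat_diag_def)
    have "Z $$ (i, j) * of_real (d j) = of_real (d' i) * Z $$ (i, j)"
      using arg_cong[OF ZD, of "\<lambda>M. M $$ (i, j)"] ij
      by (simp add: mat_diag_mult_right[OF Z] mat_diag_mult_left[OF Z])
    then have "Z $$ (i, j) = 0 \<or> d j = d' i" by (simp add: mult.commute)
    then have "Z $$ (i, j) * of_real (f (d j)) = of_real (f (d' i)) * Z $$ (i, j)" by auto
    then show "(Z * ?D (\<lambda>i. f (d i))) $$ (i, j) = (?D (\<lambda>i. f (d' i)) * Z) $$ (i, j)"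
      using ij by (simp add: mat_diag_mult_right[OF Z] mat_diag_mult_left[OF Z])
  qed (use Z in \<open>auto simp: mat_diag_def\<close>)
  have "U * ?D (\<lambda>i. f (d i)) * mat_adjoint U = V * (Z * ?D (\<lambda>i. f (d i))) * mat_adjoint U"
    using carriers by (subst VZ[symmetric]) (simp add: assoc mult)
  also have "\<dots> = V * ?D (\<lambda>i. f (d' i)) * (Z * mat_adjoint U)"
    unfolding ZfD using carriers by (simp add: assoc mult)
  finally show ?thesis unfolding ZU .
qed

lemma mat_fun_conj_diag:
  assumes w: "unitary_entries n w"
  shows "mat_fun n f (conj_diag n w d) = conj_diag n w (\<lambda>i. f (d i))"
  unfolding mat_fun_def
proof (rule the_equality)
  show "\<exists>U da. U \<in> carrier_mat n n \<and> U * mat_adjoint U = 1\<^sub>m n \<and> mat_adjoint U * U = 1\<^sub>m n \<and>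
     conj_diag n w d = U * mat_diag n (\<lambda>i. complex_of_real (da i)) * mat_adjoint U \<and>
     conj_diag n w (\<lambda>i. f (d i)) = U * mat_diag n (\<lambda>i. complex_of_real (f (da i))) * mat_adjoint U"
    using unitary_entries_mat[OF w]
    by (intro exI[of _ "entries_mat n w"] exI[of _ d]) (simp add: conj_diag_def)
next
  fix B
  assume "\<exists>U da. U \<in> carrier_mat n n \<and> U * mat_adjoint U = 1\<^sub>m n \<and> mat_adjoint U * U = 1\<^sub>m n \<and>
     conj_diag n w d = U * mat_diag n (\<lambda>i. complex_of_real (da i)) * mat_adjoint U \<and>
     B = U * mat_diag n (\<lambda>i. complex_of_real (f (da i))) * mat_adjoint U"
  then obtain U e where U: "U \<in> carrier_mat n n" "U * mat_adjoint U = 1\<^sub>m n" "mat_adjoint U * U = 1\<^sub>m n"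
    and eq: "conj_diag n w d = U * mat_diag n (\<lambda>i. complex_of_real (e i)) * mat_adjoint U"
    and B: "B = U * mat_diag n (\<lambda>i. complex_of_real (f (e i))) * mat_adjoint U"
    by blast
  show "B = conj_diag n w (\<lambda>i. f (d i))"
    unfolding B conj_diag_def
    by (rule diagonalisation_fun_unique[OF U entries_mat_carrier unitary_entries_mat(2,1)[OF w]])
      (use eq in \<open>simp add: conj_diag_def\<close>)
qed

lemma unitary_form_pos:
  assumes w: "unitary_entries n w" and c: "\<And>i. i < n \<Longrightarrow> c i > 0" and v: "i < n" "v i \<noteq> 0"
  shows "unitary_form n w c v > 0"
proof -
  let ?y = "\<lambda>k. \<Sum>i<n. cnj (w i k) * v i"
  \<comment> \<open>The columns of a square matrix being orthonormal, so are its rows.\<close>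
  have rows: "(\<Sum>k<n. w a k * cnj (w b k)) = (if a = b then 1 else 0)" if "a < n" "b < n" for a b
    using arg_cong[OF unitary_entries_mat(2)[OF w], of "\<lambda>M. M $$ (a, b)"] that
    by (simp add: scalar_prod_def lessThan_atLeast0 entries_mat_def mat_adjoint_def mat_of_rows_index)
  have "(\<Sum>k<n. w i k * ?y k) = (\<Sum>j<n. (\<Sum>k<n. w i k * cnj (w j k)) * v j)"
    by (simp add: sum_distrib_left sum_distrib_right mult_ac) (rule sum.swap)
  also have "\<dots> = (\<Sum>j<n. if i = j then v j else 0)"
    using v(1) by (intro sum.cong) (auto simp: rows)
  also have "\<dots> = v i" using v(1) by simp
  finally have sum: "(\<Sum>k<n. w i k * ?y k) = v i" .
  obtain k where "k < n" "?y k \<noteq> 0"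
  proof (rule ccontr)
    assume "\<not> thesis"
    then have "?y k = 0" if "k < n" for k using that \<open>\<And>k. \<lbrakk>k < n; ?y k \<noteq> 0\<rbrakk> \<Longrightarrow> thesis\<close> by blast
    then have "(\<Sum>k<n. w i k * ?y k) = 0" by (intro sum.neutral) simp
    then show False using sum v(2) by simp
  qed
  then have "0 < c k * (cmod (?y k))\<^sup>2" using c by simp
  then show ?thesis
    unfolding unitary_form_def using \<open>k < n\<close> c
    by (intro sum_pos2[of _ k]) (auto simp: less_imp_le)
qed

text \<open>Compressions of operators come with their eigenvalues and eigenvectors, so it is
  convenient to have operator monotonicity for matrices that are given by their diagonalisations.\<close>

lemma operator_monotone_forms:
  assumes g: "operator_monotone g"
    and w: "unitary_entries n w" "\<And>i. i < n \<Longrightarrow> c i > 0"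
    and w': "unitary_entries n w'" "\<And>i. i < n \<Longrightarrow> c' i > 0"
    and le: "\<And>v. unitary_form n w c v \<le> unitary_form n w' c' v"
  shows "unitary_form n w (\<lambda>i. g (c i)) v \<le> unitary_form n w' (\<lambda>i. g (c' i)) v"
proof -
  have posdef: "posdef_mat n (conj_diag n u e)" if "unitary_entries n u" "\<And>i. i < n \<Longrightarrow> e i > 0" for u e
    unfolding posdef_mat_def
  proof (intro conjI ballI impI)
    fix x :: "complex vec" assume x: "x \<in> carrier_vec n" "x \<noteq> 0\<^sub>v n"
    then obtain i where "i < n" "vec_index x i \<noteq> 0" by (metis carrier_vecD eq_vecI index_zero_vec)
    then show "0 < (conj_diag n u e *\<^sub>v x) \<bullet>c x"
      using unitary_form_pos[OF that] by (simp add: cscalar_conj_diag[OF x(1)] less_complex_def)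
  qed (simp_all add: adjoint_conj_diag)
  have diff: "((conj_diag n w' e' - conj_diag n w e) *\<^sub>v x) \<bullet>c x =
      of_real (unitary_form n w' e' (vec_index x) - unitary_form n w e (vec_index x))"
    if x: "x \<in> carrier_vec n" for x e e'
  proof -
    have 1: "(conj_diag n w' e' - conj_diag n w e) *\<^sub>v x = conj_diag n w' e' *\<^sub>v x - conj_diag n w e *\<^sub>v x"
      by (rule minus_mult_distrib_mat_vec[OF conj_diag_carrier conj_diag_carrier x])
    show ?thesis unfolding 1
      using x by (subst minus_scalar_prod_distrib[of _ n])
        (auto simp: cscalar_conj_diag[OF x] intro: mult_mat_vec_carrier[OF conj_diag_carrier])
  qed
  have "psd_mat n (conj_diag n w' c' - conj_diag n w c)"
    unfolding psd_mat_def
  proof (intro conjI ballI)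
    show "mat_adjoint (conj_diag n w' c' - conj_diag n w c) = conj_diag n w' c' - conj_diag n w c"
    proof (rule eq_matI)
      fix i j assume ij: "i < dim_row (conj_diag n w' c' - conj_diag n w c)"
        "j < dim_col (conj_diag n w' c' - conj_diag n w c)"
      have d: "dim_row (conj_diag n u e) = n" "dim_col (conj_diag n u e) = n" for u e
        using conj_diag_carrier[of n u e] by (auto simp del: conj_diag_carrier)
      have h: "cnj (conj_diag n u e $$ (j, i)) = conj_diag n u e $$ (i, j)" for u e
        using mat_adjoint_index[of i "conj_diag n u e" j] adjoint_conj_diag[of n u e] ij d by auto
      show "mat_adjoint (conj_diag n w' c' - conj_diag n w c) $$ (i, j) = (conj_diag n w' c' - conj_diag n w c) $$ (i, j)"
        using ij d by (simp add: mat_adjoint_index h)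
    qed (use conj_diag_carrier[of n w c] in \<open>auto simp: mat_adjoint_def simp del: conj_diag_carrier\<close>)
  qed (auto simp: diff le less_eq_complex_def intro!: minus_carrier_mat)
  then have "psd_mat n (mat_fun n g (conj_diag n w' c') - mat_fun n g (conj_diag n w c))"
    using g posdef[of w c, OF w] posdef[of w' c', OF w'] unfolding operator_monotone_def by blast
  then have psd: "psd_mat n (conj_diag n w' (\<lambda>i. g (c' i)) - conj_diag n w (\<lambda>i. g (c i)))"
    by (simp add: mat_fun_conj_diag w w')
  define x where "x = Matrix.vec n v"
  have x: "x \<in> carrier_vec n" and xv: "unitary_form n u e (vec_index x) = unitary_form n u e v" for u e
    by (simp_all add: x_def unitary_form_def)
  show ?thesis
    using psd x unfolding psd_mat_def by (fastforce simp: diff less_eq_complex_def xv)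
qed


section \<open>Compression to finite-dimensional subspaces\<close>

definition orthonormal :: "nat \<Rightarrow> (nat \<Rightarrow> 'a::chilbert_space) \<Rightarrow> bool" where
  "orthonormal n e \<longleftrightarrow> (\<forall>i<n. \<forall>j<n. cinner (e i) (e j) = (if i = j then 1 else 0))"

text \<open>The orthogonal projection onto the span of \<open>e\<^sub>0, \<dots>, e\<^sub>n\<^sub>-\<^sub>1\<close>.  Membership of \<open>y\<close> in that
  subspace is expressed by \<open>proj n e y = y\<close>.\<close>

definition proj :: "nat \<Rightarrow> (nat \<Rightarrow> 'a::chilbert_space) \<Rightarrow> 'a \<Rightarrow> 'a" where
  "proj n e y = (\<Sum>i<n. cinner y (e i) *\<^sub>C e i)"

lemma cinner_sum_scaleC_left: "cinner (\<Sum>i\<in>I. z i *\<^sub>C f i) y = (\<Sum>i\<in>I. z i * cinner (f i) (y::'a::chilbert_space))"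
  by (simp add: cinner.sum_left cinner_scaleC_left)

lemma cinner_sum_scaleC_right: "cinner y (\<Sum>i\<in>I. z i *\<^sub>C f i) = (\<Sum>i\<in>I. cnj (z i) * cinner (y::'a::chilbert_space) (f i))"
  by (simp add: cinner.sum_right cinner_scaleC_right)

lemma cmod_cinner_commute: "cmod (cinner x y) = cmod (cinner (y::'a::chilbert_space) x)"
  by (metis cinner_commute complex_mod_cnj)

lemma cinner_sum_orthonormal:
  assumes "orthonormal n e" "j < n"
  shows "cinner (\<Sum>i<n. z i *\<^sub>C e i) (e j) = z j"
proof -
  have "cinner (\<Sum>i<n. z i *\<^sub>C e i) (e j) = (\<Sum>i<n. if i = j then z i else 0)"
    unfolding cinner_sum_scaleC_left
    by (intro sum.cong) (use assms in \<open>auto simp: orthonormal_def\<close>)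
  then show ?thesis using assms(2) by simp
qed

lemma proj_sum:
  assumes "orthonormal n e"
  shows "proj n e (\<Sum>i<n. z i *\<^sub>C e i) = (\<Sum>i<n. z i *\<^sub>C e i)"
  unfolding proj_def by (intro sum.cong refl) (simp add: cinner_sum_orthonormal[OF assms])

lemma proj_proj: "orthonormal n e \<Longrightarrow> proj n e (proj n e y) = proj n e y"
  using proj_sum[of n e "\<lambda>i. cinner y (e i)"] by (simp add: proj_def)

lemma cinner_proj_basis:
  "orthonormal n e \<Longrightarrow> j < n \<Longrightarrow> cinner (proj n e y) (e j) = cinner y (e j)"
  unfolding proj_def by (rule cinner_sum_orthonormal)

lemma proj_add: "proj n e (x + y) = proj n e x + proj n e y"
  by (simp add: proj_def cinner.add_left scaleC_add_left sum.distrib)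

lemma proj_scaleC: "proj n e (a *\<^sub>C x) = a *\<^sub>C proj n e x"
  by (simp add: proj_def cinner_scaleC_left scaleC_sum_right scaleC_scaleC)

lemma proj_scaleR: "proj n e (r *\<^sub>R x) = r *\<^sub>R proj n e x"
  using proj_scaleC[of n e "of_real r" x] by (simp add: scaleC_of_real)

lemma proj_zero: "proj n e 0 = 0"
  using proj_scaleR[of n e 0] by simp

lemma proj_diff: "proj n e (x - y) = proj n e x - proj n e y"
  using proj_add[of n e x "- y"] proj_scaleR[of n e "-1" y] by simp

lemma proj_sum_fixed: "(\<And>i. i \<in> I \<Longrightarrow> proj n e (f i) = f i) \<Longrightarrow> proj n e (\<Sum>i\<in>I. z i *\<^sub>C f i) = (\<Sum>i\<in>I. z i *\<^sub>C f i)"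
  by (induction I rule: infinite_finite_induct) (auto simp: proj_zero proj_add proj_scaleC)

lemma proj_basis: "orthonormal n e \<Longrightarrow> j < n \<Longrightarrow> proj n e (e j) = e j"
proof -
  assume *: "orthonormal n e" "j < n"
  have "(\<Sum>i<n. (if i = j then 1 else 0) *\<^sub>C e i) = (\<Sum>i<n. if i = j then e i else 0)"
    by (intro sum.cong) auto
  then show "proj n e (e j) = e j"
    using proj_sum[OF *(1), of "\<lambda>i. if i = j then 1 else 0"] *(2) by simp
qed

lemma cinner_fixed_by_proj:
  assumes "proj n e y = y"
  shows "cinner x y = (\<Sum>i<n. cinner x (e i) * cnj (cinner y (e i)))"
proof -
  have "cinner x y = cinner x (proj n e y)" using assms by simp
  then show ?thesis unfolding proj_def cinner_sum_scaleC_right by (simp add: mult.commute)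
qed

lemma norm_sq_fixed_by_proj:
  assumes "proj n e y = y"
  shows "(norm y)\<^sup>2 = (\<Sum>i<n. (cmod (cinner y (e i)))\<^sup>2)"
proof -
  have "complex_of_real ((norm y)\<^sup>2) = of_real (\<Sum>i<n. (cmod (cinner y (e i)))\<^sup>2)"
    unfolding cinner_norm[symmetric] cinner_fixed_by_proj[OF assms, of y]
    by (simp only: of_real_sum complex_norm_square)
  then show ?thesis using of_real_eq_iff by blast
qed

lemma norm_sq_minus_proj:
  assumes "orthonormal n e"
  shows "(norm (y - proj n e y))\<^sup>2 = (norm y)\<^sup>2 - (\<Sum>i<n. (cmod (cinner y (e i)))\<^sup>2)"
proof -
  let ?p = "proj n e y"
  have "cinner (y - ?p) ?p = 0"
    using cinner_fixed_by_proj[OF proj_proj[OF assms], of "y - ?p" y]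
    by (simp add: cinner.diff_left cinner_proj_basis[OF assms])
  then have "(norm y)\<^sup>2 = (norm (y - ?p))\<^sup>2 + (norm ?p)\<^sup>2"
    using norm_add_sq[of "y - ?p" ?p] by simp
  moreover have "(norm ?p)\<^sup>2 = (\<Sum>i<n. (cmod (cinner y (e i)))\<^sup>2)"
    unfolding norm_sq_fixed_by_proj[OF proj_proj[OF assms]] by (simp add: cinner_proj_basis[OF assms])
  ultimately show ?thesis by simp
qed

lemma orthonormal_extend:
  assumes "orthonormal k u" "norm w = 1" "\<And>j. j < k \<Longrightarrow> cinner w (u j) = 0"
  shows "orthonormal (Suc k) (u(k := w))"
proof -
  have "cinner (u j) w = 0" if "j < k" for j
    using assms(3)[OF that] cinner_commute[of "u j" w] by simp
  then show ?thesis
    using assms by (auto simp: orthonormal_def less_Suc_eq cinner_norm)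
qed

lemma Gram_Schmidt:
  obtains n e where "orthonormal n e" "\<And>x. x \<in> set xs \<Longrightarrow> proj n e x = (x::'a::chilbert_space)"
proof -
  have "\<exists>n e. orthonormal n e \<and> (\<forall>x\<in>set xs. proj n e x = x)"
  proof (induction xs)
    case Nil
    show ?case by (rule exI[of _ 0]) (simp add: orthonormal_def)
  next
    case (Cons y xs)
    then obtain n e where e: "orthonormal n e" "\<forall>x\<in>set xs. proj n e x = x" by blast
    define z where "z = y - proj n e y"
    show ?case
    proof (cases "z = 0")
      case True
      then show ?thesis using e by (intro exI[of _ n] exI[of _ e]) (simp add: z_def)
    next
      case False
      define w where "w = (1 / norm z) *\<^sub>R z"
      have zw: "z = norm z *\<^sub>R w" and nw: "norm w = 1" using False by (simp_all add: w_def)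
      have zo: "cinner z (e j) = 0" if "j < n" for j
        using that by (simp add: z_def cinner.diff_left cinner_proj_basis[OF e(1)])
      then have wo: "cinner w (e j) = 0" if "j < n" for j
        using that by (simp add: w_def cinner_scaleR_left)
      let ?e = "e(n := w)"
      have o: "orthonormal (Suc n) ?e" using e(1) nw wo by (rule orthonormal_extend)
      have P: "proj (Suc n) ?e x = proj n e x + cinner x w *\<^sub>C w" for x
        by (simp add: proj_def)
      have fix_old: "proj (Suc n) ?e x = x" if "proj n e x = x" for x
      proof -
        have "cinner w x = 0"
          using cinner_fixed_by_proj[OF that, of w] by (simp add: wo)
        then have "cinner x w = 0" using cinner_commute[of x w] by simp
        then show ?thesis using that by (simp add: P)
      qed
      have "proj (Suc n) ?e z = z"
        using proj_basis[OF o, of n] by (subst (1 2) zw) (simp add: proj_scaleR)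
      moreover have "proj (Suc n) ?e (proj n e y) = proj n e y"
        by (rule fix_old) (rule proj_proj[OF e(1)])
      ultimately have "proj (Suc n) ?e y = y"
        using proj_add[of "Suc n" ?e z "proj n e y"] by (simp add: z_def)
      then have "\<forall>x\<in>set (y # xs). proj (Suc n) ?e x = x" using e(2) fix_old by auto
      then show ?thesis using o by blast
    qed
  qed
  then show ?thesis using that by blast
qed

text \<open>Dimension count: \<open>\<Sum>\<^sub>i \<parallel>e\<^sub>i - P\<^sub>u e\<^sub>i\<parallel>\<^sup>2 = n - \<Sum>\<^sub>j \<parallel>u\<^sub>j\<parallel>\<^sup>2 = n - k\<close>.\<close>

lemma sum_distance_basis:
  assumes e: "orthonormal n e" and u: "orthonormal k u" "\<And>j. j < k \<Longrightarrow> proj n e (u j) = u j"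
  shows "(\<Sum>i<n. (norm (e i - proj k u (e i)))\<^sup>2) = real n - real k"
proof -
  have unit: "orthonormal m v \<Longrightarrow> i < m \<Longrightarrow> (norm (v i))\<^sup>2 = 1" for m i and v :: "nat \<Rightarrow> 'a"
    by (simp add: orthonormal_def Re_cinner_self[symmetric])
  have "(\<Sum>i<n. (norm (e i - proj k u (e i)))\<^sup>2) = (\<Sum>i<n. 1 - (\<Sum>j<k. (cmod (cinner (e i) (u j)))\<^sup>2))"
    by (intro sum.cong refl) (simp add: norm_sq_minus_proj[OF u(1)] unit[OF e])
  also have "\<dots> = real n - (\<Sum>i<n. \<Sum>j<k. (cmod (cinner (e i) (u j)))\<^sup>2)"
    by (simp add: sum_subtractf)
  also have "(\<Sum>i<n. \<Sum>j<k. (cmod (cinner (e i) (u j)))\<^sup>2) = (\<Sum>j<k. \<Sum>i<n. (cmod (cinner (u j) (e i)))\<^sup>2)"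
    by (subst sum.swap) (intro sum.cong refl arg_cong[where f = "\<lambda>x. x\<^sup>2"] cmod_cinner_commute)
  also have "\<dots> = (\<Sum>j<k. 1)"
    by (intro sum.cong refl) (simp add: norm_sq_fixed_by_proj[OF u(2), symmetric] unit[OF u(1)])
  finally show ?thesis by simp
qed

lemma orthonormal_complete:
  assumes e: "orthonormal n e" and u: "orthonormal n u" "\<And>j. j < n \<Longrightarrow> proj n e (u j) = u j"
    and y: "proj n e y = y"
  shows "proj n u y = y"
proof -
  have "\<forall>i\<in>{..<n}. (norm (e i - proj n u (e i)))\<^sup>2 = 0"
    using sum_distance_basis[OF e u] by (subst sum_nonneg_eq_0_iff[symmetric]) auto
  then have "proj n u (e i) = e i" if "i < n" for i using that by auto
  then have "proj n u (proj n e y) = proj n e y"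
    unfolding proj_def[of n e y] by (intro proj_sum_fixed) simp
  then show ?thesis using y by simp
qed

lemma orthogonal_unit_vector:
  assumes e: "orthonormal n e" and u: "orthonormal k u" "\<And>j. j < k \<Longrightarrow> proj n e (u j) = u j"
    and "k < n"
  obtains w where "proj n e w = w" "norm w = 1" "\<And>j. j < k \<Longrightarrow> cinner w (u j) = 0"
proof -
  have "(\<Sum>i<n. (norm (e i - proj k u (e i)))\<^sup>2) \<noteq> 0"
    using sum_distance_basis[OF e u] \<open>k < n\<close> by simp
  then obtain i where i: "i < n" "e i - proj k u (e i) \<noteq> 0"
    by (metis (mono_tags, lifting) lessThan_iff norm_zero power_zero_numeral sum.neutral)
  define z where "z = e i - proj k u (e i)"
  have "proj n e (proj k u (e i)) = proj k u (e i)"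
    unfolding proj_def[of k u] by (intro proj_sum_fixed) (simp add: u(2))
  then have "proj n e z = z" by (simp add: z_def proj_diff proj_basis[OF e] i)
  moreover have "cinner z (u j) = 0" if "j < k" for j
    using that by (simp add: z_def cinner.diff_left cinner_proj_basis[OF u(1)])
  ultimately show ?thesis
    using i(2) that[of "(1 / norm z) *\<^sub>R z"] by (simp add: proj_scaleR cinner_scaleR_left flip: z_def)
qed

lemma bounded_bilinear_scaleC: "bounded_bilinear (\<lambda>a x. a *\<^sub>C (x::'a::chilbert_space))"
proof
  show "\<exists>K. \<forall>a b. norm (a *\<^sub>C (b::'a)) \<le> norm a * norm b * K"
    by (rule exI[of _ 1]) (simp add: norm_scaleC)
qed (auto simp: scaleC_add_right scaleC_add_left scaleC_scaleR scaleC_scaleC scaleC_of_real[symmetric]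
    scaleR_conv_of_real mult.commute)

text \<open>Induction on the dimension: the box for \<open>n + 1\<close> is the sum of the box for \<open>n\<close> and a disc in the
  direction \<open>e\<^sub>n\<close>.\<close>

lemma compact_coordinate_box:
  "compact {(\<Sum>i<n. z i *\<^sub>C e i) | z. \<forall>i<n. cmod (z i) \<le> 1}" for e :: "nat \<Rightarrow> 'a::chilbert_space"
proof (induction n)
  case 0
  show ?case by simp
next
  case (Suc n)
  let ?B = "\<lambda>n. {(\<Sum>i<n. z i *\<^sub>C e i) | z. \<forall>i<n. cmod (z i) \<le> 1}"
  have "compact ((\<lambda>a. a *\<^sub>C e n) ` cball 0 1)"
    by (intro compact_continuous_image compact_cball linear_continuous_on
        bounded_bilinear.bounded_linear_left[OF bounded_bilinear_scaleC])
  then have "compact {x + y | x y. x \<in> ?B n \<and> y \<in> (\<lambda>a. a *\<^sub>C e n) ` cball 0 1}"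
    by (intro compact_sums Suc)
  also have "{x + y | x y. x \<in> ?B n \<and> y \<in> (\<lambda>a. a *\<^sub>C e n) ` cball 0 1} = ?B (Suc n)" (is "?L = ?R")
  proof
    show "?L \<subseteq> ?R"
    proof
      fix y assume "y \<in> ?L"
      then obtain z a where za: "\<forall>i<n. cmod (z i) \<le> 1" "cmod a \<le> 1" "y = (\<Sum>i<n. z i *\<^sub>C e i) + a *\<^sub>C e n"
        by auto
      have "y = (\<Sum>i<Suc n. (z(n := a)) i *\<^sub>C e i)" by (simp add: za(3))
      moreover have "\<forall>i<Suc n. cmod ((z(n := a)) i) \<le> 1" using za by (auto simp: less_Suc_eq)
      ultimately show "y \<in> ?R" by blast
    qed
    show "?R \<subseteq> ?L"
    proof
      fix y assume "y \<in> ?R"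
      then obtain z where z: "\<forall>i<Suc n. cmod (z i) \<le> 1" "y = (\<Sum>i<n. z i *\<^sub>C e i) + z n *\<^sub>C e n"
        by auto
      have "(\<Sum>i<n. z i *\<^sub>C e i) \<in> ?B n" "z n *\<^sub>C e n \<in> (\<lambda>a. a *\<^sub>C e n) ` cball 0 1"
        using z(1) by auto
      then show "y \<in> ?L" using z(2) by blast
    qed
  qed
  finally show ?case .
qed

lemma compact_unit_sphere_orthogonal:
  assumes "orthonormal n e"
  shows "compact {w::'a::chilbert_space. proj n e w = w \<and> norm w = 1 \<and> (\<forall>j<k. cinner w (u j) = 0)}" (is "compact ?S")
proof -
  have cont: "continuous_on UNIV (proj n e)"
    unfolding proj_def
    by (intro continuous_on_sum bounded_bilinear.continuous_on[OF bounded_bilinear_scaleC]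
        cinner.continuous_on continuous_on_const continuous_on_id)
  have "closed ({w. proj n e w = w} \<inter> {w. norm w = 1} \<inter> (\<Inter>j\<in>{..<k}. {w. cinner w (u j) = 0}))"
    by (intro closed_Int closed_INT ballI closed_Collect_eq continuous_on_norm continuous_on_id
        continuous_on_const cont cinner.continuous_on)
  moreover have "?S = {w. proj n e w = w} \<inter> {w. norm w = 1} \<inter> (\<Inter>j\<in>{..<k}. {w. cinner w (u j) = 0})"
    by auto
  ultimately have "closed ?S" by simp
  moreover have "?S \<subseteq> {(\<Sum>i<n. z i *\<^sub>C e i) | z. \<forall>i<n. cmod (z i) \<le> 1}"
  proof
    fix w assume w: "w \<in> ?S"
    then have "w = (\<Sum>i<n. cinner w (e i) *\<^sub>C e i)" by (simp add: proj_def)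
    moreover have "\<forall>i<n. cmod (cinner w (e i)) \<le> 1"
    proof (intro allI impI)
      fix i assume "i < n"
      then have "cinner (e i) (e i) = 1" using assms by (simp add: orthonormal_def)
      then have "(norm (e i))\<^sup>2 = 1" using Re_cinner_self[of "e i"] by simp
      then have "norm (e i) = 1" by (simp add: power2_eq_1_iff) (use norm_ge_zero[of "e i"] in linarith)
      then show "cmod (cinner w (e i)) \<le> 1" using Cauchy_Schwarz[of w "e i"] w by simp
    qed
    ultimately show "w \<in> {(\<Sum>i<n. z i *\<^sub>C e i) | z. \<forall>i<n. cmod (z i) \<le> 1}"
      unfolding mem_Collect_eq by (intro exI[of _ "\<lambda>i. cinner w (e i)"] conjI)
  qed
  ultimately show ?thesis
    using compact_Int_closed[OF compact_coordinate_box[of e n], of ?S] by (simp only: inf.absorb2)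
qed

text \<open>First variation at a maximiser \<open>x\<close> of the Rayleigh quotient: \<open>Tx\<close> is orthogonal to every
  admissible direction that is orthogonal to \<open>x\<close>.\<close>

lemma Rayleigh_maximiser:
  assumes T: "T \<in> selfadj" and x: "x \<in> W" "norm x = 1"
    and W: "\<And>y z a. y \<in> W \<Longrightarrow> z \<in> W \<Longrightarrow> y + a *\<^sub>C z \<in> W"
    and max: "\<And>z. z \<in> W \<Longrightarrow> qform T z \<le> qform T x * (norm z)\<^sup>2"
    and y: "y \<in> W" "cinner x y = 0"
  shows "cinner (T x) y = 0"
proof -
  have Re0: "Re (cinner (T x) z) = 0" if z: "z \<in> W" "cinner x z = 0" for z
  proof (rule ccontr)
    let ?r = "Re (cinner (T x) z)"
    assume "?r \<noteq> 0"
    let ?K = "\<bar>qform T x * (norm z)\<^sup>2 - qform T z\<bar> + 1"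
    have ineq: "2 * s * ?r \<le> s\<^sup>2 * ?K" for s
    proof -
      have "x + s *\<^sub>R z \<in> W" using W[OF x(1) z(1), of "of_real s"] by (simp add: scaleC_of_real)
      then have "qform T (x + s *\<^sub>R z) \<le> qform T x * (norm (x + s *\<^sub>R z))\<^sup>2" by (rule max)
      moreover have "(norm (x + s *\<^sub>R z))\<^sup>2 = 1 + s\<^sup>2 * (norm z)\<^sup>2"
        unfolding norm_add_sq using x(2) z(2) by (simp add: cinner_scaleR_right power_mult_distrib)
      moreover have "Re (cinner (T z) x) = ?r"
        using selfadj_cinner[OF T, of z x] cinner_commute[of z "T x"] by simp
      then have "qform T (x + s *\<^sub>R z) = qform T x + 2 * s * ?r + s\<^sup>2 * qform T z"
        by (simp add: blinfun.add_right blinfun.scaleR_right cinner.add_left cinner.add_right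
            cinner_scaleR_left cinner_scaleR_right power2_eq_square algebra_simps)
      ultimately have "2 * s * ?r \<le> s\<^sup>2 * (qform T x * (norm z)\<^sup>2 - qform T z)"
        by (simp add: algebra_simps)
      also have "\<dots> \<le> s\<^sup>2 * ?K" by (intro mult_left_mono) auto
      finally show ?thesis .
    qed
    have K: "?K > 0" by simp
    have "2 * (?r / ?K) * ?r \<le> (?r / ?K)\<^sup>2 * ?K" by (rule ineq)
    also have "\<dots> = (?r / ?K) * ?r" using K by (simp add: power2_eq_square)
    finally have "?r * ?r / ?K \<le> 0" by simp
    moreover have "?r * ?r / ?K > 0"
      using K \<open>?r \<noteq> 0\<close> by (intro divide_pos_pos) (auto simp: zero_less_mult_iff linorder_neq_iff)
    ultimately show False by simp
  qed
  have iy: "\<i> *\<^sub>C y \<in> W"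
    using W[OF W[OF y(1) y(1), of "-1"] y(1), of \<i>] scaleC_of_real[of "-1" y] by simp
  have "Re (cinner (T x) (\<i> *\<^sub>C y)) = 0"
    by (rule Re0[OF iy]) (simp add: cinner_scaleC_right y(2))
  then have "Im (cinner (T x) y) = 0" by (simp add: cinner_scaleC_right)
  then show ?thesis using Re0[OF y] by (simp add: complex_eq_iff)
qed

text \<open>The vectors \<open>u\<^sub>0, u\<^sub>1, \<dots>\<close> are chosen greedily: \<open>u\<^sub>k\<close> maximises the Rayleigh quotient of \<open>T\<close> on
  the orthogonal complement of its predecessors in the subspace.  By the first variation \<open>Tu\<^sub>k\<close> is
  orthogonal to all later candidates, which is the last clause of the induction hypothesis.\<close>

lemma compression_eigenbasis:
  assumes T: "T \<in> selfadj" and e: "orthonormal n e"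
  obtains u where "orthonormal n u" "\<And>j. j < n \<Longrightarrow> proj n e (u j) = u j"
    "\<And>i j. i < n \<Longrightarrow> j < n \<Longrightarrow> i \<noteq> j \<Longrightarrow> cinner (T (u i)) (u j) = 0"
proof -
  have "\<exists>u. orthonormal k u \<and> (\<forall>j<k. proj n e (u j) = u j) \<and>
      (\<forall>i<k. \<forall>j<k. i \<noteq> j \<longrightarrow> cinner (T (u i)) (u j) = 0) \<and>
      (\<forall>i<k. \<forall>y. proj n e y = y \<and> (\<forall>j<k. cinner y (u j) = 0) \<longrightarrow> cinner (T (u i)) y = 0)"
    if "k \<le> n" for k
    using that
  proof (induction k)
    case 0
    show ?case by (simp add: orthonormal_def)
  next
    case (Suc k)
    then obtain u where u: "orthonormal k u" "\<forall>j<k. proj n e (u j) = u j"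
      "\<forall>i<k. \<forall>j<k. i \<noteq> j \<longrightarrow> cinner (T (u i)) (u j) = 0"
      "\<And>i y. i < k \<Longrightarrow> proj n e y = y \<Longrightarrow> \<forall>j<k. cinner y (u j) = 0 \<Longrightarrow> cinner (T (u i)) y = 0"
      by auto
    define W where "W = {y. proj n e y = y \<and> (\<forall>j<k. cinner y (u j) = 0)}"
    let ?S = "{w. proj n e w = w \<and> norm w = 1 \<and> (\<forall>j<k. cinner w (u j) = 0)}"
    have ne: "?S \<noteq> {}"
    proof -
      obtain w where "proj n e w = w" "norm w = 1" "\<And>j. j < k \<Longrightarrow> cinner w (u j) = 0"
        by (rule orthogonal_unit_vector[OF e u(1)]) (use u(2) Suc.prems in auto)
      then show ?thesis by blast
    qed
    have cont: "continuous_on ?S (qform T)"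
      by (intro continuous_on_Re cinner.continuous_on blinfun.continuous_on continuous_on_const continuous_on_id)
    obtain x where x: "x \<in> ?S" "\<forall>z\<in>?S. qform T z \<le> qform T x"
      by (rule bexE[OF continuous_attains_sup[OF compact_unit_sphere_orthogonal[OF e, of k u] ne cont]])
    have xW: "x \<in> W" "norm x = 1" using x(1) by (auto simp: W_def)
    have Wlin: "y + a *\<^sub>C z \<in> W" if "y \<in> W" "z \<in> W" for y z a
      using that by (simp add: W_def proj_add proj_scaleC cinner.add_left cinner_scaleC_left)
    have max: "qform T z \<le> qform T x * (norm z)\<^sup>2" if "z \<in> W" for z
    proof (cases "z = 0")
      case False
      define v where "v = (1 / norm z) *\<^sub>R z"
      have "v \<in> ?S" using that False by (simp add: v_def W_def proj_scaleR cinner_scaleR_left)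
      moreover have "qform T z = (norm z)\<^sup>2 * qform T v"
        using False by (simp add: v_def blinfun.scaleR_right cinner_scaleR_left cinner_scaleR_right power2_eq_square)
      ultimately show ?thesis using bspec[OF x(2), of v] by (simp add: mult.commute mult_right_mono)
    qed (simp add: cinner.zero_left)
    have ortho: "cinner (T x) y = 0" if "y \<in> W" "cinner x y = 0" for y
      by (rule Rayleigh_maximiser[OF T xW Wlin max that])
    let ?u = "u(k := x)"
    have "orthonormal (Suc k) ?u"
      using u(1) xW by (intro orthonormal_extend) (auto simp: W_def)
    moreover have "\<forall>j<Suc k. proj n e (?u j) = ?u j"
      using u(2) xW by (auto simp: less_Suc_eq W_def)
    moreover have "\<forall>i<Suc k. \<forall>j<Suc k. i \<noteq> j \<longrightarrow> cinner (T (?u i)) (?u j) = 0"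
    proof (intro allI impI)
      fix i j assume ij: "i < Suc k" "j < Suc k" "i \<noteq> j"
      have ux: "cinner (T (u i)) x = 0" if "i < k" for i
        using u(4)[OF that] xW by (simp add: W_def)
      have xu: "cinner (T x) (u i) = 0" if "i < k" for i
        using ux[OF that] selfadj_cinner[OF T, of "u i" x] cinner_commute[of "T x" "u i"] by simp
      show "cinner (T (?u i)) (?u j) = 0"
        using ij u(3) ux xu by (auto simp: less_Suc_eq)
    qed
    moreover have "\<forall>i<Suc k. \<forall>y. proj n e y = y \<and> (\<forall>j<Suc k. cinner y (?u j) = 0) \<longrightarrow> cinner (T (?u i)) y = 0"
    proof (intro allI impI, elim conjE)
      fix i y assume i: "i < Suc k" and y: "proj n e y = y" "\<forall>j<Suc k. cinner y (?u j) = 0"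
      have "y \<in> W" using y by (auto simp: W_def less_Suc_eq split: if_splits)
      moreover have "cinner x y = 0" using y(2) cinner_commute[of x y] by auto
      ultimately show "cinner (T (?u i)) y = 0"
        using i ortho u(4) by (auto simp: less_Suc_eq W_def)
    qed
    ultimately show ?case by blast
  qed
  from this[of n] show ?thesis using that by auto
qed

lemma cinner_compression:
  assumes T: "T \<in> selfadj"
    and u: "\<And>i j. i < n \<Longrightarrow> j < n \<Longrightarrow> i \<noteq> j \<Longrightarrow> cinner (T (u i)) (u j) = 0"
    and y: "proj n u y = y" and j: "j < n"
  shows "cinner (T y) (u j) = of_real (qform T (u j)) * cinner y (u j)"
proof -
  have "cinner (T y) (u j) = cinner y (T (u j))" by (rule selfadj_cinner[OF T])
  also have "\<dots> = cinner (proj n u y) (T (u j))" using y by simp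
  also have "\<dots> = (\<Sum>i<n. if i = j then cinner y (u i) * cinner (u i) (T (u i)) else 0)"
    unfolding proj_def cinner_sum_scaleC_left
    by (intro sum.cong refl) (use u j in \<open>auto simp flip: selfadj_cinner[OF T]\<close>)
  also have "\<dots> = cinner y (u j) * cinner (T (u j)) (u j)"
    using j by (simp add: selfadj_cinner[OF T])
  also have "cinner (T (u j)) (u j) = of_real (qform T (u j))"
    using Im_qform[OF T] by (simp add: complex_eq_iff)
  finally show ?thesis by (simp add: mult.commute)
qed

lemma qform_compression:
  assumes T: "T \<in> selfadj"
    and u: "\<And>i j. i < n \<Longrightarrow> j < n \<Longrightarrow> i \<noteq> j \<Longrightarrow> cinner (T (u i)) (u j) = 0"
    and y: "proj n u y = y"
  shows "qform T y = (\<Sum>j<n. qform T (u j) * (cmod (cinner y (u j)))\<^sup>2)"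
proof -
  have "cinner (T y) y = (\<Sum>j<n. of_real (qform T (u j)) * (cinner y (u j) * cnj (cinner y (u j))))"
    unfolding cinner_fixed_by_proj[OF y]
    by (intro sum.cong refl) (simp add: cinner_compression[OF T u y] mult.assoc)
  also have "\<dots> = of_real (\<Sum>j<n. qform T (u j) * (cmod (cinner y (u j)))\<^sup>2)"
    by (simp only: complex_norm_square of_real_sum of_real_mult)
  finally show ?thesis by simp
qed

text \<open>Gauss quadrature: if the subspace contains \<open>x, Tx, \<dots>, T\<^sup>Nx\<close>, then the compression of \<open>T\<close>
  to it computes \<open>\<langle>p(T)x, x\<rangle>\<close> exactly for all polynomials \<open>p\<close> of degree at most \<open>N\<close>.\<close>

lemma qform_poly_op_compression:
  assumes T: "T \<in> selfadj"
    and u: "\<And>i j. i < n \<Longrightarrow> j < n \<Longrightarrow> i \<noteq> j \<Longrightarrow> cinner (T (u i)) (u j) = 0"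
    and Krylov: "\<And>i. i \<le> N \<Longrightarrow> proj n u (((o\<^sub>L) T ^^ i) id_blinfun x) = ((o\<^sub>L) T ^^ i) id_blinfun x"
    and p: "degree p \<le> N"
  shows "qform (poly_op p T) x = (\<Sum>j<n. poly p (qform T (u j)) * (cmod (cinner x (u j)))\<^sup>2)"
proof -
  have x: "proj n u x = x" using Krylov[of 0] by simp
  have pow: "cinner (((o\<^sub>L) T ^^ i) id_blinfun x) (u j) = of_real (qform T (u j) ^ i) * cinner x (u j)"
    if "i \<le> N" "j < n" for i j
    using that
  proof (induction i)
    case (Suc i)
    have "cinner (((o\<^sub>L) T ^^ Suc i) id_blinfun x) (u j) = cinner (T (((o\<^sub>L) T ^^ i) id_blinfun x)) (u j)"
      by simp
    also have "\<dots> = of_real (qform T (u j)) * cinner (((o\<^sub>L) T ^^ i) id_blinfun x) (u j)"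
      by (rule cinner_compression[OF T u Krylov]) (use Suc.prems in auto)
    finally show ?case using Suc by simp
  qed simp
  have pol: "cinner (poly_op p T x) (u j) = of_real (poly p (qform T (u j))) * cinner x (u j)" if "j < n" for j
  proof -
    have "cinner (poly_op p T x) (u j) =
        (\<Sum>i\<le>N. of_real (coeff p i) * (of_real (qform T (u j) ^ i) * cinner x (u j)))"
      by (simp add: poly_op_altdef[OF p] blinfun.sum_left cinner.sum_left blinfun.scaleR_left
          cinner_scaleR_left pow that)
    also have "\<dots> = of_real (\<Sum>i\<le>N. coeff p i * qform T (u j) ^ i) * cinner x (u j)"
      by (simp add: sum_distrib_right mult.assoc)
    also have "(\<Sum>i\<le>N. coeff p i * qform T (u j) ^ i) = poly p (qform T (u j))"
      unfolding poly_altdef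
      by (rule sum.mono_neutral_right) (use p in \<open>auto simp: coeff_eq_0\<close>)
    finally show ?thesis .
  qed
  have "cinner (poly_op p T x) x =
      (\<Sum>j<n. of_real (poly p (qform T (u j))) * (cinner x (u j) * cnj (cinner x (u j))))"
    unfolding cinner_fixed_by_proj[OF x]
    by (intro sum.cong refl) (simp add: pol mult.assoc)
  also have "\<dots> = of_real (\<Sum>j<n. poly p (qform T (u j)) * (cmod (cinner x (u j)))\<^sup>2)"
    by (simp only: complex_norm_square of_real_sum of_real_mult)
  finally show ?thesis by simp
qed

text \<open>The passage from matrices to operators on an arbitrary Hilbert space.  For a fixed vector
  \<open>x\<close> and a polynomial \<open>p\<close> close to \<open>g\<close>, both \<open>p(C)\<close> and \<open>p(D)\<close> are seen by the compressions of
  \<open>C\<close> and \<open>D\<close> to one finite-dimensional space, where the matrix inequality applies.  The factors \<open>\<alpha>\<close> and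
  \<open>\<beta>\<close> are handled on the level of eigenvalues, so that only functions of \<open>C\<close> and \<open>D\<close> occur.\<close>

lemma operator_monotone_Hilbert:
  fixes C D :: "'a::chilbert_space \<Rightarrow>\<^sub>L 'a"
  assumes g: "operator_monotone g" "continuous_on {a..b} g" and "a > 0" "\<alpha> > 0"
    and C: "between a b C" and D: "between a b D"
    and le: "\<And>x. qform C x \<le> \<alpha> * qform D x"
    and scale: "\<And>t. t \<in> {a..b} \<Longrightarrow> g (\<alpha> * t) \<le> \<beta> * g t" and "\<beta> \<ge> 0"
  shows "qform (op_fun g C) x \<le> \<beta> * qform (op_fun g D) x"
proof (rule field_le_epsilon)
  fix \<epsilon> :: real assume "\<epsilon> > 0"
  \<comment> \<open>Two errors of size \<open>d\<parallel>x\<parallel>\<^sup>2\<close> arise for \<open>C\<close> and two, multiplied by \<open>\<beta>\<close>, for \<open>D\<close>; the summand \<open>1\<close> covers \<open>x = 0\<close>.\<close>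
  define d where "d = \<epsilon> / (2 * (1 + \<beta>) * ((norm x)\<^sup>2 + 1))"
  have pos: "2 * (1 + \<beta>) * ((norm x)\<^sup>2 + 1) > 0"
    using \<open>\<beta> \<ge> 0\<close> by (intro mult_pos_pos add_pos_nonneg add_nonneg_pos; simp)
  then have d: "d > 0" using \<open>\<epsilon> > 0\<close> by (simp add: d_def)
  have "2 * (1 + \<beta>) * d * (norm x)\<^sup>2 \<le> 2 * (1 + \<beta>) * d * ((norm x)\<^sup>2 + 1)"
    using d \<open>\<beta> \<ge> 0\<close> by (intro mult_left_mono) auto
  also have "\<dots> = (2 * (1 + \<beta>) * ((norm x)\<^sup>2 + 1)) * d" by (simp only: mult_ac)
  also have "\<dots> = \<epsilon>" unfolding d_def using pos by (metis nonzero_mult_div_cancel_left less_irrefl times_divide_eq_right)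
  finally have d\<epsilon>: "2 * (1 + \<beta>) * d * (norm x)\<^sup>2 \<le> \<epsilon>" .
  obtain p where p: "\<And>t. t \<in> {a..b} \<Longrightarrow> \<bar>poly p t - g t\<bar> < d"
    using polynomial_approx[OF g(2) d] by metis
  define N where "N = degree p"
  let ?xs = "map (\<lambda>i. ((o\<^sub>L) C ^^ i) id_blinfun x) [0..<Suc N] @ map (\<lambda>i. ((o\<^sub>L) D ^^ i) id_blinfun x) [0..<Suc N]"
  obtain n e where e: "orthonormal n e" and fixed: "\<And>y. y \<in> set ?xs \<Longrightarrow> proj n e y = y"
    using Gram_Schmidt by blast
  have sa: "C \<in> selfadj" "D \<in> selfadj" using C D between_def by blast+
  obtain u where u: "orthonormal n u" "\<And>j. j < n \<Longrightarrow> proj n e (u j) = u j"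
    "\<And>i j. i < n \<Longrightarrow> j < n \<Longrightarrow> i \<noteq> j \<Longrightarrow> cinner (C (u i)) (u j) = 0"
    by (rule compression_eigenbasis[OF sa(1) e]) blast
  obtain v where v: "orthonormal n v" "\<And>j. j < n \<Longrightarrow> proj n e (v j) = v j"
    "\<And>i j. i < n \<Longrightarrow> j < n \<Longrightarrow> i \<noteq> j \<Longrightarrow> cinner (D (v i)) (v j) = 0"
    by (rule compression_eigenbasis[OF sa(2) e]) blast
  have fix_u: "proj n u y = y" and fix_v: "proj n v y = y" if "proj n e y = y" for y
    using orthonormal_complete[OF e u(1,2) that] orthonormal_complete[OF e v(1,2) that] by auto
  let ?c = "\<lambda>j. qform C (u j)" and ?d = "\<lambda>j. qform D (v j)"
  have unit: "norm (w j) = 1" if "orthonormal n w" "j < n" for w :: "nat \<Rightarrow> 'a" and j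
  proof -
    have "(norm (w j))\<^sup>2 = 1" using that by (simp add: orthonormal_def Re_cinner_self[symmetric])
    then show ?thesis by (simp add: power2_eq_1_iff) (use norm_ge_zero[of "w j"] in linarith)
  qed
  have c_ab: "?c j \<in> {a..b}" and d_ab: "?d j \<in> {a..b}" if "j < n" for j
    using C D unit[OF u(1) that] unit[OF v(1) that] unfolding between_def
    by (metis atLeastAtMost_iff mult.right_neutral power_one)+
  have Krylov: "proj n e (((o\<^sub>L) C ^^ i) id_blinfun x) = ((o\<^sub>L) C ^^ i) id_blinfun x"
      "proj n e (((o\<^sub>L) D ^^ i) id_blinfun x) = ((o\<^sub>L) D ^^ i) id_blinfun x" if "i \<le> N" for i
    using that by (intro fixed; auto simp del: upt_Suc)+
  have xfix: "proj n e x = x" using Krylov(1)[of 0] by simp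
  have quad: "qform (poly_op p C) x = (\<Sum>j<n. poly p (?c j) * (cmod (cinner x (u j)))\<^sup>2)"
    by (rule qform_poly_op_compression[where N = N, OF sa(1) u(3) fix_u[OF Krylov(1)]]) (auto simp: N_def)
  have quad': "qform (poly_op p D) x = (\<Sum>j<n. poly p (?d j) * (cmod (cinner x (v j)))\<^sup>2)"
    by (rule qform_poly_op_compression[where N = N, OF sa(2) v(3) fix_v[OF Krylov(2)]]) (auto simp: N_def)
  have weights: "(\<Sum>j<n. (cmod (cinner x (u j)))\<^sup>2) = (norm x)\<^sup>2" "(\<Sum>j<n. (cmod (cinner x (v j)))\<^sup>2) = (norm x)\<^sup>2"
    using norm_sq_fixed_by_proj fix_u[OF xfix] fix_v[OF xfix] by metis+
  \<comment> \<open>The coordinates of both families of eigenvectors in the common basis \<open>e\<close>.\<close>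
  define w w' where "w i j = cinner (u j) (e i)" and "w' i j = cinner (v j) (e i)" for i j
  have unitary: "unitary_entries n (\<lambda>i j. cinner (z j) (e i))"
    if "orthonormal n z" "\<And>j. j < n \<Longrightarrow> proj n e (z j) = z j" for z
    unfolding unitary_entries_def
  proof (intro allI impI)
    fix j k assume jk: "j < n" "k < n"
    have "(\<Sum>i<n. cnj (cinner (z j) (e i)) * cinner (z k) (e i)) = cinner (z k) (z j)"
      unfolding cinner_fixed_by_proj[OF that(2)[OF jk(1)]] by (simp add: mult.commute)
    then show "(\<Sum>i<n. cnj (cinner (z j) (e i)) * cinner (z k) (e i)) = (if j = k then 1 else 0)"
      using that(1) jk by (auto simp: orthonormal_def)
  qed
  have coord: "(\<Sum>i<n. cnj (cinner z (e i)) * c i) = cinner (\<Sum>i<n. c i *\<^sub>C e i) z" for z c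
    unfolding cinner_sum_scaleC_left
    by (intro sum.cong refl) (simp add: mult.commute cinner_commute[of _ z])
  have xsum: "(\<Sum>i<n. cinner x (e i) *\<^sub>C e i) = x" using xfix by (simp add: proj_def)
  have "unitary_form n w (\<lambda>i. g (?c i)) (\<lambda>i. cinner x (e i)) \<le>
      unitary_form n w' (\<lambda>i. g (\<alpha> * ?d i)) (\<lambda>i. cinner x (e i))"
  proof (rule operator_monotone_forms[OF g(1)])
    show "unitary_entries n w" "unitary_entries n w'"
      unfolding w_def w'_def using u v by (intro unitary; blast)+
    show "0 < ?c i" "0 < \<alpha> * ?d i" if "i < n" for i
      using c_ab[OF that] d_ab[OF that] \<open>a > 0\<close> \<open>\<alpha> > 0\<close> by auto
    fix c
    let ?y = "\<Sum>i<n. c i *\<^sub>C e i"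
    have y: "proj n e ?y = ?y" by (rule proj_sum[OF e])
    have "unitary_form n w ?c c = qform C ?y"
      unfolding unitary_form_def w_def coord
      using qform_compression[OF sa(1) u(3) fix_u[OF y]] by simp
    moreover have "unitary_form n w' (\<lambda>i. \<alpha> * ?d i) c = \<alpha> * qform D ?y"
      unfolding unitary_form_def w'_def coord
      using qform_compression[OF sa(2) v(3) fix_v[OF y]] by (simp add: sum_distrib_left mult.assoc)
    ultimately show "unitary_form n w ?c c \<le> unitary_form n w' (\<lambda>i. \<alpha> * ?d i) c"
      using le by simp
  qed
  then have mono: "(\<Sum>j<n. g (?c j) * (cmod (cinner x (u j)))\<^sup>2) \<le> (\<Sum>j<n. g (\<alpha> * ?d j) * (cmod (cinner x (v j)))\<^sup>2)"
    by (simp add: unitary_form_def w_def w'_def coord xsum)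
  have "qform (op_fun g C) x \<le> qform (poly_op p C) x + d * (norm x)\<^sup>2"
    using qform_op_fun_approx[OF C g(2) p, of x] by linarith
  also have "qform (poly_op p C) x \<le> (\<Sum>j<n. (g (?c j) + d) * (cmod (cinner x (u j)))\<^sup>2)"
    unfolding quad using p c_ab by (intro sum_mono mult_right_mono) (force simp: abs_less_iff)+
  also have "\<dots> = (\<Sum>j<n. g (?c j) * (cmod (cinner x (u j)))\<^sup>2) + d * (norm x)\<^sup>2"
    by (simp add: distrib_right sum.distrib sum_distrib_left[symmetric] weights)
  also note mono
  also have "(\<Sum>j<n. g (\<alpha> * ?d j) * (cmod (cinner x (v j)))\<^sup>2) \<le>
      (\<Sum>j<n. \<beta> * (poly p (?d j) + d) * (cmod (cinner x (v j)))\<^sup>2)"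
  proof (intro sum_mono mult_right_mono)
    fix j assume "j \<in> {..<n}"
    then have "?d j \<in> {a..b}" using d_ab by simp
    then have "g (\<alpha> * ?d j) \<le> \<beta> * g (?d j)" "g (?d j) \<le> poly p (?d j) + d"
      using scale p[of "?d j"] by auto
    then show "g (\<alpha> * ?d j) \<le> \<beta> * (poly p (?d j) + d)"
      using \<open>\<beta> \<ge> 0\<close> by (meson mult_left_mono order_trans)
  qed simp
  also have "\<dots> = \<beta> * (qform (poly_op p D) x + d * (norm x)\<^sup>2)"
    unfolding quad' by (simp add: distrib_left distrib_right sum.distrib sum_distrib_left weights(2)[symmetric] mult.assoc)
  also have "qform (poly_op p D) x \<le> qform (op_fun g D) x + d * (norm x)\<^sup>2"
    using qform_op_fun_approx[OF D g(2) p, of x] by linarith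
  finally have "qform (op_fun g C) x \<le> \<beta> * (qform (op_fun g D) x + d * (norm x)\<^sup>2 + d * (norm x)\<^sup>2) + d * (norm x)\<^sup>2 + d * (norm x)\<^sup>2"
    using \<open>\<beta> \<ge> 0\<close> by (simp add: mult_left_mono)
  also have "\<dots> = \<beta> * qform (op_fun g D) x + 2 * (1 + \<beta>) * d * (norm x)\<^sup>2"
    by (simp add: algebra_simps)
  also note d\<epsilon>
  finally show "qform (op_fun g C) x \<le> \<beta> * qform (op_fun g D) x + \<epsilon>" by simp
qed


section \<open>Operator monotone functions on the half-line\<close>

lemma quadratic_form_2_nonneg:
  fixes X Y q s t :: real
  assumes "X \<ge> 0" "Y \<ge> 0" "q\<^sup>2 \<le> X * Y"
  shows "2 * q * s * t \<le> X * s\<^sup>2 + Y * t\<^sup>2"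
proof (cases "X = 0")
  case True
  then have "q = 0" using assms(3) by simp
  then show ?thesis using assms(1,2) by simp
next
  case False
  have "X * (X * s\<^sup>2 + Y * t\<^sup>2 - 2 * q * s * t) = (X * s - q * t)\<^sup>2 + (X * Y - q\<^sup>2) * t\<^sup>2"
    by (simp add: power2_eq_square algebra_simps)
  also have "\<dots> \<ge> 0" using assms(3) by simp
  finally show ?thesis using False assms(1) by (simp add: zero_le_mult_iff)
qed

lemma quadratic_form_2_discriminant:
  fixes X Y q :: real
  assumes "\<And>s t. 2 * q * s * t \<le> X * s\<^sup>2 + Y * t\<^sup>2"
  shows "X \<ge> 0" "Y \<ge> 0" "q\<^sup>2 \<le> X * Y"
proof -
  show X: "X \<ge> 0" and Y: "Y \<ge> 0" using assms[of 1 0] assms[of 0 1] by simp_all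
  show "q\<^sup>2 \<le> X * Y"
  proof (cases "X = 0")
    case True
    \<comment> \<open>With \<open>X = 0\<close> the form is affine in \<open>s\<close>, and \<open>s = Y + 1\<close> is large enough to force \<open>q = 0\<close>.\<close>
    have "2 * q * (Y + 1) * q \<le> Y * q\<^sup>2" using assms[of "Y + 1" q] True by simp
    then have "(Y + 2) * q\<^sup>2 \<le> 0" by (simp add: power2_eq_square algebra_simps)
    then have "q\<^sup>2 \<le> 0" using Y by (simp add: mult_le_0_iff)
    then show ?thesis using True by simp
  next
    case False
    have "2 * q * q * X \<le> X * q\<^sup>2 + Y * X\<^sup>2" by (rule assms)
    then have "X * q\<^sup>2 \<le> X * (X * Y)" by (simp add: power2_eq_square algebra_simps)
    then show ?thesis using False X by simp
  qed
qed

text \<open>The matrix with eigenvalues \<open>a, b\<close> and eigenvectors \<open>(c, s), (-s, c)\<close> has diagonal entries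
  \<open>c\<^sup>2a + s\<^sup>2b\<close>, \<open>s\<^sup>2a + c\<^sup>2b\<close> and off-diagonal entry \<open>cs(a - b)\<close>.  The hypothesis says that it lies
  below \<open>diag(x, K)\<close>, the conclusion that \<open>g\<close> preserves this.\<close>

lemma operator_monotone_2x2:
  assumes g: "operator_monotone g" and cs: "c\<^sup>2 + s\<^sup>2 = (1::real)"
    and pos: "a > 0" "b > 0" "x > 0" "K > 0"
    and le: "c\<^sup>2 * a + s\<^sup>2 * b \<le> x" "s\<^sup>2 * a + c\<^sup>2 * b \<le> K"
      "(c * s * (a - b))\<^sup>2 \<le> (x - (c\<^sup>2 * a + s\<^sup>2 * b)) * (K - (s\<^sup>2 * a + c\<^sup>2 * b))"
  shows "c\<^sup>2 * g a + s\<^sup>2 * g b \<le> g x"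
    and "(c * s * (g a - g b))\<^sup>2 \<le> (g x - (c\<^sup>2 * g a + s\<^sup>2 * g b)) * (g K - (s\<^sup>2 * g a + c\<^sup>2 * g b))"
proof -
  define w :: "nat \<Rightarrow> nat \<Rightarrow> complex" where
    "w i j = of_real (if i = 0 then (if j = 0 then c else - s) else (if j = 0 then s else c))" for i j
  define w' :: "nat \<Rightarrow> nat \<Rightarrow> complex" where "w' i j = (if i = j then 1 else 0)" for i j
  let ?e = "\<lambda>(a::real) b (i::nat). if i = 0 then a else b"
  have two: "(\<Sum>i<2. f i) = f 0 + f (Suc 0)" for f :: "nat \<Rightarrow> 'b::comm_monoid_add"
    by (simp add: numeral_2_eq_2)
  have cs': "of_real c * of_real c + of_real s * of_real s = (1::complex)"
    using cs by (metis of_real_1 of_real_add of_real_mult power2_eq_square)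
  have uw: "unitary_entries 2 w"
    unfolding unitary_entries_def two w_def using cs' by (auto simp: less_2_cases_iff add.commute)
  have uw': "unitary_entries 2 w'"
    unfolding unitary_entries_def two w'_def by (auto simp: less_2_cases_iff)
  have form: "unitary_form 2 w (?e a b) v =
      (c\<^sup>2 * a + s\<^sup>2 * b) * (cmod (v 0))\<^sup>2 + (s\<^sup>2 * a + c\<^sup>2 * b) * (cmod (v 1))\<^sup>2
      + 2 * (c * s * (a - b)) * (Re (v 0) * Re (v 1) + Im (v 0) * Im (v 1))" for a b v
    unfolding unitary_form_def two w_def
    by (simp add: cmod_power2) (simp add: power2_eq_square algebra_simps)
  have form': "unitary_form 2 w' (?e a b) v = a * (cmod (v 0))\<^sup>2 + b * (cmod (v 1))\<^sup>2" for a b v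
    unfolding unitary_form_def two w'_def by simp
  have comp: "(\<lambda>i. g (?e a b i)) = ?e (g a) (g b)" for a b by auto
  have main: "unitary_form 2 w (?e (g a) (g b)) v \<le> unitary_form 2 w' (?e (g x) (g K)) v" for v
    unfolding comp[symmetric]
  proof (rule operator_monotone_forms[OF g uw _ uw'])
    fix v :: "nat \<Rightarrow> complex"
    have sq: "2 * (c * s * (a - b)) * y * z \<le>
        (x - (c\<^sup>2 * a + s\<^sup>2 * b)) * y\<^sup>2 + (K - (s\<^sup>2 * a + c\<^sup>2 * b)) * z\<^sup>2" for y z
      using le by (intro quadratic_form_2_nonneg) auto
    show "unitary_form 2 w (?e a b) v \<le> unitary_form 2 w' (?e x K) v"
      unfolding form form' cmod_power2
      using sq[of "Re (v 0)" "Re (v 1)"] sq[of "Im (v 0)" "Im (v 1)"] by (simp add: algebra_simps)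
  qed (use pos in auto)
  have "2 * (c * s * (g a - g b)) * y * z \<le>
      (g x - (c\<^sup>2 * g a + s\<^sup>2 * g b)) * y\<^sup>2 + (g K - (s\<^sup>2 * g a + c\<^sup>2 * g b)) * z\<^sup>2" for y z
    using main[of "\<lambda>i. of_real (if i = 0 then y else z)"] unfolding form form' by (simp add: algebra_simps)
  note quadratic_form_2_discriminant[OF this]
  then show "c\<^sup>2 * g a + s\<^sup>2 * g b \<le> g x"
    and "(c * s * (g a - g b))\<^sup>2 \<le> (g x - (c\<^sup>2 * g a + s\<^sup>2 * g b)) * (g K - (s\<^sup>2 * g a + c\<^sup>2 * g b))"
    by simp_all
qed

text \<open>The \<open>2 \<times> 2\<close> matrix with eigenvalues \<open>a, b\<close> and upper left entry \<open>la + (1-l)b < x\<close> lies below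
  \<open>diag(x, K)\<close> for large \<open>K\<close>; the upper left entries of the images under \<open>g\<close> give the claim.\<close>

lemma operator_monotone_almost_concave:
  assumes g: "operator_monotone g" and "a > 0" "b > 0" "0 \<le> l" "l \<le> 1" "l * a + (1 - l) * b < x"
  shows "l * g a + (1 - l) * g b \<le> g x"
proof -
  define c s where "c = sqrt l" and "s = sqrt (1 - l)"
  have c2: "c\<^sup>2 = l" and s2: "s\<^sup>2 = 1 - l" using assms by (simp_all add: c_def s_def)
  define p r where "p = l * a + (1 - l) * b" and "r = (1 - l) * a + l * b"
  define K where "K = r + (c * s * (a - b))\<^sup>2 / (x - p)"
  have comb: "t * y + (1 - t) * z > 0" if "0 \<le> t" "t \<le> 1" "y > 0" "z > 0" for t y z :: real
    using that by (cases "t = 0") (simp_all add: add_pos_nonneg)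
  have p: "p < x" "p > 0" using assms comb[of l a b] by (simp_all add: p_def)
  have r: "r > 0" using assms comb[of "1 - l" a b] by (simp add: r_def)
  have K: "K \<ge> r" "K > 0" and prod: "(x - p) * (K - r) = (c * s * (a - b))\<^sup>2"
    using p r by (auto simp: K_def intro: add_pos_nonneg)
  have "c\<^sup>2 * g a + s\<^sup>2 * g b \<le> g x"
    by (rule operator_monotone_2x2(1)[OF g, of c s a b x K])
      (use assms p K prod in \<open>auto simp: c2 s2 p_def[symmetric] r_def[symmetric]\<close>)
  then show ?thesis by (simp add: c2 s2)
qed

lemma operator_monotone_mono:
  assumes g: "operator_monotone g" and "0 < s" "s \<le> t"
  shows "g s \<le> g t"
  using operator_monotone_2x2(1)[OF g, of 1 0 s 1 t 1] assms by simp

lemma le_0_if_small_multiples: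
  fixes A B c :: real
  assumes "c > 0" "\<And>e. 0 < e \<Longrightarrow> e < c \<Longrightarrow> A \<le> e * B"
  shows "A \<le> 0"
proof (rule ccontr)
  assume "\<not> A \<le> 0"
  define e where "e = min (c / 2) (A / (2 * (\<bar>B\<bar> + 1)))"
  have e: "0 < e" "e < c" "e \<le> A / (2 * (\<bar>B\<bar> + 1))"
    using \<open>\<not> A \<le> 0\<close> assms(1) by (auto simp: e_def)
  have "A \<le> e * B" using assms(2) e by blast
  also have "\<dots> \<le> e * (\<bar>B\<bar> + 1)" using e(1) by (intro mult_left_mono) auto
  also have "\<dots> \<le> A / (2 * (\<bar>B\<bar> + 1)) * (\<bar>B\<bar> + 1)" using e(3) by (intro mult_right_mono) auto
  also have "\<dots> = A / 2" by (simp add: field_simps)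
  finally show False using \<open>\<not> A \<le> 0\<close> by simp
qed

text \<open>Passing to the limit \<open>x \<rightarrow> la + (1-l)b\<close> needs left continuity of \<open>g\<close> at \<open>a\<close>, which comes
  from the same inequality applied to \<open>a/2\<close> and \<open>a\<close>.\<close>

lemma operator_monotone_concave:
  assumes g: "operator_monotone g" and ab: "a > 0" "b > 0" and l: "0 \<le> l" "l \<le> 1"
  shows "l * g a + (1 - l) * g b \<le> g (l * a + (1 - l) * b)"
proof (cases "l = 0")
  case False
  then have "l > 0" using l by simp
  have "l * g a + (1 - l) * g b - g (l * a + (1 - l) * b) \<le> 0"
  proof (rule le_0_if_small_multiples[of 1])
    fix \<mu> :: real assume \<mu>: "0 < \<mu>" "\<mu> < 1"
    define a' where "a' = a * (1 - \<mu> / 4)"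
    have a': "a' > 0" "a' < a" using ab \<mu> by (auto simp: a'_def)
    have "l * a' < l * a" using a' \<open>l > 0\<close> by simp
    then have 1: "l * g a' + (1 - l) * g b \<le> g (l * a + (1 - l) * b)"
      using a' ab l by (intro operator_monotone_almost_concave[OF g]) auto
    have "\<mu> * (a / 2) + (1 - \<mu>) * a < a'"
      using ab \<mu> by (simp add: a'_def algebra_simps)
    then have "\<mu> * g (a / 2) + (1 - \<mu>) * g a \<le> g a'"
      using ab \<mu> by (intro operator_monotone_almost_concave[OF g]) auto
    then have "l * (\<mu> * g (a / 2) + (1 - \<mu>) * g a) \<le> l * g a'"
      using \<open>l > 0\<close> by (intro mult_left_mono) auto
    with 1 show "l * g a + (1 - l) * g b - g (l * a + (1 - l) * b) \<le> \<mu> * (l * (g a - g (a / 2)))"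
      by (simp add: algebra_simps)
  qed simp
  then show ?thesis by simp
qed simp

text \<open>Concavity as a comparison of the slopes of two adjacent chords.\<close>

lemma operator_monotone_three_chord:
  assumes g: "operator_monotone g" and "0 < s" "s < t" "t \<le> u"
  shows "(g u - g t) * (t - s) \<le> (g t - g s) * (u - t)"
proof -
  define l where "l = (u - t) / (u - s)"
  have us: "u - s > 0" using assms by simp
  have l: "0 \<le> l" "l \<le> 1" using assms us by (auto simp: l_def)
  have l1: "1 - l = (t - s) / (u - s)" using us by (simp add: l_def field_simps)
  have "l * s + (1 - l) * u = ((u - t) * s + (t - s) * u) / (u - s)"
    unfolding l1 by (simp add: l_def add_divide_distrib)
  also have "(u - t) * s + (t - s) * u = t * (u - s)" by (simp add: algebra_simps)
  finally have "l * s + (1 - l) * u = t" using us by simp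
  moreover have "l * g s + (1 - l) * g u \<le> g (l * s + (1 - l) * u)"
    using assms l by (intro operator_monotone_concave) auto
  ultimately have "((u - t) * g s + (t - s) * g u) / (u - s) \<le> g t"
    unfolding l1 by (simp add: l_def add_divide_distrib)
  then have "(u - t) * g s + (t - s) * g u \<le> g t * (u - s)" using us by (simp add: divide_le_eq)
  then show ?thesis by (simp add: algebra_simps)
qed

lemma operator_monotone_continuous:
  assumes g: "operator_monotone g"
  shows "continuous_on {0<..} g"
proof -
  have "convex_on {0<..} (\<lambda>t. - g t)"
  proof (rule convex_onI)
    fix t x y :: real assume "0 < t" "t < 1" "x \<in> {0<..}" "y \<in> {0<..}"
    then show "- g ((1 - t) *\<^sub>R x + t *\<^sub>R y) \<le> (1 - t) * - g x + t * - g y"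
      using operator_monotone_concave[OF g, of x y "1 - t"] by simp
  qed simp
  then have "continuous_on {0<..} (\<lambda>t. - g t)" by (intro convex_on_continuous) auto
  then have "continuous_on {0<..} (\<lambda>t. - (- g t))" by (rule continuous_on_minus)
  then show ?thesis by simp
qed

text \<open>The chord slopes from a point \<open>e\<close> near \<open>0\<close> are compared; positivity of \<open>g\<close> replaces a value at \<open>0\<close>.\<close>

lemma operator_monotone_ratio_antimono:
  assumes g: "operator_monotone g" and pos: "\<And>t. t > 0 \<Longrightarrow> g t > 0" and "0 < s" "s < t"
  shows "s * g t \<le> t * g s"
proof -
  have "s * g t - t * g s \<le> 0"
  proof (rule le_0_if_small_multiples[OF \<open>0 < s\<close>])
    fix e assume e: "0 < e" "e < s"
    have "(g t - g s) * (s - e) \<le> (g s - g e) * (t - s)"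
      using e assms by (intro operator_monotone_three_chord) auto
    also have "\<dots> \<le> g s * (t - s)"
      using pos[OF e(1)] \<open>s < t\<close> by (intro mult_right_mono) auto
    finally show "s * g t - t * g s \<le> e * (g t - g s)" by (simp add: algebra_simps)
  qed
  then show ?thesis by simp
qed

text \<open>If \<open>g(t)/t\<close> takes the same value \<open>k\<close> at two points \<open>s < t\<close>, then \<open>g(u) = ku\<close> for \<open>u \<le> t\<close> by
  concavity.  To pass \<open>t\<close>, a \<open>2 \<times> 2\<close> matrix with eigenvalues \<open>t/4, t/2\<close> is compared with
  \<open>diag(x, u)\<close>, where \<open>x < t\<close> is as small as possible: then the conclusion for \<open>g\<close> is sharp in the
  entry \<open>x\<close> and bounds \<open>g(u)\<close> from below.\<close>

lemma operator_monotone_linear: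
  assumes g: "operator_monotone g" and pos: "\<And>t. t > 0 \<Longrightarrow> g t > 0"
    and st: "0 < s" "s < t" and eq: "s * g t = t * g s" and "u > 0"
  shows "g u = g s / s * u"
proof -
  define k where "k = g s / s"
  have k: "k > 0" "g s = k * s" "g t = k * t"
    using st pos[OF st(1)] eq by (auto simp: k_def field_simps)
  have low: "g v = k * v" if v: "0 < v" "v \<le> t" for v
  proof (cases v s rule: linorder_cases)
    case less
    have "v * g s \<le> s * g v" by (rule operator_monotone_ratio_antimono[OF g pos v(1) less])
    then have "k * v \<le> g v" using st(1) by (simp add: k(2) mult.commute)
    have "(g t - g s) * (s - v) \<le> (g s - g v) * (t - s)"
      using operator_monotone_three_chord[OF g v(1) less] st(2) by simp
    then have "k * (s - v) * (t - s) \<le> (g s - g v) * (t - s)"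
      unfolding k(2,3) by (simp add: algebra_simps)
    then have "k * (s - v) \<le> g s - g v" using st(2) by simp
    then have "g v \<le> k * v" by (simp add: k(2) algebra_simps)
    with \<open>k * v \<le> g v\<close> show ?thesis by simp
  next
    case equal
    then show ?thesis by (simp add: k(2))
  next
    case greater
    show ?thesis
    proof (cases "v = t")
      case False
      then have "v < t" using v(2) by simp
      have "s * g v \<le> v * g s" by (rule operator_monotone_ratio_antimono[OF g pos st(1) greater])
      then have "g v \<le> k * v" using st(1) by (simp add: k(2) mult.left_commute)
      moreover have "v * g t \<le> t * g v" by (rule operator_monotone_ratio_antimono[OF g pos v(1) \<open>v < t\<close>])
      then have "k * v \<le> g v" using st by (simp add: k(3) mult.left_commute mult.commute[of k])
      ultimately show ?thesis by simp
    qed (simp add: k(3))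
  qed
  show ?thesis
  proof (cases "u \<le> t")
    case False
    then have "t < u" "0 < t" using st by auto
    have "t * g u \<le> u * g t" by (rule operator_monotone_ratio_antimono[OF g pos \<open>0 < t\<close> \<open>t < u\<close>])
    then have "g u \<le> k * u" using \<open>0 < t\<close> by (simp add: k(3) mult.left_commute mult.commute[of k])
    define p q x where "p = 3 * t / 8" and "q = t / 8" and "x = p + q\<^sup>2 / (u - p)"
    have up: "u - p \<ge> 5 * t / 8" using \<open>t < u\<close> by (simp add: p_def)
    then have up0: "u - p > 0" using \<open>0 < t\<close> by linarith
    have "q\<^sup>2 / (u - p) \<le> q\<^sup>2 / (5 * t / 8)"
      using up up0 \<open>0 < t\<close> by (intro divide_left_mono mult_pos_pos) auto
    also have "\<dots> = t / 40" using \<open>0 < t\<close> by (simp add: q_def power2_eq_square)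
    finally have "x \<le> p + t / 40" by (simp add: x_def)
    moreover have "0 < q\<^sup>2 / (u - p)" using \<open>0 < t\<close> up0 by (simp add: q_def)
    ultimately have x: "p < x" "x \<le> t" "x > 0"
      using \<open>0 < t\<close> by (simp_all add: x_def p_def)
    define c where "c = sqrt (1 / 2)"
    have c2: "c\<^sup>2 = 1 / 2" "c * c = 1 / 2" by (simp_all add: c_def)
    have diag: "c\<^sup>2 * (t / 4) + c\<^sup>2 * (t / 2) = p" by (simp add: c2 p_def)
    have off: "(c * c * (y * (t / 4) - y * (t / 2)))\<^sup>2 = y\<^sup>2 * q\<^sup>2" for y
      unfolding c2(2) by (simp add: q_def power2_eq_square)
    have prod: "(x - p) * (u - p) = q\<^sup>2" using up0 by (simp add: x_def)
    have "(c * c * (g (t / 4) - g (t / 2)))\<^sup>2 \<le>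
      (g x - (c\<^sup>2 * g (t / 4) + c\<^sup>2 * g (t / 2))) * (g u - (c\<^sup>2 * g (t / 4) + c\<^sup>2 * g (t / 2)))"
    proof (rule operator_monotone_2x2(2)[OF g])
      show "c\<^sup>2 * (t / 4) + c\<^sup>2 * (t / 2) \<le> x" "c\<^sup>2 * (t / 4) + c\<^sup>2 * (t / 2) \<le> u"
        unfolding diag using x up0 by auto
      show "(c * c * (t / 4 - t / 2))\<^sup>2 \<le>
        (x - (c\<^sup>2 * (t / 4) + c\<^sup>2 * (t / 2))) * (u - (c\<^sup>2 * (t / 4) + c\<^sup>2 * (t / 2)))"
        unfolding diag prod using off[of 1] by simp
    qed (use \<open>0 < t\<close> \<open>u > 0\<close> x in \<open>auto simp: c2(1)\<close>)
    moreover have gs: "g (t / 4) = k * (t / 4)" "g (t / 2) = k * (t / 2)" "g x = k * x"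
      using \<open>0 < t\<close> x by (intro low; simp)+
    moreover have "c\<^sup>2 * (k * (t / 4)) + c\<^sup>2 * (k * (t / 2)) = k * p"
      unfolding diag[symmetric] by (simp add: algebra_simps)
    ultimately have "k\<^sup>2 * q\<^sup>2 \<le> (k * x - k * p) * (g u - k * p)" by (simp only: off)
    then have "k\<^sup>2 * q\<^sup>2 * (u - p) \<le> (k * x - k * p) * (g u - k * p) * (u - p)"
      using up0 by (intro mult_right_mono) auto
    also have "\<dots> = k * ((x - p) * (u - p)) * (g u - k * p)" by (simp add: algebra_simps)
    also have "\<dots> = k * q\<^sup>2 * (g u - k * p)" by (simp only: prod)
    finally have "(k * q\<^sup>2) * (k * (u - p)) \<le> (k * q\<^sup>2) * (g u - k * p)"
      by (simp add: power2_eq_square mult_ac)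
    moreover have "k * q\<^sup>2 > 0" using k(1) \<open>0 < t\<close> by (simp add: q_def)
    ultimately have "k * (u - p) \<le> g u - k * p" by (rule mult_left_le_imp_le)
    then show ?thesis using \<open>g u \<le> k * u\<close> by (simp add: k_def[symmetric] algebra_simps)
  qed (use low \<open>u > 0\<close> in \<open>simp add: k_def\<close>)
qed

text \<open>Equality at two points would make \<open>g\<close> linear, hence the identity by \<open>g(1) = 1\<close>.\<close>

lemma operator_monotone_ratio_strict:
  assumes g: "operator_monotone g" and pos: "\<And>t. t > 0 \<Longrightarrow> g t > 0" and "g 1 = 1"
    and nontrivial: "v > 0" "g v \<noteq> v" and st: "0 < s" "s < t"
  shows "s * g t < t * g s"
proof (rule ccontr)
  assume "\<not> s * g t < t * g s"
  then have eq: "s * g t = t * g s"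
    using operator_monotone_ratio_antimono[OF g pos st] by simp
  have lin: "g u = g s / s * u" if "u > 0" for u
    by (rule operator_monotone_linear[OF g pos st eq that])
  have "g s / s = 1" using lin[of 1] \<open>g 1 = 1\<close> by simp
  then show False using lin[OF nontrivial(1)] nontrivial(2) by simp
qed

text \<open>On \<open>[1,L]\<close> the logarithmic derivative \<open>\<rho>\<^sub>0/(1 + (\<alpha>-1)\<rho>\<^sub>0)\<close> of the left side is at most
  \<open>\<rho>/\<alpha>\<close>; equality holds at \<open>\<alpha> = L\<close>.\<close>

lemma linear_le_powr:
  fixes \<rho>0 L :: real
  assumes \<rho>0: "0 < \<rho>0" "\<rho>0 < 1" and \<alpha>: "1 \<le> \<alpha>" "\<alpha> \<le> L"
  defines "\<rho> \<equiv> \<rho>0 * L / (1 - \<rho>0 + \<rho>0 * L)"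
  shows "1 + (\<alpha> - 1) * \<rho>0 \<le> \<alpha> powr \<rho>"
proof -
  define \<phi> where "\<phi> x = \<rho> * ln x - ln (1 + (x - 1) * \<rho>0)" for x
  have den: "1 - \<rho>0 + \<rho>0 * L > 0" using \<rho>0 \<alpha> by (intro add_pos_nonneg) auto
  have pos: "1 + (x - 1) * \<rho>0 > 0" if "x \<ge> 1" for x
    using that \<rho>0 by (intro add_pos_nonneg) auto
  have "\<phi> 1 \<le> \<phi> \<alpha>"
  proof (rule DERIV_nonneg_imp_nondecreasing[OF \<alpha>(1)])
    fix x assume x: "1 \<le> x" "x \<le> \<alpha>"
    have "DERIV \<phi> x :> \<rho> * (1 / x) - 1 / (1 + (x - 1) * \<rho>0) * \<rho>0"
      unfolding \<phi>_def using x pos[OF x(1)] by (auto intro!: derivative_eq_intros)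
    moreover have "\<rho>0 / (1 + (x - 1) * \<rho>0) \<le> \<rho> / x"
    proof -
      have "x * (1 - \<rho>0) \<le> L * (1 - \<rho>0)" using x \<alpha> \<rho>0 by (intro mult_right_mono) auto
      then have "x * (1 - \<rho>0 + \<rho>0 * L) \<le> L * (1 + (x - 1) * \<rho>0)" by (simp add: algebra_simps)
      then have "\<rho>0 * (x * (1 - \<rho>0 + \<rho>0 * L)) \<le> \<rho>0 * (L * (1 + (x - 1) * \<rho>0))"
        using \<rho>0 by (intro mult_left_mono) auto
      then have "\<rho>0 * x \<le> \<rho> * (1 + (x - 1) * \<rho>0)"
        using den by (simp add: \<rho>_def pos_le_divide_eq mult_ac)
      then show ?thesis using x pos[OF x(1)] by (simp add: divide_le_eq pos_le_divide_eq mult_ac)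
    qed
    ultimately show "\<exists>y. DERIV \<phi> x :> y \<and> y \<ge> 0"
      by (intro exI[of _ "\<rho> * (1 / x) - 1 / (1 + (x - 1) * \<rho>0) * \<rho>0"]) auto
  qed
  then have "ln (1 + (\<alpha> - 1) * \<rho>0) \<le> \<rho> * ln \<alpha>" by (simp add: \<phi>_def)
  then have "exp (ln (1 + (\<alpha> - 1) * \<rho>0)) \<le> exp (\<rho> * ln \<alpha>)" by simp
  then show ?thesis using pos[OF \<alpha>(1)] \<alpha>(1) by (simp add: powr_def)
qed

text \<open>The scalar contraction estimate.  The chord from \<open>s = a/2\<close> to \<open>t\<close> bounds \<open>g(\<alpha>t)\<close> by
  \<open>g(t)(1 + (\<alpha>-1)\<kappa>(t))\<close>, where \<open>\<kappa>(t) < 1\<close> because \<open>g(t)/t\<close> is strictly decreasing.\<close>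

lemma operator_monotone_contraction:
  assumes g: "operator_monotone g" and pos: "\<And>t. t > 0 \<Longrightarrow> g t > 0" and "g 1 = 1"
    and nontrivial: "v > 0" "g v \<noteq> v" and ab: "0 < a" "a \<le> b" and "L \<ge> 1"
  obtains \<rho> where "0 < \<rho>" "\<rho> < 1"
    "\<And>t \<alpha>. t \<in> {a..b} \<Longrightarrow> 1 \<le> \<alpha> \<Longrightarrow> \<alpha> \<le> L \<Longrightarrow> g (\<alpha> * t) \<le> \<alpha> powr \<rho> * g t"
proof -
  define s where "s = a / 2"
  define \<kappa> where "\<kappa> t = t * (g t - g s) / ((t - s) * g t)" for t
  have s: "0 < s" "s < a" using ab by (auto simp: s_def)
  have cont_g: "continuous_on {a..b} g"
    by (rule continuous_on_subset[OF operator_monotone_continuous[OF g]]) (use ab in auto)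
  have nz: "(t - s) * g t > 0" if "t \<in> {a..b}" for t
    using that s ab pos[of t] by auto
  have "continuous_on {a..b} \<kappa>"
    unfolding \<kappa>_def by (intro continuous_intros cont_g) (use nz in fastforce)
  then obtain t0 where t0: "t0 \<in> {a..b}" "\<And>t. t \<in> {a..b} \<Longrightarrow> \<kappa> t \<le> \<kappa> t0"
    using continuous_attains_sup[OF compact_Icc, of a b \<kappa>] ab by auto
  have "s * g t0 < t0 * g s"
    by (rule operator_monotone_ratio_strict[OF g pos \<open>g 1 = 1\<close> nontrivial]) (use s t0 in auto)
  then have "t0 * (g t0 - g s) < (t0 - s) * g t0" by (simp add: algebra_simps)
  then have "\<kappa> t0 < 1" using nz[OF t0(1)] by (simp add: \<kappa>_def divide_less_eq)
  define \<rho>0 where "\<rho>0 = max (\<kappa> t0) (1 / 2)"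
  have \<rho>0: "0 < \<rho>0" "\<rho>0 < 1" using \<open>\<kappa> t0 < 1\<close> by (auto simp: \<rho>0_def)
  define \<rho> where "\<rho> = \<rho>0 * L / (1 - \<rho>0 + \<rho>0 * L)"
  have den: "1 - \<rho>0 + \<rho>0 * L > 0" using \<rho>0 \<open>L \<ge> 1\<close> by (intro add_pos_nonneg) auto
  have "0 < \<rho>" "\<rho> < 1" using \<rho>0 \<open>L \<ge> 1\<close> den by (auto simp: \<rho>_def divide_less_eq)
  moreover have "g (\<alpha> * t) \<le> \<alpha> powr \<rho> * g t" if t: "t \<in> {a..b}" and \<alpha>: "1 \<le> \<alpha>" "\<alpha> \<le> L" for t \<alpha>
  proof -
    have ts: "0 < t" "s < t" "t \<le> \<alpha> * t" and gt: "g t > 0"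
      using t ab s \<alpha>(1) pos[of t] by (auto simp: mult_le_cancel_right1)
    have "(g (\<alpha> * t) - g t) * (t - s) \<le> (g t - g s) * (\<alpha> * t - t)"
      by (rule operator_monotone_three_chord[OF g s(1) ts(2,3)])
    also have "\<dots> = (\<alpha> - 1) * (t * (g t - g s))" by (simp add: algebra_simps)
    also have "t * (g t - g s) = \<kappa> t * ((t - s) * g t)" using ts(2) gt by (simp add: \<kappa>_def)
    also have "(\<alpha> - 1) * (\<kappa> t * ((t - s) * g t)) \<le> (\<alpha> - 1) * (\<rho>0 * ((t - s) * g t))"
      using t0(2)[OF t] nz[OF t] \<alpha>(1) by (intro mult_left_mono mult_right_mono) (auto simp: \<rho>0_def)
    finally have "(g (\<alpha> * t) - g t) * (t - s) \<le> ((\<alpha> - 1) * \<rho>0 * g t) * (t - s)" by (simp add: mult_ac)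
    then have "g (\<alpha> * t) - g t \<le> (\<alpha> - 1) * \<rho>0 * g t" using ts(2) by simp
    then have "g (\<alpha> * t) \<le> (1 + (\<alpha> - 1) * \<rho>0) * g t" by (simp add: algebra_simps)
    also have "\<dots> \<le> \<alpha> powr \<rho> * g t"
      unfolding \<rho>_def using gt \<rho>0 \<alpha> by (intro mult_right_mono linear_le_powr) auto
    finally show ?thesis .
  qed
  ultimately show ?thesis using that by blast
qed


section \<open>The Thompson metric\<close>

lemma posdef_ops_qform_pos:
  assumes "X \<in> posdef_ops" "x \<noteq> 0"
  shows "qform X x > 0"
proof -
  obtain a b where "0 < a" "between a b X" using posdef_ops_between[OF assms(1)] by metis
  then have "a * (norm x)\<^sup>2 \<le> qform X x" "a * (norm x)\<^sup>2 > 0"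
    using assms(2) by (simp_all add: between_def)
  then show ?thesis by linarith
qed

lemma posdef_ops_qform_nonneg: "X \<in> posdef_ops \<Longrightarrow> 0 \<le> qform X x"
  using posdef_ops_qform_pos[of X x] by (cases "x = 0") (auto simp: cinner.zero_left)

lemma op_le_scaleR_iff:
  assumes "X \<in> selfadj" "Y \<in> selfadj"
  shows "op_le X (\<alpha> *\<^sub>R Y) \<longleftrightarrow> (\<forall>x. qform X x \<le> \<alpha> * qform Y x)"
  using assms by (simp add: op_le_iff selfadj_scaleR blinfun.scaleR_left cinner_scaleR_left)

lemma posdef_ops_dominated:
  assumes "X \<in> posdef_ops" "Y \<in> posdef_ops"
  obtains \<alpha> where "\<alpha> > 0" "\<And>x. qform X x \<le> \<alpha> * qform Y x"
proof -
  obtain a b where X: "0 < a" "a \<le> b" "between a b X" using posdef_ops_between[OF assms(1)] by metis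
  obtain c d where Y: "0 < c" "c \<le> d" "between c d Y" using posdef_ops_between[OF assms(2)] by metis
  have "qform X x \<le> b / c * qform Y x" for x
  proof -
    have "qform X x \<le> b / c * (c * (norm x)\<^sup>2)" using X Y by (simp add: between_def)
    also have "\<dots> \<le> b / c * qform Y x"
      using X Y by (intro mult_left_mono) (auto simp: between_def)
    finally show ?thesis .
  qed
  then show ?thesis using that[of "b / c"] X Y by simp
qed

lemma thompson_ratio_le:
  assumes "X \<in> selfadj" "Y \<in> selfadj" "\<alpha> > 0" "\<And>x. qform X x \<le> \<alpha> * qform Y x"
  shows "thompson_ratio X Y \<le> \<alpha>"
  unfolding thompson_ratio_def
  by (rule cInf_lower) (use assms op_le_scaleR_iff in \<open>auto intro!: bdd_belowI[of _ 0]\<close>)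

text \<open>The inequalities that define the Thompson ratio are closed in \<open>\<alpha>\<close>, so the infimum is attained.\<close>

lemma qform_le_thompson_ratio:
  assumes "X \<in> posdef_ops" "Y \<in> posdef_ops"
  shows "qform X x \<le> thompson_ratio X Y * qform Y x"
proof (cases "x = 0")
  case False
  let ?S = "{\<alpha>. \<alpha> > 0 \<and> op_le X (\<alpha> *\<^sub>R Y)}"
  note sa = assms[THEN posdef_ops_selfadj]
  have Y: "qform Y x > 0" by (rule posdef_ops_qform_pos[OF assms(2) False])
  obtain \<alpha> where "\<alpha> > 0" "\<And>x. qform X x \<le> \<alpha> * qform Y x"
    using posdef_ops_dominated[OF assms] by blast
  then have "\<alpha> \<in> ?S" by (simp add: op_le_scaleR_iff[OF sa])
  then have "qform X x / qform Y x \<le> Inf ?S"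
    by (intro cInf_greatest) (use Y op_le_scaleR_iff[OF sa] in \<open>auto simp: pos_divide_le_eq\<close>)
  then show ?thesis using Y by (simp add: thompson_ratio_def pos_divide_le_eq)
qed (simp add: cinner.zero_left)

lemma thompson_ratio_pos:
  assumes "X \<in> posdef_ops" "Y \<in> posdef_ops" and "(z::'a::chilbert_space) \<noteq> 0"
  shows "thompson_ratio X (Y :: 'a \<Rightarrow>\<^sub>L 'a) > 0"
proof -
  have "0 < thompson_ratio X Y * qform Y z"
    using posdef_ops_qform_pos[OF assms(1,3)] qform_le_thompson_ratio[OF assms(1,2), of z] by linarith
  then show ?thesis using posdef_ops_qform_pos[OF assms(2,3)] by (simp add: zero_less_mult_iff)
qed

text \<open>In the zero space every Thompson ratio is \<open>0\<close>, outside the domain of the logarithm; hence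
  the nonzero vector \<open>z\<close>.\<close>

lemma thompson_dist_le_iff:
  assumes X: "X \<in> posdef_ops" and Y: "Y \<in> posdef_ops" and z: "(z::'a::chilbert_space) \<noteq> 0"
  shows "thompson_dist X (Y :: 'a \<Rightarrow>\<^sub>L 'a) \<le> d \<longleftrightarrow>
    (\<forall>x. qform X x \<le> exp d * qform Y x \<and> qform Y x \<le> exp d * qform X x)"
proof -
  have half: "ln (thompson_ratio X Y) \<le> d \<longleftrightarrow> (\<forall>x. qform X x \<le> exp d * qform Y x)"
    if "X \<in> posdef_ops" "Y \<in> posdef_ops" for X Y :: "'a \<Rightarrow>\<^sub>L 'a"
  proof
    assume "ln (thompson_ratio X Y) \<le> d"
    then have "thompson_ratio X Y \<le> exp d"
      using thompson_ratio_pos[OF that z] by (metis exp_le_cancel_iff exp_ln)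
    then have "thompson_ratio X Y * qform Y x \<le> exp d * qform Y x" for x
      using posdef_ops_qform_nonneg[OF that(2)] by (intro mult_right_mono) auto
    then show "\<forall>x. qform X x \<le> exp d * qform Y x"
      using qform_le_thompson_ratio[OF that] order_trans by blast
  next
    assume "\<forall>x. qform X x \<le> exp d * qform Y x"
    then have "thompson_ratio X Y \<le> exp d"
      using that posdef_ops_selfadj by (intro thompson_ratio_le) auto
    then show "ln (thompson_ratio X Y) \<le> d"
      using thompson_ratio_pos[OF that z] by (metis ln_exp ln_le_cancel_iff exp_gt_zero)
  qed
  show ?thesis unfolding thompson_dist_def using half[OF X Y] half[OF Y X] by auto
qed

lemma thompson_dist_nonneg:
  assumes X: "X \<in> posdef_ops" and Y: "Y \<in> posdef_ops" and z: "(z::'a::chilbert_space) \<noteq> 0"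
  shows "0 \<le> thompson_dist X (Y :: 'a \<Rightarrow>\<^sub>L 'a)"
proof -
  let ?d = "thompson_dist X Y"
  have le: "qform X z \<le> exp ?d * qform Y z" "qform Y z \<le> exp ?d * qform X z"
    using thompson_dist_le_iff[OF X Y z, of ?d] by auto
  have "qform X z + qform Y z \<le> exp ?d * (qform X z + qform Y z)"
    using le by (simp add: distrib_left)
  moreover have "qform X z + qform Y z > 0"
    using posdef_ops_qform_pos[OF X z] posdef_ops_qform_pos[OF Y z] by simp
  ultimately have "1 \<le> exp ?d" by simp
  then show ?thesis by simp
qed

lemma thompson_dist_triangle_ball:
  assumes A: "A \<in> posdef_ops" and X: "X \<in> posdef_ops" and Y: "Y \<in> posdef_ops" and z: "(z::'a::chilbert_space) \<noteq> 0"
    and "thompson_dist A X \<le> r" "thompson_dist A (Y :: 'a \<Rightarrow>\<^sub>L 'a) \<le> s"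
  shows "thompson_dist X Y \<le> r + s"
proof -
  have AX: "qform A x \<le> exp r * qform X x" "qform X x \<le> exp r * qform A x"
   and AY: "qform A x \<le> exp s * qform Y x" "qform Y x \<le> exp s * qform A x" for x
    using thompson_dist_le_iff[OF A X z] thompson_dist_le_iff[OF A Y z] assms(5,6) by blast+
  have "qform X x \<le> exp r * (exp s * qform Y x)" "qform Y x \<le> exp s * (exp r * qform X x)" for x
    using AX AY by (meson exp_ge_zero mult_left_mono order_trans)+
  then show ?thesis unfolding thompson_dist_le_iff[OF X Y z] exp_add by (simp add: mult_ac)
qed


section \<open>Operator means and congruence\<close>

lemma qform_congruence:
  assumes "S \<in> selfadj"
  shows "qform (S o\<^sub>L T o\<^sub>L S) x = qform T (S x)"
  by (simp add: selfadj_cinner[OF assms])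

lemma qform_sqrt:
  assumes "A \<in> posdef_ops"
  shows "qform A x = (norm (op_powr A (1/2) x))\<^sup>2"
    and "qform A (op_powr A (-1/2) x) = (norm x)\<^sup>2"
proof -
  note P = op_powr_half[OF assms]
  show *: "qform A x = (norm (op_powr A (1/2) x))\<^sup>2" for x
  proof -
    have "A x = op_powr A (1/2) (op_powr A (1/2) x)"
      by (metis P(5) blinfun_apply_blinfun_compose)
    then show ?thesis
      using selfadj_cinner[OF P(1), of "op_powr A (1/2) x" x] by (simp add: Re_cinner_self)
  qed
  have "op_powr A (1/2) (op_powr A (-1/2) x) = x"
    by (metis P(3) blinfun_apply_blinfun_compose blinfun_apply_id_blinfun id_apply)
  then show "qform A (op_powr A (-1/2) x) = (norm x)\<^sup>2" by (simp add: *)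
qed

text \<open>Bounds relative to \<open>A\<close> become bounds relative to the identity, because
  \<open>\<langle>A A\<^sup>-\<^sup>1\<^sup>/\<^sup>2x, A\<^sup>-\<^sup>1\<^sup>/\<^sup>2x\<rangle> = \<parallel>x\<parallel>\<^sup>2\<close>.\<close>

lemma between_relative:
  assumes A: "A \<in> posdef_ops" and X: "X \<in> selfadj"
    and "\<And>x. a * qform A x \<le> qform X x" "\<And>x. qform X x \<le> b * qform A x"
  shows "between a b (op_powr A (-1/2) o\<^sub>L X o\<^sub>L op_powr A (-1/2))"
  unfolding between_def qform_congruence[OF op_powr_half(2)[OF A]]
  using selfadj_congruence[OF op_powr_half(2)[OF A] X] assms(3,4) by (metis qform_sqrt(2)[OF A])

lemma posdef_ops_congruence:
  assumes A: "A \<in> posdef_ops" and "0 < m" "between m k G"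
  shows "op_powr A (1/2) o\<^sub>L G o\<^sub>L op_powr A (1/2) \<in> posdef_ops"
proof -
  obtain a b where ab: "0 < a" "a \<le> b" "between a b A" using posdef_ops_between[OF A] by metis
  note P = op_powr_half[OF A]
  have G: "G \<in> selfadj" "\<And>x. m * (norm x)\<^sup>2 \<le> qform G x" "\<And>x. qform G x \<le> k * (norm x)\<^sup>2"
    using assms(3) by (auto simp: between_def)
  \<comment> \<open>On the zero space \<open>k\<close> may be negative, and the estimates below multiply by it.\<close>
  let ?k = "max k 0"
  have "between (m * a) (?k * b) (op_powr A (1/2) o\<^sub>L G o\<^sub>L op_powr A (1/2))"
    unfolding between_def qform_congruence[OF P(1)]
  proof (intro conjI allI selfadj_congruence P(1) G(1))
    fix x
    let ?y = "op_powr A (1/2) x"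
    have y: "a * (norm x)\<^sup>2 \<le> (norm ?y)\<^sup>2" "(norm ?y)\<^sup>2 \<le> b * (norm x)\<^sup>2"
      using ab(3) unfolding between_def qform_sqrt(1)[OF A] by auto
    show "m * a * (norm x)\<^sup>2 \<le> qform G ?y"
    proof -
      have "m * (a * (norm x)\<^sup>2) \<le> m * (norm ?y)\<^sup>2"
        using y(1) \<open>0 < m\<close> by (intro mult_left_mono) auto
      then show ?thesis using G(2)[of ?y] by (simp only: mult.assoc)
    qed
    have "k * (norm ?y)\<^sup>2 \<le> ?k * (norm ?y)\<^sup>2" by (intro mult_right_mono) auto
    also have "\<dots> \<le> ?k * (b * (norm x)\<^sup>2)" using y(2) by (intro mult_left_mono) auto
    finally show "qform G ?y \<le> ?k * b * (norm x)\<^sup>2"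
      using G(3)[of ?y] by (simp only: mult.assoc)
  qed
  then show ?thesis by (rule between_posdef_ops[rotated]) (use ab assms(2) in simp)
qed

text \<open>For \<open>g\<close> the identity, the square roots of \<open>A\<close> cancel in \<open>M(A, B)\<close>.\<close>

lemma right_trivial_if_identity:
  fixes M :: "('a::chilbert_space \<Rightarrow>\<^sub>L 'a) \<Rightarrow> ('a \<Rightarrow>\<^sub>L 'a) \<Rightarrow> ('a \<Rightarrow>\<^sub>L 'a)"
  assumes M: "\<And>A B. A \<in> posdef_ops \<Longrightarrow> B \<in> posdef_ops \<Longrightarrow> M A B = op_powr A (1/2) o\<^sub>L
      op_fun g (op_powr A (-1/2) o\<^sub>L B o\<^sub>L op_powr A (-1/2)) o\<^sub>L op_powr A (1/2)"
    and g: "\<And>t. t > 0 \<Longrightarrow> g t = t"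
  shows "right_trivial M"
  unfolding right_trivial_def
proof (intro ballI)
  fix B A :: "'a \<Rightarrow>\<^sub>L 'a" assume B: "B \<in> posdef_ops" and A: "A \<in> posdef_ops"
  note P = op_powr_half[OF A]
  let ?C = "op_powr A (-1/2) o\<^sub>L B o\<^sub>L op_powr A (-1/2)"
  obtain k l where k: "k > 0" "\<And>x. qform A x \<le> k * qform B x"
    and l: "l > 0" "\<And>x. qform B x \<le> l * qform A x"
    using posdef_ops_dominated[OF A B] posdef_ops_dominated[OF B A] by metis
  have C: "between (1 / k) l ?C"
    by (rule between_relative[OF A posdef_ops_selfadj[OF B]])
      (use k l in \<open>auto simp: divide_le_eq mult.commute\<close>)
  have "op_fun g ?C = op_fun (\<lambda>t. t) ?C"
    by (rule op_fun_cong[OF C, symmetric])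
      (use k(1) in \<open>auto intro!: g[symmetric] continuous_intros elim: order_less_le_trans[rotated]\<close>)
  then have "M A B = op_powr A (1/2) o\<^sub>L ?C o\<^sub>L op_powr A (1/2)"
    using M[OF A B] op_fun_ident[OF C] by simp
  moreover have "op_powr A (1/2) (op_powr A (-1/2) x) = x" "op_powr A (-1/2) (op_powr A (1/2) x) = x" for x
    by (metis P(3,4) blinfun_apply_blinfun_compose blinfun_apply_id_blinfun id_apply)+
  ultimately show "M A B = B" by (intro blinfun_eqI) simp
qed

lemma right_trivial_zero_space:
  fixes M :: "('a::chilbert_space \<Rightarrow>\<^sub>L 'a) \<Rightarrow> ('a \<Rightarrow>\<^sub>L 'a) \<Rightarrow> ('a \<Rightarrow>\<^sub>L 'a)"
  assumes "\<And>z::'a. z = 0"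
  shows "right_trivial M"
proof -
  have "S = T" for S T :: "'a \<Rightarrow>\<^sub>L 'a" by (rule blinfun_eqI) (metis assms)
  then show ?thesis by (simp add: right_trivial_def)
qed

theorem theorem4p9:
  fixes M :: "('a::chilbert_space \<Rightarrow>\<^sub>L 'a) \<Rightarrow> ('a \<Rightarrow>\<^sub>L 'a) \<Rightarrow> ('a \<Rightarrow>\<^sub>L 'a)"
  assumes "M \<in> operator_means"
  shows "(\<not> right_trivial M \<longrightarrow>
           (\<forall>A\<in>posdef_ops. \<forall>r>0. \<exists>\<rho>. 0 < \<rho> \<and> \<rho> < 1 \<and>
             (\<forall>X\<in>thompson_cball A r. \<forall>Y\<in>thompson_cball A r.
               thompson_dist (M A X) (M A Y) \<le> \<rho> * thompson_dist X Y))) \<and>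
         (right_trivial M \<longrightarrow>
           (\<forall>A\<in>posdef_ops. \<forall>X\<in>posdef_ops. \<forall>Y\<in>posdef_ops.
             thompson_dist (M A X) (M A Y) \<le> thompson_dist X Y))"
proof (intro conjI impI ballI allI)
  fix A X Y :: "'a \<Rightarrow>\<^sub>L 'a"
  assume "right_trivial M" "A \<in> posdef_ops" "X \<in> posdef_ops" "Y \<in> posdef_ops"
  then show "thompson_dist (M A X) (M A Y) \<le> thompson_dist X Y"
    by (simp add: right_trivial_def)
next
  fix A :: "'a \<Rightarrow>\<^sub>L 'a" and r :: real
  assume nontrivial: "\<not> right_trivial M" and A: "A \<in> posdef_ops" and "0 < r"
  obtain g where pos: "\<And>t. t > 0 \<Longrightarrow> g t > 0" and g: "operator_monotone g" and "g 1 = 1"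
    and M: "\<And>A B. A \<in> posdef_ops \<Longrightarrow> B \<in> posdef_ops \<Longrightarrow> M A B = op_powr A (1/2) o\<^sub>L
      op_fun g (op_powr A (-1/2) o\<^sub>L B o\<^sub>L op_powr A (-1/2)) o\<^sub>L op_powr A (1/2)"
    using assms unfolding operator_means_def by blast
  obtain z :: 'a where z: "z \<noteq> 0" using right_trivial_zero_space nontrivial by blast
  obtain v where v: "v > 0" "g v \<noteq> v" using right_trivial_if_identity[OF M] nontrivial by blast
  define a b where "a = exp (- r)" and "b = exp r"
  have ab: "0 < a" "a \<le> b" using \<open>0 < r\<close> by (auto simp: a_def b_def)
  \<comment> \<open>Two points of the ball have distance at most \<open>2r\<close>, so only \<open>\<alpha> \<le> e\<^sup>2\<^sup>r\<close> occurs.\<close>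
  have L: "exp (r + r) \<ge> 1" using \<open>0 < r\<close> by simp
  obtain \<rho> where \<rho>: "0 < \<rho>" "\<rho> < 1"
    "\<And>t \<alpha>. t \<in> {a..b} \<Longrightarrow> 1 \<le> \<alpha> \<Longrightarrow> \<alpha> \<le> exp (r + r) \<Longrightarrow> g (\<alpha> * t) \<le> \<alpha> powr \<rho> * g t"
    by (rule operator_monotone_contraction[OF g pos \<open>g 1 = 1\<close> v ab L]) blast+
  have cont: "continuous_on {a..b} g"
    by (rule continuous_on_subset[OF operator_monotone_continuous[OF g]]) (use ab in auto)
  let ?R = "op_powr A (1/2)" and ?N = "op_powr A (-1/2)"
  let ?C = "\<lambda>X. ?N o\<^sub>L X o\<^sub>L ?N"
  have ball: "X \<in> posdef_ops" "thompson_dist A X \<le> r" "between a b (?C X)" "M A X \<in> posdef_ops"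
    if "X \<in> thompson_cball A r" for X
  proof -
    show X: "X \<in> posdef_ops" and d: "thompson_dist A X \<le> r"
      using that by (auto simp: thompson_cball_def)
    have AX: "qform A x \<le> exp r * qform X x" "qform X x \<le> exp r * qform A x" for x
      using thompson_dist_le_iff[OF A X z] d by blast+
    show C: "between a b (?C X)"
    proof (rule between_relative[OF A posdef_ops_selfadj[OF X]])
      show "a * qform A x \<le> qform X x" for x
        using mult_left_mono[OF AX(1)[of x], of "exp (- r)"]
        by (simp add: a_def mult.assoc[symmetric] exp_add[symmetric])
    qed (use AX(2) in \<open>simp add: b_def\<close>)
    have "between (g a) (g b) (op_fun g (?C X))"
      by (rule between_op_fun[OF C cont]) (use ab operator_monotone_mono[OF g] in auto)
    then show "M A X \<in> posdef_ops"
      unfolding M[OF A X] by (rule posdef_ops_congruence[OF A pos[OF ab(1)]])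
  qed
  have one_sided: "qform (M A X) x \<le> exp (\<rho> * thompson_dist X Y) * qform (M A Y) x"
    if X: "X \<in> thompson_cball A r" and Y: "Y \<in> thompson_cball A r"
      and le: "\<And>x. qform X x \<le> exp (thompson_dist X Y) * qform Y x" for X Y x
  proof -
    let ?\<alpha> = "exp (thompson_dist X Y)"
    have \<alpha>: "1 \<le> ?\<alpha>" "?\<alpha> \<le> exp (r + r)"
      using thompson_dist_nonneg[OF ball(1)[OF X] ball(1)[OF Y] z]
        thompson_dist_triangle_ball[OF A ball(1)[OF X] ball(1)[OF Y] z ball(2)[OF X] ball(2)[OF Y]]
      by simp_all
    have "qform (op_fun g (?C X)) (?R x) \<le> ?\<alpha> powr \<rho> * qform (op_fun g (?C Y)) (?R x)"
    proof (rule operator_monotone_Hilbert[OF g cont ab(1) _ ball(3)[OF X] ball(3)[OF Y]])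
      show "qform (?C X) y \<le> ?\<alpha> * qform (?C Y) y" for y
        unfolding qform_congruence[OF op_powr_half(2)[OF A]] by (rule le)
    qed (use \<rho>(3) \<alpha> in auto)
    then show ?thesis
      unfolding M[OF A ball(1)[OF X]] M[OF A ball(1)[OF Y]] qform_congruence[OF op_powr_half(1)[OF A]]
      by (simp add: powr_def)
  qed
  have "thompson_dist (M A X) (M A Y) \<le> \<rho> * thompson_dist X Y"
    if X: "X \<in> thompson_cball A r" and Y: "Y \<in> thompson_cball A r" for X Y
  proof -
    have le: "qform X x \<le> exp (thompson_dist X Y) * qform Y x" "qform Y x \<le> exp (thompson_dist X Y) * qform X x" for x
      using thompson_dist_le_iff[OF ball(1)[OF X] ball(1)[OF Y] z, of "thompson_dist X Y"] by auto
    have sym: "thompson_dist Y X = thompson_dist X Y" by (simp add: thompson_dist_def max.commute)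
    show ?thesis
      unfolding thompson_dist_le_iff[OF ball(4)[OF X] ball(4)[OF Y] z]
      using one_sided[OF X Y le(1)] one_sided[OF Y X] le(2) by (simp add: sym)
  qed
  then show "\<exists>\<rho>. 0 < \<rho> \<and> \<rho> < 1 \<and> (\<forall>X\<in>thompson_cball A r. \<forall>Y\<in>thompson_cball A r.
      thompson_dist (M A X) (M A Y) \<le> \<rho> * thompson_dist X Y)"
    using \<rho>(1,2) by blast
qed

end
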